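(* Suppose that $m\geq n>2$ and let $A=\{i_1<i_2<\cdots<i_n\}\subseteq [m]$. Then the complex $\mathcal{VR}(\mathcal{F}^m_{\preceq A},2)$ is homotopy equivalent to a wedge sum of copies of $S^3$. More specifically, if $A=\{1,2,3\}$, then $$\mathcal{VR}(\mathcal{F}^m_{\preceq A},2)\simeq S^3,$$ and for any $A\subseteq[m]$ with $\{1,2,3\}\prec A$, $$\mathcal{VR}(\mathcal{F}^m_{\preceq A},2)\simeq \Big(\bigvee_{r_A} S^3\Big)\vee \mathcal{VR}(\mathcal{F}^m_{\prec A},2).$$ Therefore, if $A\subseteq [m]$ with $|A|\geq 3$, then $\mathcal{VR}(\mathcal{F}^m_{\preceq A},2)$ is homotopy equivalent to the wedge sum of $\sum\{r_B: B\subseteq[m],\ \{1,2,3\}\preceq B\preceq A\}$ copies of $S^3$.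
   Context: $[m]=\{1,\dots,m\}$, and $\mathcal{P}([m])$ is the set of all subsets of $[m]$ (including $\emptyset$). Any collection of subsets of $[m]$ is a finite metric space with $d(A,B)=|A\Delta B|$ (size of the symmetric difference). For a metric space $X$ and $r\ge 0$, the Vietoris-Rips complex $\mathcal{VR}(X,r)$ is the simplicial complex with vertex set $X$ whose simplices are the nonempty finite subsets of $X$ of diameter at most $r$. The total order $\prec$ on $\mathcal{P}([m])$: $A\prec B$ if either $|A|<|B|$, or $|A|=|B|=n$, $A=\{i_1<\dots<i_n\}$, $B=\{j_1<\dots<j_n\}$ and there is a $k$ with $i_k<j_k$ and $i_\ell=j_\ell$ for all $\ell<k$. Write $A\preceq B$ for $A\prec B$ or $A=B$. $\mathcal{F}^m_{\prec A}=\{B\subseteq[m]: B\prec A\}$ and $\mathcal{F}^m_{\preceq A}=\mathcal{F}^m_{\prec A}\cup\{A\}$. For $A=\{i_1<\cdots<i_n\}\subseteq[m]$, set $d_1=i_1$ and $d_\ell=i_\ell-(i_{\ell-1}+1)$ for $\ell=2,\dots,n$, and $$r_A= \sum_{k=2}^{n-2}\binom{k}{2}+\sum_{\ell=1}^{n-2}d_{\ell}\binom{n-\ell}{2},$$ where a sum whose upper limit is less than its lower limit is $0$. $\simeq$ denotes homotopy equivalence (of geometric realizations), $\vee$ wedge sum, and $\bigvee_k X$ the wedge sum of $k$ copies of $X$. *)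

theory Defs
  imports "HOL-Analysis.Analysis"
begin

section \<open>Vietoris--Rips complexes and geometric realization\<close>

definition finite_diameter :: "('a \<Rightarrow> 'a \<Rightarrow> real) \<Rightarrow> 'a set \<Rightarrow> real" where
  "finite_diameter d S = Max {d x y | x y. x \<in> S \<and> y \<in> S}"

definition vietoris_rips :: "('a \<Rightarrow> 'a \<Rightarrow> real) \<Rightarrow> 'a set \<Rightarrow> real \<Rightarrow> 'a set set" where
  "vietoris_rips d X r = {S. S \<subseteq> X \<and> finite S \<and> S \<noteq> {} \<and> finite_diameter d S \<le> r}"

text \<open>
  An abstract simplicial complex is given by its set \<open>K\<close> of nonempty finite simplices.  The points
  of its realization are the barycentric coordinate functions of points in the simplices of \<open>K\<close>.
\<close>

definition support :: "('a \<Rightarrow> real) \<Rightarrow> 'a set" where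
  "support f = {v. f v \<noteq> 0}"

definition realization_points :: "'a set set \<Rightarrow> ('a \<Rightarrow> real) set" where
  "realization_points K = {f. (\<forall>v. 0 \<le> f v) \<and> support f \<in> K \<and> (\<Sum>v\<in>support f. f v) = 1}"

definition closed_simplex :: "'a set set \<Rightarrow> 'a set \<Rightarrow> ('a \<Rightarrow> real) set" where
  "closed_simplex K S = {f \<in> realization_points K. support f \<subseteq> S}"

text \<open>
  The realization carries the weak topology: a set is open iff its trace on each closed simplex is
  open in the Euclidean topology of that simplex.
\<close>

definition geometric_realization :: "'a set set \<Rightarrow> ('a \<Rightarrow> real) topology" where
  "geometric_realization K = topology (\<lambda>U. U \<subseteq> realization_points K \<and>
     (\<forall>S\<in>K. openin (subtopology (powertop_real UNIV) (closed_simplex K S))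
              (U \<inter> closed_simplex K S)))"

lemma openin_geometric_realization:
  "openin (geometric_realization K) U \<longleftrightarrow> U \<subseteq> realization_points K \<and>
     (\<forall>S\<in>K. openin (subtopology (powertop_real UNIV) (closed_simplex K S))
              (U \<inter> closed_simplex K S))"
proof -
  let ?P = "\<lambda>U. U \<subseteq> realization_points K \<and>
     (\<forall>S\<in>K. openin (subtopology (powertop_real UNIV) (closed_simplex K S))
              (U \<inter> closed_simplex K S))"
  have "istopology ?P"
    unfolding istopology_def
  proof (intro conjI allI impI)
    fix U V assume U: "?P U" and V: "?P V"
    show "U \<inter> V \<subseteq> realization_points K" using U by blast
    show "\<forall>S\<in>K. openin (subtopology (powertop_real UNIV) (closed_simplex K S))
            (U \<inter> V \<inter> closed_simplex K S)"
    proof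
      fix S assume "S \<in> K"
      moreover have "U \<inter> V \<inter> closed_simplex K S
          = (U \<inter> closed_simplex K S) \<inter> (V \<inter> closed_simplex K S)" by blast
      ultimately show "openin (subtopology (powertop_real UNIV) (closed_simplex K S))
            (U \<inter> V \<inter> closed_simplex K S)"
        using U V by (simp only: openin_Int)
    qed
  next
    fix \<U> assume \<U>: "\<forall>U\<in>\<U>. ?P U"
    show "\<Union>\<U> \<subseteq> realization_points K" using \<U> by blast
    show "\<forall>S\<in>K. openin (subtopology (powertop_real UNIV) (closed_simplex K S))
            (\<Union>\<U> \<inter> closed_simplex K S)"
    proof
      fix S assume "S \<in> K"
      then show "openin (subtopology (powertop_real UNIV) (closed_simplex K S))
            (\<Union>\<U> \<inter> closed_simplex K S)"
        unfolding Int_Union2 using \<U> by (intro openin_Union) blast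
    qed
  qed
  then show ?thesis by (simp add: geometric_realization_def)
qed

lemma topspace_geometric_realization:
  "topspace (geometric_realization K) = realization_points K"
proof (rule subset_antisym)
  show "topspace (geometric_realization K) \<subseteq> realization_points K"
    using openin_geometric_realization openin_topspace by blast
  have "openin (geometric_realization K) (realization_points K)"
  proof -
    have "realization_points K \<inter> closed_simplex K S
        = topspace (subtopology (powertop_real UNIV) (closed_simplex K S))" for S
      by (auto simp: closed_simplex_def)
    then show ?thesis
      unfolding openin_geometric_realization by (metis openin_topspace subset_refl)
  qed
  then show "realization_points K \<subseteq> topspace (geometric_realization K)"
    by (rule openin_subset)
qed

section \<open>Wedge sums\<close>

text \<open>
  \<open>wedge_sum I X p\<close> is the wedge sum of the spaces \<open>X i\<close> at the basepoints \<open>p i\<close>.  The point \<open>None\<close>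
  is the common basepoint and \<open>Some (i, x)\<close> is the point \<open>x \<noteq> p i\<close> of the \<open>i\<close>-th summand; the
  topology is the quotient topology, i.e. the final one for the inclusions of the summands.  The
  empty wedge sum is a one-point space.
\<close>

definition wedge_incl :: "('i \<Rightarrow> 'a) \<Rightarrow> 'i \<Rightarrow> 'a \<Rightarrow> ('i \<times> 'a) option" where
  "wedge_incl p i x = (if x = p i then None else Some (i, x))"

definition wedge_sum ::
    "'i set \<Rightarrow> ('i \<Rightarrow> 'a topology) \<Rightarrow> ('i \<Rightarrow> 'a) \<Rightarrow> ('i \<times> 'a) option topology" where
  "wedge_sum I X p = topology (\<lambda>U.
     U \<subseteq> insert None (\<Union>i\<in>I. wedge_incl p i ` topspace (X i)) \<and>
     (\<forall>i\<in>I. openin (X i) {x \<in> topspace (X i). wedge_incl p i x \<in> U}))"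

lemma openin_wedge_sum:
  "openin (wedge_sum I X p) U \<longleftrightarrow>
     U \<subseteq> insert None (\<Union>i\<in>I. wedge_incl p i ` topspace (X i)) \<and>
     (\<forall>i\<in>I. openin (X i) {x \<in> topspace (X i). wedge_incl p i x \<in> U})"
proof -
  let ?W = "insert None (\<Union>i\<in>I. wedge_incl p i ` topspace (X i))"
  let ?Q = "\<lambda>i U. {x \<in> topspace (X i). wedge_incl p i x \<in> U}"
  have "istopology (\<lambda>U. U \<subseteq> ?W \<and> (\<forall>i\<in>I. openin (X i) (?Q i U)))"
    unfolding istopology_def
  proof (intro conjI allI impI)
    fix U V
    assume UV: "U \<subseteq> ?W \<and> (\<forall>i\<in>I. openin (X i) (?Q i U))" "V \<subseteq> ?W \<and> (\<forall>i\<in>I. openin (X i) (?Q i V))"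
    show "U \<inter> V \<subseteq> ?W" using UV by blast
    have "?Q i (U \<inter> V) = ?Q i U \<inter> ?Q i V" for i by blast
    then show "\<forall>i\<in>I. openin (X i) (?Q i (U \<inter> V))" using UV by auto
  next
    fix \<U> assume \<U>: "\<forall>U\<in>\<U>. U \<subseteq> ?W \<and> (\<forall>i\<in>I. openin (X i) (?Q i U))"
    show "\<Union>\<U> \<subseteq> ?W" using \<U> by blast
    have "?Q i (\<Union>\<U>) = \<Union>(?Q i ` \<U>)" for i by blast
    then show "\<forall>i\<in>I. openin (X i) (?Q i (\<Union>\<U>))" using \<U> by auto
  qed
  then show ?thesis by (simp add: wedge_sum_def)
qed

text \<open>The wedge sum of two pointed spaces of possibly different types, encoded in the same way.\<close>

definition wedge_inl :: "'a \<Rightarrow> 'a \<Rightarrow> ('a + 'b) option" where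
  "wedge_inl a x = (if x = a then None else Some (Inl x))"

definition wedge_inr :: "'b \<Rightarrow> 'b \<Rightarrow> ('a + 'b) option" where
  "wedge_inr b y = (if y = b then None else Some (Inr y))"

definition wedge :: "'a topology \<Rightarrow> 'a \<Rightarrow> 'b topology \<Rightarrow> 'b \<Rightarrow> ('a + 'b) option topology" where
  "wedge X a Y b = topology (\<lambda>U.
     U \<subseteq> insert None (wedge_inl a ` topspace X \<union> wedge_inr b ` topspace Y) \<and>
     openin X {x \<in> topspace X. wedge_inl a x \<in> U} \<and>
     openin Y {y \<in> topspace Y. wedge_inr b y \<in> U})"

lemma openin_wedge:
  "openin (wedge X a Y b) U \<longleftrightarrow>
     U \<subseteq> insert None (wedge_inl a ` topspace X \<union> wedge_inr b ` topspace Y) \<and>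
     openin X {x \<in> topspace X. wedge_inl a x \<in> U} \<and>
     openin Y {y \<in> topspace Y. wedge_inr b y \<in> U}"
proof -
  let ?W = "insert None (wedge_inl a ` topspace X \<union> wedge_inr b ` topspace Y)"
  let ?L = "\<lambda>U. {x \<in> topspace X. wedge_inl a x \<in> U}"
  let ?R = "\<lambda>U. {y \<in> topspace Y. wedge_inr b y \<in> U}"
  have "istopology (\<lambda>U. U \<subseteq> ?W \<and> openin X (?L U) \<and> openin Y (?R U))"
    unfolding istopology_def
  proof (intro conjI allI impI)
    fix U V
    assume UV: "U \<subseteq> ?W \<and> openin X (?L U) \<and> openin Y (?R U)"
               "V \<subseteq> ?W \<and> openin X (?L V) \<and> openin Y (?R V)"
    show "U \<inter> V \<subseteq> ?W" using UV by blast
    have "?L (U \<inter> V) = ?L U \<inter> ?L V" "?R (U \<inter> V) = ?R U \<inter> ?R V" by blast+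
    then show "openin X (?L (U \<inter> V))" "openin Y (?R (U \<inter> V))" using UV by auto
  next
    fix \<U> assume \<U>: "\<forall>U\<in>\<U>. U \<subseteq> ?W \<and> openin X (?L U) \<and> openin Y (?R U)"
    show "\<Union>\<U> \<subseteq> ?W" using \<U> by blast
    have "?L (\<Union>\<U>) = \<Union>(?L ` \<U>)" "?R (\<Union>\<U>) = \<Union>(?R ` \<U>)" by blast+
    then show "openin X (?L (\<Union>\<U>))" "openin Y (?R (\<Union>\<U>))" using \<U> by auto
  qed
  then show ?thesis by (simp add: wedge_def)
qed

text \<open>Since \<open>nsphere\<close> is homogeneous, the choice of its basepoint is immaterial.\<close>

definition sphere_basepoint :: "nat \<Rightarrow> real" where
  "sphere_basepoint i = (if i = 0 then 1 else 0)"

definition sphere_bouquet :: "nat \<Rightarrow> nat \<Rightarrow> (nat \<times> (nat \<Rightarrow> real)) option topology" where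
  "sphere_bouquet k q = wedge_sum {..<k} (\<lambda>_. nsphere q) (\<lambda>_. sphere_basepoint)"

definition bouquet_basepoint :: "(nat \<times> (nat \<Rightarrow> real)) option" where
  "bouquet_basepoint = None"

section \<open>Families of finite sets of naturals\<close>

definition symdiff_dist :: "nat set \<Rightarrow> nat set \<Rightarrow> real" where
  "symdiff_dist A B = real (card (sym_diff A B))"

text \<open>\<open>nth_elem A k\<close> is the element \<open>i\<^sub>k\<close> of \<open>A = {i\<^sub>1 < \<dots> < i\<^sub>n}\<close>; indices start at \<open>1\<close>.\<close>

definition nth_elem :: "nat set \<Rightarrow> nat \<Rightarrow> nat" where
  "nth_elem A k = sorted_list_of_set A ! (k - 1)"

definition set_prec :: "nat set \<Rightarrow> nat set \<Rightarrow> bool" where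
  "set_prec A B \<longleftrightarrow> card A < card B \<or>
     (card A = card B \<and>
      (\<exists>k\<in>{1..card A}. nth_elem A k < nth_elem B k \<and>
         (\<forall>l\<in>{1..<k}. nth_elem A l = nth_elem B l)))"

definition set_preceq :: "nat set \<Rightarrow> nat set \<Rightarrow> bool" where
  "set_preceq A B \<longleftrightarrow> set_prec A B \<or> A = B"

definition family_prec :: "nat \<Rightarrow> nat set \<Rightarrow> nat set set" where
  "family_prec m A = {B. B \<subseteq> {1..m} \<and> set_prec B A}"

definition family_preceq :: "nat \<Rightarrow> nat set \<Rightarrow> nat set set" where
  "family_preceq m A = family_prec m A \<union> {A}"

text \<open>The truncated subtraction never truncates for \<open>1 \<le> l \<le> card A\<close>.\<close>

definition gap :: "nat set \<Rightarrow> nat \<Rightarrow> nat" where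
  "gap A l = (if l = 1 then nth_elem A 1 else nth_elem A l - (nth_elem A (l - 1) + 1))"

definition sphere_count :: "nat set \<Rightarrow> nat" where
  "sphere_count A = (let n = card A in
     (\<Sum>k = 2..n - 2. k choose 2) + (\<Sum>l = 1..n - 2. gap A l * ((n - l) choose 2)))"

abbreviation VR_prec :: "nat \<Rightarrow> nat set \<Rightarrow> (nat set \<Rightarrow> real) topology" where
  "VR_prec m A \<equiv> geometric_realization (vietoris_rips symdiff_dist (family_prec m A) 2)"

abbreviation VR_preceq :: "nat \<Rightarrow> nat set \<Rightarrow> (nat set \<Rightarrow> real) topology" where
  "VR_preceq m A \<equiv> geometric_realization (vietoris_rips symdiff_dist (family_preceq m A) 2)"

end

theory Submission
  imports Defs
begin

text \<open>
  Passing from the family below \<open>A\<close> to the family up to \<open>A\<close> adds a cone over the link of \<open>A\<close>.  After translating by the symmetric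
  difference with \<open>A\<close>, the vertices of the link are the singletons \<open>{x}\<close> and pairs \<open>{x, x'}\<close> of elements
  of \<open>A\<close> together with the pairs \<open>{y, x}\<close> with \<open>x \<in> A\<close>, \<open>y \<notin> A\<close> and \<open>y < x\<close>; two pairs are adjacent iff they
  meet.  Removing one triangle \<open>{uv, vw, uw}\<close> for each triple in \<open>A\<close> and for each triple with \<open>u \<notin> A\<close> and
  \<open>v, w \<in> A - {Max A}\<close>, where \<open>u < v < w\<close>, leaves a link whose cone can be collapsed.  Each removed triangle contributes
  a \<open>3\<close>-simplex whose boundary lies in a contractible subcomplex, the union of a cone over seven faces of an
  octahedron and a cone over all eight, so attaching it amounts to wedging on a copy of \<open>S\<^sup>3\<close>.
\<close>

section \<open>Attaching cells up to homotopy\<close>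

text \<open>Every space to be compared with (a bouquet, a wedge with a complex, the 3-sphere itself)
  is treated as a tower in which each stage attaches a 3-cell by a constant map. Hence one argument
  serves all of them, resting on one fact: up to homotopy equivalence, attaching a cell depends only
  on the homotopy type of the base and the homotopy class of the attaching map. For a triple
  \<open>u < v < w\<close> in \<open>A\<close> the octahedron has the antipodes \<open>{w}\<close>,
  \<open>{u}\<close>, \<open>{v}\<close> of \<open>{u, v}\<close>, \<open>{v, w}\<close>,
  \<open>{u, w}\<close>. If \<open>u\<close> lies outside \<open>A\<close>, then \<open>{u}\<close>
  is not a vertex of the link; with \<open>z = Max A\<close> as an auxiliary element the antipodes
  become \<open>{w, z}\<close>, \<open>{u, z}\<close>, \<open>{v, z}\<close>. This leaves no room
  for \<open>w = z\<close>, so triangles ending in \<open>z\<close> stay and are used for collapsing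
  instead. The octahedron face on \<open>v\<close>, \<open>w\<close>, \<open>z\<close> is itself a
  removed triangle, which is why the simplices for triples in \<open>A\<close> have to be attached
  first.\<close>

abbreviation unit_interval :: "real topology" where
  "unit_interval \<equiv> top_of_set {0..1}"

text \<open>Pasting along closed maps that need not be inclusions: the preimage of a closed set is
  the union of two closed images. The characteristic map of a cell can therefore serve as one member
  of the cover.\<close>

lemma continuous_map_from_closed_cover:
  assumes e1: "closed_map X1 W e1" and e2: "closed_map X2 W e2"
    and sur: "topspace W \<subseteq> e1 ` topspace X1 \<union> e2 ` topspace X2"
    and k1: "continuous_map X1 Z (k \<circ> e1)" and k2: "continuous_map X2 Z (k \<circ> e2)"
  shows "continuous_map W Z k"
  unfolding continuous_map_closedin
proof (intro conjI allI impI)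
  have e1W: "e1 ` topspace X1 \<subseteq> topspace W" and e2W: "e2 ` topspace X2 \<subseteq> topspace W"
    using e1 e2 by (auto simp: closed_map_def dest!: spec[of _ "topspace _"] closedin_subset)
  show "k \<in> topspace W \<rightarrow> topspace Z"
  proof
    fix x assume "x \<in> topspace W"
    then show "k x \<in> topspace Z"
      using sur continuous_map_image_subset_topspace[OF k1] continuous_map_image_subset_topspace[OF k2]
      by fastforce
  qed
  fix D assume D: "closedin Z D"
  have "{x \<in> topspace W. k x \<in> D} =
      e1 ` {x \<in> topspace X1. (k \<circ> e1) x \<in> D} \<union> e2 ` {x \<in> topspace X2. (k \<circ> e2) x \<in> D}"
    using sur e1W e2W by auto
  moreover have "closedin W (e1 ` {x \<in> topspace X1. (k \<circ> e1) x \<in> D})"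
    using e1 closedin_continuous_map_preimage[OF k1 D] unfolding closed_map_def by blast
  moreover have "closedin W (e2 ` {x \<in> topspace X2. (k \<circ> e2) x \<in> D})"
    using e2 closedin_continuous_map_preimage[OF k2 D] unfolding closed_map_def by blast
  ultimately show "closedin W {x \<in> topspace W. k x \<in> D}"
    by (simp add: closedin_Un)
qed

lemma continuous_map_closed_Un:
  assumes "closedin X C" "closedin X D" "topspace X \<subseteq> C \<union> D"
    and "continuous_map (subtopology X C) Z k" "continuous_map (subtopology X D) Z k"
  shows "continuous_map X Z k"
  by (rule continuous_map_from_closed_cover[where ?e1.0 = id and ?e2.0 = id, OF closed_map_inclusion[OF assms(1), folded id_def] closed_map_inclusion[OF assms(2), folded id_def]])
     (use assms in \<open>auto simp: topspace_subtopology\<close>)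

subsection \<open>Cofibrations\<close>

text \<open>The homotopy extension property in its retraction form: every extension problem is
  solved by composing with one retraction of the cylinder onto its bottom and sides. Closedness of
  \<open>S\<close> makes maps on these two pieces paste.\<close>

definition cofibration :: "'b topology \<Rightarrow> 'b set \<Rightarrow> bool" where
  "cofibration B S \<longleftrightarrow> closedin B S \<and>
     (\<exists>r. continuous_map (prod_topology unit_interval B)
            (subtopology (prod_topology unit_interval B) ({0} \<times> topspace B \<union> {0..1} \<times> S)) r \<and>
          (\<forall>z \<in> {0} \<times> topspace B \<union> {0..1} \<times> S. r z = z))"

lemma cofibration_extend:
  assumes cof: "cofibration B S"
    and p: "continuous_map B Z p"
    and q: "continuous_map (prod_topology unit_interval (subtopology B S)) Z q"
    and pq: "\<And>s. s \<in> S \<Longrightarrow> q (0, s) = p s"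
  obtains R where "continuous_map (prod_topology unit_interval B) Z R"
    "\<And>b. b \<in> topspace B \<Longrightarrow> R (0, b) = p b"
    "\<And>t s. t \<in> {0..1} \<Longrightarrow> s \<in> S \<Longrightarrow> R (t, s) = q (t, s)"
proof -
  let ?IB = "prod_topology unit_interval B"
  let ?C = "{0} \<times> topspace B" and ?D = "{0..1} \<times> S"
  obtain r where S: "closedin B S" and r: "continuous_map ?IB (subtopology ?IB (?C \<union> ?D)) r"
    and rid: "\<And>z. z \<in> ?C \<union> ?D \<Longrightarrow> r z = z"
    using cof unfolding cofibration_def by blast
  have SB: "S \<subseteq> topspace B" using S closedin_subset by blast
  define k where "k = (\<lambda>(t, b). if b \<in> S then q (t, b) else p b)"
  have C: "closedin ?IB ?C" and D: "closedin ?IB ?D"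
    using S by (simp_all add: closedin_prod_Times_iff closedin_closed_subset)
  have CD: "?C \<subseteq> topspace ?IB" "?D \<subseteq> topspace ?IB"
    using C D closedin_subset by blast+
  have "continuous_map (subtopology ?IB (?C \<union> ?D)) Z k"
  proof (rule continuous_map_closed_Un[of _ ?C ?D])
    show "closedin (subtopology ?IB (?C \<union> ?D)) ?C" "closedin (subtopology ?IB (?C \<union> ?D)) ?D"
      using C D by (simp_all add: closedin_subset_topspace)
    have "continuous_map (subtopology ?IB ?C) Z k"
    proof (rule continuous_map_eq)
      show "continuous_map (subtopology ?IB ?C) Z (p \<circ> snd)"
        by (rule continuous_map_compose[OF continuous_map_from_subtopology[OF continuous_map_snd] p])
      show "(p \<circ> snd) z = k z" if "z \<in> topspace (subtopology ?IB ?C)" for z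
        using that pq by (auto simp: k_def)
    qed
    then show "continuous_map (subtopology (subtopology ?IB (?C \<union> ?D)) ?C) Z k"
      by (simp add: subtopology_subtopology Int_absorb1)
    have "continuous_map (subtopology ?IB ?D) Z k"
    proof (rule continuous_map_eq)
      have "subtopology ?IB ?D = prod_topology unit_interval (subtopology B S)"
        by (simp add: prod_topology_subtopology(2))
      then show "continuous_map (subtopology ?IB ?D) Z q"
        using q by simp
      show "q z = k z" if "z \<in> topspace (subtopology ?IB ?D)" for z
        using that by (auto simp: k_def)
    qed
    then show "continuous_map (subtopology (subtopology ?IB (?C \<union> ?D)) ?D) Z k"
      by (simp add: subtopology_subtopology Int_absorb1)
  qed auto
  then have "continuous_map ?IB Z (k \<circ> r)"
    using r continuous_map_compose by blast
  moreover have "(k \<circ> r) (0, b) = p b" if "b \<in> topspace B" for b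
    using that pq by (auto simp: rid k_def)
  moreover have "(k \<circ> r) (t, s) = q (t, s)" if "t \<in> {0..1}" "s \<in> S" for t s
    using that by (auto simp: rid k_def)
  ultimately show thesis using that by blast
qed

text \<open>Needed to deform a homotopy on \<open>B\<close> along a prescribed deformation over
  \<open>S\<close>. The retraction moves \<open>t\<close> and \<open>b\<close> and carries the extra
  parameter \<open>a\<close> along.\<close>

lemma cofibration_prod_interval:
  assumes "cofibration B S"
  shows "cofibration (prod_topology unit_interval B) ({0..1} \<times> S)"
proof -
  let ?I = unit_interval
  let ?IB = "prod_topology ?I B"
  obtain r where S: "closedin B S"
    and r: "continuous_map ?IB (subtopology ?IB ({0} \<times> topspace B \<union> {0..1} \<times> S)) r"
    and rid: "\<And>z. z \<in> {0} \<times> topspace B \<union> {0..1} \<times> S \<Longrightarrow> r z = z"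
    using assms unfolding cofibration_def by blast
  have SB: "S \<subseteq> topspace B" using S closedin_subset by blast
  have r1: "continuous_map ?IB ?IB r" and rim: "r ` topspace ?IB \<subseteq> {0} \<times> topspace B \<union> {0..1} \<times> S"
    using r unfolding continuous_map_in_subtopology by blast+
  define r' where "r' = (\<lambda>(t::real, a::real, b). (fst (r (t, b)), a, snd (r (t, b))))"
  have c: "continuous_map (prod_topology ?I ?IB) ?IB (\<lambda>z. r (fst z, snd (snd z)))"
  proof -
    have "continuous_map (prod_topology ?I ?IB) B (snd \<circ> snd)"
      by (rule continuous_map_compose[OF continuous_map_snd continuous_map_snd])
    then have "continuous_map (prod_topology ?I ?IB) ?IB (\<lambda>z. (fst z, snd (snd z)))"
      by (intro continuous_map_pairedI) (auto simp: o_def continuous_map_fst)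
    from continuous_map_compose[OF this r1] show ?thesis by (simp add: o_def)
  qed
  have c2: "continuous_map (prod_topology ?I ?IB) (prod_topology ?I ?IB) r'"
  proof -
    have "continuous_map (prod_topology ?I ?IB) ?I (\<lambda>z. fst (r (fst z, snd (snd z))))"
      using continuous_map_compose[OF c continuous_map_fst] by (simp add: o_def)
    moreover have "continuous_map (prod_topology ?I ?IB) B (\<lambda>z. snd (r (fst z, snd (snd z))))"
      using continuous_map_compose[OF c continuous_map_snd] by (simp add: o_def)
    moreover have "continuous_map (prod_topology ?I ?IB) ?I (\<lambda>z. fst (snd z))"
      using continuous_map_compose[OF continuous_map_snd continuous_map_fst, of ?I ?I B] by (simp add: o_def)
    ultimately have "continuous_map (prod_topology ?I ?IB) (prod_topology ?I ?IB)
        (\<lambda>z. (fst (r (fst z, snd (snd z))), fst (snd z), snd (r (fst z, snd (snd z)))))"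
      by (intro continuous_map_pairedI)
    then show ?thesis by (simp add: r'_def case_prod_unfold)
  qed
  have "r' ` topspace (prod_topology ?I ?IB) \<subseteq> {0} \<times> topspace ?IB \<union> {0..1} \<times> ({0..1} \<times> S)"
  proof (rule image_subsetI)
    fix w assume "w \<in> topspace (prod_topology ?I ?IB)"
    then obtain t a b where w: "w = (t, a, b)" "t \<in> {0..1}" "a \<in> {0..1}" "b \<in> topspace B" by auto
    then have "(t, b) \<in> topspace ?IB" by simp
    then have "r (t, b) \<in> {0} \<times> topspace B \<union> {0..1} \<times> S" using rim by blast
    then show "r' w \<in> {0} \<times> topspace ?IB \<union> {0..1} \<times> ({0..1} \<times> S)"
      using w by (cases "r (t, b)") (auto simp: r'_def)
  qed
  then have "continuous_map (prod_topology ?I ?IB) (subtopology (prod_topology ?I ?IB)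
      ({0} \<times> topspace ?IB \<union> {0..1} \<times> ({0..1} \<times> S))) r'"
    by (simp add: continuous_map_in_subtopology c2 image_subset_iff_funcset del: topspace_prod_topology)
  moreover have "r' z = z" if "z \<in> {0} \<times> topspace ?IB \<union> {0..1} \<times> ({0..1} \<times> S)" for z
    using that rid by (auto simp: r'_def)
  moreover have "closedin ?IB ({0..1} \<times> S)"
    using S closedin_topspace[of ?I] by (simp add: closedin_prod_Times_iff)
  ultimately show ?thesis unfolding cofibration_def by blast
qed


lemma homotopic_with_fixedI:
  assumes "continuous_map (prod_topology unit_interval X) Z h"
    and "\<And>x. x \<in> topspace X \<Longrightarrow> h (0, x) = f x" "\<And>x. x \<in> topspace X \<Longrightarrow> h (1, x) = g x"
    and "S \<subseteq> topspace X" "\<And>t s. t \<in> {0..1} \<Longrightarrow> s \<in> S \<Longrightarrow> h (t, s) = c s"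
  shows "homotopic_with (\<lambda>k. \<forall>s\<in>S. k s = c s) X Z f g"
proof (subst homotopic_with)
  show "(\<forall>s\<in>S. h s = c s) \<longleftrightarrow> (\<forall>s\<in>S. k s = c s)"
    if "\<And>x. x \<in> topspace X \<Longrightarrow> h x = k x" for h k
    using that assms(4) by (metis subsetD)
  show "\<exists>h. continuous_map (prod_topology unit_interval X) Z h \<and>
      (\<forall>x\<in>topspace X. h (0, x) = f x) \<and> (\<forall>x\<in>topspace X. h (1, x) = g x) \<and>
      (\<forall>t\<in>{0..1}. \<forall>s\<in>S. h (t, s) = c s)"
    using assms by blast
qed

lemma homotopic_with_into_I:
  assumes "continuous_map (prod_topology unit_interval X) Z h"
    and "\<And>x. x \<in> topspace X \<Longrightarrow> h (0, x) = f x" "\<And>x. x \<in> topspace X \<Longrightarrow> h (1, x) = g x"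
    and "S \<subseteq> topspace X" "\<And>t s. t \<in> {0..1} \<Longrightarrow> s \<in> S \<Longrightarrow> h (t, s) \<in> C"
  shows "homotopic_with (\<lambda>k. k ` S \<subseteq> C) X Z f g"
proof (subst homotopic_with)
  show "(h ` S \<subseteq> C) \<longleftrightarrow> (k ` S \<subseteq> C)"
    if "\<And>x. x \<in> topspace X \<Longrightarrow> h x = k x" for h k
    using that assms(4) by (metis image_cong subsetD)
  show "\<exists>h. continuous_map (prod_topology unit_interval X) Z h \<and>
      (\<forall>x\<in>topspace X. h (0, x) = f x) \<and> (\<forall>x\<in>topspace X. h (1, x) = g x) \<and>
      (\<forall>t\<in>{0..1}. (\<lambda>x. h (t, x)) ` S \<subseteq> C)"
    using assms by blast
qed

lemma continuous_map_reparametrize: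
  assumes "continuous_map (prod_topology unit_interval X) Z h"
    and "continuous_map W euclideanreal u" "\<And>w. w \<in> topspace W \<Longrightarrow> u w \<in> {0..1}"
    and "continuous_map W X v"
  shows "continuous_map W Z (\<lambda>w. h (u w, v w))"
proof -
  have "continuous_map W unit_interval u"
    using assms by (auto simp: continuous_map_in_subtopology)
  then have "continuous_map W (prod_topology unit_interval X) (\<lambda>w. (u w, v w))"
    using assms by (intro continuous_map_pairedI)
  from continuous_map_compose[OF this assms(1)] show ?thesis by (simp add: o_def)
qed

lemma continuous_map_fst_interval:
  "continuous_map (prod_topology unit_interval X) euclideanreal fst"
  using continuous_map_fst continuous_map_in_subtopology by blast

text \<open>Following \<open>P\<close> forward and then \<open>Q\<close> backward joins the two
  starting maps, but over \<open>S\<close> it runs along a track and back. Contracting this track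
  over \<open>S\<close> and extending the contraction over \<open>B\<close> gives a square of maps;
  its other three sides form a homotopy that is fixed on \<open>S\<close>.\<close>

lemma cofibration_homotopic_start:
  assumes cof: "cofibration B S"
    and P: "continuous_map (prod_topology unit_interval B) Z P"
    and Q: "continuous_map (prod_topology unit_interval B) Z Q"
    and end_eq: "\<And>b. b \<in> topspace B \<Longrightarrow> P (1, b) = Q (1, b)"
    and track_eq: "\<And>t s. t \<in> {0..1} \<Longrightarrow> s \<in> S \<Longrightarrow> P (t, s) = Q (t, s)"
  shows "homotopic_with (\<lambda>k. \<forall>s\<in>S. k s = P (0, s)) B Z (\<lambda>b. P (0, b)) (\<lambda>b. Q (0, b))"
proof -
  let ?I = unit_interval
  let ?IB = "prod_topology ?I B"
  let ?S' = "{0..1} \<times> S"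
  have S: "closedin B S" using cof by (simp add: cofibration_def)
  have SB: "S \<subseteq> topspace B" using S closedin_subset by blast
  define D where "D = (\<lambda>y. if fst y \<le> 1/2 then P (2 * fst y, snd y) else Q (2 - 2 * fst y, snd y))"
  have D: "continuous_map ?IB Z D"
    unfolding D_def
  proof (rule continuous_map_cases_le)
    show "continuous_map ?IB euclideanreal fst" by (rule continuous_map_fst_interval)
    show "continuous_map ?IB euclideanreal (\<lambda>x. 1/2)" by simp
    show "continuous_map (subtopology ?IB {y \<in> topspace ?IB. fst y \<le> 1/2}) Z (\<lambda>y. P (2 * fst y, snd y))"
      by (rule continuous_map_reparametrize[OF P])
         (auto intro!: continuous_map_real_mult continuous_map_diff continuous_map_canonical_const
           continuous_map_from_subtopology continuous_map_fst_interval continuous_map_snd)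
    show "continuous_map (subtopology ?IB {y \<in> topspace ?IB. 1/2 \<le> fst y}) Z (\<lambda>y. Q (2 - 2 * fst y, snd y))"
      by (rule continuous_map_reparametrize[OF Q])
         (auto intro!: continuous_map_real_mult continuous_map_diff continuous_map_canonical_const
           continuous_map_from_subtopology continuous_map_fst_interval continuous_map_snd)
    show "P (2 * fst y, snd y) = Q (2 - 2 * fst y, snd y)" if "y \<in> topspace ?IB" "fst y = 1/2" for y
    proof -
      have "2 * fst y = 1" "2 - 2 * fst y = 1" using that by simp_all
      moreover have "snd y \<in> topspace B" using that by auto
      ultimately show ?thesis using end_eq by metis
    qed
  qed
  \<comment> \<open>Over \<open>S\<close> the path \<open>D\<close> is \<open>P\<close> at the
    parameter \<open>tent\<close>, which rises to 1 at \<open>a = 1/2\<close> and returns. Shrinking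
    \<open>tent\<close> by a factor contracts this track to its starting point.\<close>
  define tent :: "real \<Rightarrow> real" where "tent a = min (2 * a) (2 - 2 * a)" for a
  define \<Theta> where "\<Theta> = (\<lambda>w. P ((1 - fst w) * tent (fst (snd w)), snd (snd w)))"
  have "continuous_map (prod_topology ?I ?IB) Z \<Theta>"
    unfolding \<Theta>_def
  proof (rule continuous_map_reparametrize[OF P])
    have f: "continuous_map (prod_topology ?I ?IB) euclideanreal (\<lambda>w. fst (snd w))"
      using continuous_map_compose[OF continuous_map_snd continuous_map_fst_interval] by (simp add: o_def)
    show "continuous_map (prod_topology ?I ?IB) euclideanreal (\<lambda>w. (1 - fst w) * tent (fst (snd w)))"
      unfolding tent_def by (intro continuous_map_real_mult continuous_map_diff continuous_map_canonical_const
        continuous_map_fst_interval f continuous_map_real_min)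
    show "continuous_map (prod_topology ?I ?IB) B (\<lambda>w. snd (snd w))"
      using continuous_map_compose[OF continuous_map_snd continuous_map_snd] by (simp add: o_def)
    show "(1 - fst w) * tent (fst (snd w)) \<in> {0..1}" if "w \<in> topspace (prod_topology ?I ?IB)" for w
    proof -
      have "0 \<le> tent (fst (snd w))" "tent (fst (snd w)) \<le> 1" "0 \<le> 1 - fst w" "1 - fst w \<le> 1"
        using that by (auto simp: tent_def)
      then show ?thesis by (simp add: mult_le_one)
    qed
  qed
  then have \<Theta>: "continuous_map (prod_topology ?I (subtopology ?IB ?S')) Z \<Theta>"
    by (simp add: prod_topology_subtopology(2) continuous_map_from_subtopology)
  have eq0: "\<Theta> (0, z) = D z" if z: "z \<in> ?S'" for z
  proof (cases "fst z \<le> 1/2")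
    case True
    then show ?thesis by (auto simp: \<Theta>_def D_def tent_def min_def)
  next
    case False
    then have "tent (fst z) = 2 - 2 * fst z" by (auto simp: tent_def)
    then show ?thesis using False z track_eq[of "2 - 2 * fst z" "snd z"] by (auto simp: \<Theta>_def D_def)
  qed
  obtain R where R: "continuous_map (prod_topology ?I ?IB) Z R"
    and R0: "\<And>z. z \<in> topspace ?IB \<Longrightarrow> R (0, z) = D z"
    and RS: "\<And>t z. t \<in> {0..1} \<Longrightarrow> z \<in> ?S' \<Longrightarrow> R (t, z) = \<Theta> (t, z)"
    by (rule cofibration_extend[OF cofibration_prod_interval[OF cof] D \<Theta> eq0], assumption, rule that)
  let ?rel = "homotopic_with (\<lambda>k. \<forall>s\<in>S. k s = P (0, s)) B Z"
  have side: "continuous_map ?IB Z (\<lambda>w. R (fst w, a, snd w))" if "a \<in> {0..1}" for a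
  proof (rule continuous_map_reparametrize[OF R continuous_map_fst_interval])
    show "continuous_map ?IB ?IB (\<lambda>w. (a, snd w))"
      by (rule continuous_map_pairedI) (use that in \<open>simp_all add: continuous_map_snd\<close>)
  qed auto
  have "continuous_map ?IB Z (\<lambda>w. R (1, w))"
    using continuous_map_o_Pair[OF R, of 1] by (simp add: o_def)
  then have top: "continuous_map ?IB Z (\<lambda>w. R (1, fst w, snd w))" by simp
  have "?rel (\<lambda>b. P (0, b)) (\<lambda>b. R (1, 0, b))"
    using R0 RS SB by (intro homotopic_with_fixedI[OF side[of 0]]) (auto simp: D_def \<Theta>_def tent_def)
  moreover have "?rel (\<lambda>b. R (1, 0, b)) (\<lambda>b. R (1, 1, b))"
    using RS SB by (intro homotopic_with_fixedI[OF top]) (auto simp: \<Theta>_def)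
  moreover have "?rel (\<lambda>b. Q (0, b)) (\<lambda>b. R (1, 1, b))"
    using R0 RS SB track_eq by (intro homotopic_with_fixedI[OF side[of 1]]) (auto simp: D_def \<Theta>_def tent_def)
  ultimately show ?thesis
    by (meson homotopic_with_symD homotopic_with_trans)
qed

subsection \<open>Attaching a cell\<close>

text \<open>\<open>Y\<close> is \<open>C\<close> with the cell \<open>B\<close> glued on along
  \<open>\<phi>\<close> restricted to \<open>S\<close>. Properness takes the place of the quotient
  topology: it survives the product with the interval, so homotopies can be glued as well as
  maps.\<close>

definition attaching :: "'a topology \<Rightarrow> 'a set \<Rightarrow> 'b topology \<Rightarrow> 'b set \<Rightarrow> ('b \<Rightarrow> 'a) \<Rightarrow> bool" where
  "attaching Y C B S \<phi> \<longleftrightarrow> closedin Y C \<and> closedin B S \<and> continuous_map B Y \<phi> \<and> proper_map B Y \<phi> \<and>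
     inj_on \<phi> (topspace B - S) \<and> \<phi> ` S \<subseteq> C \<and> \<phi> ` (topspace B - S) = topspace Y - C"

text \<open>A point outside \<open>C\<close> comes from exactly one point of the cell off
  \<open>S\<close>, which defines the glued map; continuity follows because two closed maps cover
  the product of the interval with \<open>Y\<close>.\<close>

lemma attaching_homotopy:
  assumes att: "attaching Y C B S \<phi>"
    and a: "continuous_map (prod_topology unit_interval (subtopology Y C)) Z a"
    and b: "continuous_map (prod_topology unit_interval B) Z b"
    and ab: "\<And>t s. t \<in> {0..1} \<Longrightarrow> s \<in> S \<Longrightarrow> a (t, \<phi> s) = b (t, s)"
  obtains k where "continuous_map (prod_topology unit_interval Y) Z k"
    "\<And>t y. t \<in> {0..1} \<Longrightarrow> y \<in> C \<Longrightarrow> k (t, y) = a (t, y)"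
    "\<And>t x. t \<in> {0..1} \<Longrightarrow> x \<in> topspace B \<Longrightarrow> k (t, \<phi> x) = b (t, x)"
proof -
  let ?I = unit_interval
  have C: "closedin Y C" and S: "closedin B S" and proper: "proper_map B Y \<phi>"
    and inj: "inj_on \<phi> (topspace B - S)"
    and SC: "\<phi> ` S \<subseteq> C" and onto: "\<phi> ` (topspace B - S) = topspace Y - C"
    using att by (auto simp: attaching_def)
  have CY: "C \<subseteq> topspace Y" using C closedin_subset by blast
  define k where "k = (\<lambda>(t::real, y). if y \<in> C then a (t, y) else b (t, inv_into (topspace B - S) \<phi> y))"
  have kC: "k (t, y) = a (t, y)" if "y \<in> C" for t y using that by (simp add: k_def)
  have kB: "k (t, \<phi> x) = b (t, x)" if "t \<in> {0..1}" "x \<in> topspace B" for t x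
  proof (cases "x \<in> S")
    case True
    then show ?thesis using SC ab that by (auto simp: k_def)
  next
    case False
    then have "\<phi> x \<notin> C" using that onto by blast
    then show ?thesis using False that inv_into_f_f[OF inj] by (simp add: k_def)
  qed
  have "continuous_map (prod_topology ?I Y) Z k"
  proof (rule continuous_map_from_closed_cover)
    have "proper_map (subtopology Y C) Y id"
      using C by (simp add: closed_injective_imp_proper_map closed_map_inclusion)
    then have "proper_map (prod_topology ?I (subtopology Y C)) (prod_topology ?I Y) (\<lambda>(t, y). (id t, id y))"
      by (subst proper_map_prod) auto
    then show "closed_map (prod_topology ?I (subtopology Y C)) (prod_topology ?I Y) (\<lambda>(t, y). (id t, id y))"
      by (rule proper_imp_closed_map)
    have "proper_map (prod_topology ?I B) (prod_topology ?I Y) (\<lambda>(t, x). (id t, \<phi> x))"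
      using proper by (subst proper_map_prod) auto
    then show "closed_map (prod_topology ?I B) (prod_topology ?I Y) (\<lambda>(t, x). (id t, \<phi> x))"
      by (rule proper_imp_closed_map)
    show "topspace (prod_topology ?I Y) \<subseteq>
        (\<lambda>(t, y). (id t, id y)) ` topspace (prod_topology ?I (subtopology Y C)) \<union>
        (\<lambda>(t, x). (id t, \<phi> x)) ` topspace (prod_topology ?I B)"
    proof clarify
      fix t y assume ty: "(t, y) \<in> topspace (prod_topology ?I Y)"
        and "(t, y) \<notin> (\<lambda>(t, x). (id t, \<phi> x)) ` topspace (prod_topology ?I B)"
      then have "y \<in> C" using onto by (force simp: image_iff)
      then show "(t, y) \<in> (\<lambda>(t, y). (id t, id y)) ` topspace (prod_topology ?I (subtopology Y C))"
        using ty by auto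
    qed
    show "continuous_map (prod_topology ?I (subtopology Y C)) Z (k \<circ> (\<lambda>(t, y). (id t, id y)))"
      by (rule continuous_map_eq[OF a]) (auto simp: kC)
    show "continuous_map (prod_topology ?I B) Z (k \<circ> (\<lambda>(t, x). (id t, \<phi> x)))"
      by (rule continuous_map_eq[OF b]) (auto simp: kB)
  qed
  then show thesis using that kC kB by blast
qed

lemma attaching_map:
  assumes att: "attaching Y C B S \<phi>"
    and a: "continuous_map (subtopology Y C) Z a"
    and b: "continuous_map B Z b"
    and ab: "\<And>s. s \<in> S \<Longrightarrow> a (\<phi> s) = b s"
  obtains k where "continuous_map Y Z k" "\<And>y. y \<in> C \<Longrightarrow> k y = a y"
    "\<And>x. x \<in> topspace B \<Longrightarrow> k (\<phi> x) = b x"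
proof -
  have "continuous_map (prod_topology unit_interval (subtopology Y C)) Z (a \<circ> snd)"
    "continuous_map (prod_topology unit_interval B) Z (b \<circ> snd)"
    using continuous_map_compose[OF continuous_map_snd a] continuous_map_compose[OF continuous_map_snd b] by blast+
  then obtain k where k: "continuous_map (prod_topology unit_interval Y) Z k"
    "\<And>t y. t \<in> {0..1} \<Longrightarrow> y \<in> C \<Longrightarrow> k (t, y) = (a \<circ> snd) (t, y)"
    "\<And>t x. t \<in> {0..1} \<Longrightarrow> x \<in> topspace B \<Longrightarrow> k (t, \<phi> x) = (b \<circ> snd) (t, x)"
    by (rule attaching_homotopy[OF att]) (use ab in auto)
  have "continuous_map Y Z (k \<circ> Pair 0)"
    by (rule continuous_map_o_Pair[OF k(1)]) simp
  then show thesis using that k(2,3)[of 0] by simp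
qed

lemma attaching_homotopicI:
  assumes att: "attaching Y C B S \<phi>" and M: "continuous_map Y Z M" and N: "continuous_map Y Z N"
    and a: "continuous_map (prod_topology unit_interval (subtopology Y C)) Z a"
    and a01: "\<And>y. y \<in> C \<Longrightarrow> a (0, y) = M y" "\<And>y. y \<in> C \<Longrightarrow> a (1, y) = N y"
    and b: "continuous_map (prod_topology unit_interval B) Z b"
    and b01: "\<And>x. x \<in> topspace B \<Longrightarrow> b (0, x) = M (\<phi> x)" "\<And>x. x \<in> topspace B \<Longrightarrow> b (1, x) = N (\<phi> x)"
    and ab: "\<And>t s. t \<in> {0..1} \<Longrightarrow> s \<in> S \<Longrightarrow> a (t, \<phi> s) = b (t, s)"
  shows "homotopic_with (\<lambda>_. True) Y Z M N"
proof -
  obtain k where k: "continuous_map (prod_topology unit_interval Y) Z k"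
    "\<And>t y. t \<in> {0..1} \<Longrightarrow> y \<in> C \<Longrightarrow> k (t, y) = a (t, y)"
    "\<And>t x. t \<in> {0..1} \<Longrightarrow> x \<in> topspace B \<Longrightarrow> k (t, \<phi> x) = b (t, x)"
    by (rule attaching_homotopy[OF att a b], erule (1) ab, rule that)
  have cover: "y \<in> C \<or> (\<exists>x \<in> topspace B. y = \<phi> x)" if "y \<in> topspace Y" for y
    using that att by (auto simp: attaching_def)
  have "k (0, y) = M y" "k (1, y) = N y" if "y \<in> topspace Y" for y
    using cover[OF that] k(2,3)[of 0] k(2,3)[of 1] a01 b01 by auto
  then show ?thesis
    using k(1) by (auto simp: homotopic_with)
qed

text \<open>A one-sided inverse is enough, because the conclusion on
  \<open>G \<circ> \<phi>'\<close> has the form of the hypothesis on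
  \<open>F \<circ> \<phi>\<close>, so the lemma applies again with the roles exchanged. On the cell,
  \<open>G\<close> is reached from \<open>\<phi>\<close> by first running the homotopy from
  \<open>g \<circ> f\<close> to the identity backwards over \<open>S\<close> (this is
  \<open>P\<close>) and then following \<open>g\<close> applied to the deformation of
  \<open>F \<circ> \<phi>\<close> into \<open>\<phi>'\<close> (this is \<open>Q\<close>).\<close>

lemma attaching_left_inverse:
  assumes cof: "cofibration B S"
    and att: "attaching Y C B S \<phi>" and att': "attaching Y' C' B S \<phi>'"
    and F: "continuous_map Y Y' F" "\<And>y. y \<in> C \<Longrightarrow> F y = f y"
    and f: "continuous_map (subtopology Y C) (subtopology Y' C') f"
    and g: "continuous_map (subtopology Y' C') (subtopology Y C) g"
    and gf: "homotopic_with (\<lambda>_. True) (subtopology Y C) (subtopology Y C) (g \<circ> f) id"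
    and hom: "homotopic_with (\<lambda>k. k ` S \<subseteq> C') B Y' (F \<circ> \<phi>) \<phi>'"
  obtains G where "continuous_map Y' Y G" "\<And>y. y \<in> C' \<Longrightarrow> G y = g y"
    "homotopic_with (\<lambda>k. k ` S \<subseteq> C) B Y (G \<circ> \<phi>') \<phi>"
    "homotopic_with (\<lambda>_. True) Y Y (G \<circ> F) id"
proof -
  let ?I = unit_interval
  let ?IB = "prod_topology ?I B"
  have C: "closedin Y C" and S: "closedin B S" and \<phi>: "continuous_map B Y \<phi>" and SC: "\<phi> ` S \<subseteq> C"
    using att by (auto simp: attaching_def)
  have C': "closedin Y' C'" and \<phi>': "continuous_map B Y' \<phi>'" and SC': "\<phi>' ` S \<subseteq> C'"
    using att' by (auto simp: attaching_def)
  have SB: "S \<subseteq> topspace B" and CY: "C \<subseteq> topspace Y" and CY': "C' \<subseteq> topspace Y'"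
    using S C C' closedin_subset by blast+
  have tops: "topspace (subtopology Y C) = C" "topspace (subtopology Y' C') = C'"
    using CY CY' by auto
  have \<phi>S: "continuous_map (subtopology B S) (subtopology Y C) \<phi>"
    using \<phi> SC by (auto simp: continuous_map_in_subtopology continuous_map_from_subtopology)
  obtain H where H: "continuous_map (prod_topology ?I (subtopology Y C)) (subtopology Y C) H"
    and H0: "\<And>y. H (0, y) = g (f y)" and H1: "\<And>y. H (1, y) = y"
    using gf by (auto simp: homotopic_with_def)
  have HY: "continuous_map (prod_topology ?I (subtopology Y C)) Y H"
    using H continuous_map_into_fulltopology by blast
  have HC: "H (t, y) \<in> C" if "t \<in> {0..1}" "y \<in> C" for t y
  proof -
    have "(t, y) \<in> topspace (prod_topology ?I (subtopology Y C))" using that CY by auto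
    then show ?thesis using continuous_map_image_subset_topspace[OF H] tops by blast
  qed
  obtain E where E: "continuous_map ?IB Y' E"
    and E0: "\<And>x. E (0, x) = F (\<phi> x)" and E1: "\<And>x. E (1, x) = \<phi>' x"
    and EC: "\<And>t s. t \<in> {0..1} \<Longrightarrow> s \<in> S \<Longrightarrow> E (t, s) \<in> C'"
    using hom by (auto simp: homotopic_with_def image_subset_iff)
  have IBS: "prod_topology ?I (subtopology B S) = subtopology ?IB ({0..1} \<times> S)"
    by (simp add: prod_topology_subtopology(2))
  have fst: "continuous_map (prod_topology ?I (subtopology B S)) euclideanreal fst"
    by (rule continuous_map_fst_interval)
  have HS: "continuous_map (prod_topology ?I (subtopology B S)) Y (\<lambda>w. H (1 - fst w, \<phi> (snd w)))"
  proof (rule continuous_map_reparametrize[OF HY])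
    show "continuous_map (prod_topology ?I (subtopology B S)) (subtopology Y C) (\<lambda>w. \<phi> (snd w))"
      using continuous_map_compose[OF continuous_map_snd \<phi>S] by (simp add: o_def)
  qed (auto intro!: continuous_map_diff continuous_map_canonical_const fst)
  obtain P where P: "continuous_map ?IB Y P" and P0: "\<And>b. b \<in> topspace B \<Longrightarrow> P (0, b) = \<phi> b"
    and PS: "\<And>t s. t \<in> {0..1} \<Longrightarrow> s \<in> S \<Longrightarrow> P (t, s) = H (1 - t, \<phi> s)"
    by (rule cofibration_extend[OF cof \<phi> HS]) (simp_all add: H1)
  have P1: "continuous_map B Y (\<lambda>b. P (1, b))"
    using continuous_map_o_Pair[OF P, of 1] by (simp add: o_def)
  have ES: "continuous_map (prod_topology ?I (subtopology B S)) (subtopology Y' C') E"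
    using E EC by (auto simp: IBS continuous_map_in_subtopology continuous_map_from_subtopology)
  have gE: "continuous_map (prod_topology ?I (subtopology B S)) Y (g \<circ> E)"
    using continuous_map_compose[OF ES g] continuous_map_into_fulltopology by blast
  have gE0: "(g \<circ> E) (0, s) = P (1, s)" if "s \<in> S" for s
    using that SC PS[of 1 s] F(2) H0 E0 by auto
  obtain Q where Q: "continuous_map ?IB Y Q"
    and Q0: "\<And>b. b \<in> topspace B \<Longrightarrow> Q (0, b) = P (1, b)"
    and QS: "\<And>t s. t \<in> {0..1} \<Longrightarrow> s \<in> S \<Longrightarrow> Q (t, s) = g (E (t, s))"
    by (rule cofibration_extend[OF cof P1 gE]) (simp_all add: gE0[unfolded comp_def])
  have gY: "continuous_map (subtopology Y' C') Y g"
    using g continuous_map_into_fulltopology by blast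
  have Q1: "continuous_map B Y (\<lambda>b. Q (1, b))"
    using continuous_map_o_Pair[OF Q, of 1] by (simp add: o_def)
  have gQ: "g (\<phi>' s) = Q (1, s)" if "s \<in> S" for s
    using that QS[of 1 s] E1 by simp
  obtain G where G: "continuous_map Y' Y G" and GC: "\<And>y. y \<in> C' \<Longrightarrow> G y = g y"
    and GB: "\<And>x. x \<in> topspace B \<Longrightarrow> G (\<phi>' x) = Q (1, x)"
    by (rule attaching_map[OF att' gY Q1], erule gQ, rule that)
  have gC: "g y \<in> C" if "y \<in> C'" for y
    using that continuous_map_image_subset_topspace[OF g] tops by blast
  have "homotopic_with (\<lambda>k. k ` S \<subseteq> C) B Y (G \<circ> \<phi>') (\<lambda>b. P (1, b))"
    by (rule homotopic_with_symD, rule homotopic_with_into_I[OF Q])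
       (use SB Q0 GB QS EC gC in auto)
  moreover have "homotopic_with (\<lambda>k. k ` S \<subseteq> C) B Y (\<lambda>b. P (1, b)) \<phi>"
    by (rule homotopic_with_symD, rule homotopic_with_into_I[OF P])
       (use SB P0 PS SC HC in auto)
  ultimately have hG: "homotopic_with (\<lambda>k. k ` S \<subseteq> C) B Y (G \<circ> \<phi>') \<phi>"
    by (rule homotopic_with_trans)
  \<comment> \<open>\<open>G \<circ> E\<close> and \<open>Q\<close> both end at
    \<open>Q (1, _)\<close> and agree over \<open>S\<close>, so their starting maps
    \<open>G \<circ> F \<circ> \<phi>\<close> and \<open>P (1, _)\<close> are homotopic relative to
    \<open>S\<close>.\<close>
  have "continuous_map ?IB Y (G \<circ> E)" by (rule continuous_map_compose[OF E G])
  then have "homotopic_with (\<lambda>k. \<forall>s\<in>S. k s = (G \<circ> E) (0, s)) B Y (\<lambda>b. (G \<circ> E) (0, b)) (\<lambda>b. Q (0, b))"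
    by (rule cofibration_homotopic_start[OF cof _ Q]) (use E1 GB QS EC GC in auto)
  then obtain b where b: "continuous_map ?IB Y b" and b0: "\<And>x. b (0, x) = G (F (\<phi> x))"
    and b1: "\<And>x. b (1, x) = Q (0, x)" and bS: "\<And>t s. t \<in> {0..1} \<Longrightarrow> s \<in> S \<Longrightarrow> b (t, s) = G (F (\<phi> s))"
    by (auto simp: homotopic_with_def E0)
  have gfY: "continuous_map (subtopology Y C) Y (g \<circ> f)"
    using continuous_map_compose[OF f gY] .
  have fC: "f y \<in> C'" if "y \<in> C" for y
    using that continuous_map_image_subset_topspace[OF f] tops by blast
  have gfP: "(g \<circ> f) (\<phi> s) = P (1, s)" if "s \<in> S" for s
    using that PS[of 1 s] H0 by simp
  \<comment> \<open>An intermediate map: \<open>g \<circ> f\<close> on the base and the end of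
    \<open>P\<close> on the cell. It is homotopic to \<open>G \<circ> F\<close> by moving the cell
    only, and to the identity by \<open>H\<close> together with \<open>P\<close> run
    backwards.\<close>
  obtain M where M: "continuous_map Y Y M" and MC: "\<And>y. y \<in> C \<Longrightarrow> M y = g (f y)"
    and MB: "\<And>x. x \<in> topspace B \<Longrightarrow> M (\<phi> x) = P (1, x)"
    by (rule attaching_map[OF att gfY P1], erule gfP) (simp_all add: comp_def)
  have "homotopic_with (\<lambda>_. True) Y Y (G \<circ> F) M"
  proof (rule attaching_homotopicI[OF att continuous_map_compose[OF F(1) G] M _ _ _ b])
    show "continuous_map (prod_topology ?I (subtopology Y C)) Y (\<lambda>w. g (f (snd w)))"
      using continuous_map_compose[OF continuous_map_snd gfY] by (simp add: o_def)
  qed (use F(2) fC GC MC MB b0 b1 bS Q0 SC in auto)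
  moreover have "homotopic_with (\<lambda>_. True) Y Y M id"
  proof (rule attaching_homotopicI[OF att M continuous_map_id HY])
    show "continuous_map ?IB Y (\<lambda>w. P (1 - fst w, snd w))"
      by (rule continuous_map_reparametrize[OF P])
         (auto intro!: continuous_map_diff continuous_map_canonical_const continuous_map_fst_interval continuous_map_snd)
  qed (use MC MB H0 H1 P0 PS in auto)
  ultimately have "homotopic_with (\<lambda>_. True) Y Y (G \<circ> F) id"
    by (rule homotopic_with_trans)
  from that[OF G GC hG this] show thesis .
qed

text \<open>Extending \<open>f\<close> over the cell along the given homotopy yields
  \<open>F\<close>. A left inverse \<open>G\<close> of \<open>F\<close> and a left inverse
  \<open>F'\<close> of \<open>G\<close> force \<open>F\<close> and \<open>F'\<close> to be
  homotopic, so \<open>G\<close> is a two-sided homotopy inverse.\<close>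

theorem attaching_homotopy_equivalent:
  assumes cof: "cofibration B S"
    and att: "attaching Y C B S \<phi>" and att': "attaching Y' C' B S \<phi>'"
    and f: "continuous_map (subtopology Y C) (subtopology Y' C') f"
    and g: "continuous_map (subtopology Y' C') (subtopology Y C) g"
    and gf: "homotopic_with (\<lambda>_. True) (subtopology Y C) (subtopology Y C) (g \<circ> f) id"
    and fg: "homotopic_with (\<lambda>_. True) (subtopology Y' C') (subtopology Y' C') (f \<circ> g) id"
    and hom: "homotopic_with (\<lambda>_. True) (subtopology B S) (subtopology Y' C') (f \<circ> \<phi>) \<phi>'"
  shows "Y homotopy_equivalent_space Y'"
proof -
  let ?I = unit_interval
  have S: "closedin B S" and SC: "\<phi> ` S \<subseteq> C" and C': "closedin Y' C'" and \<phi>': "continuous_map B Y' \<phi>'"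
    using att att' by (auto simp: attaching_def)
  have SB: "S \<subseteq> topspace B" and CY': "C' \<subseteq> topspace Y'" using S C' closedin_subset by blast+
  obtain h where h: "continuous_map (prod_topology ?I (subtopology B S)) (subtopology Y' C') h"
    and h0: "\<And>x. h (0, x) = \<phi>' x" and h1: "\<And>x. h (1, x) = f (\<phi> x)"
    using homotopic_with_symD[OF hom] by (auto simp: homotopic_with_def)
  have hY: "continuous_map (prod_topology ?I (subtopology B S)) Y' h"
    using h continuous_map_into_fulltopology by blast
  have hC: "h (t, s) \<in> C'" if "t \<in> {0..1}" "s \<in> S" for t s
  proof -
    have "(t, s) \<in> topspace (prod_topology ?I (subtopology B S))" using that SB by auto
    then show ?thesis using continuous_map_image_subset_topspace[OF h] CY' by fastforce
  qed
  obtain R where R: "continuous_map (prod_topology ?I B) Y' R"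
    and R0: "\<And>b. b \<in> topspace B \<Longrightarrow> R (0, b) = \<phi>' b"
    and RS: "\<And>t s. t \<in> {0..1} \<Longrightarrow> s \<in> S \<Longrightarrow> R (t, s) = h (t, s)"
    by (rule cofibration_extend[OF cof \<phi>' hY h0], rule that)
  have R1: "continuous_map B Y' (\<lambda>b. R (1, b))"
    using continuous_map_o_Pair[OF R, of 1] by (simp add: o_def)
  have fY: "continuous_map (subtopology Y C) Y' f"
    using f continuous_map_into_fulltopology by blast
  have fR: "f (\<phi> s) = R (1, s)" if "s \<in> S" for s
    using that RS[of 1 s] h1 by simp
  obtain F where F: "continuous_map Y Y' F" and FC: "\<And>y. y \<in> C \<Longrightarrow> F y = f y"
    and FB: "\<And>x. x \<in> topspace B \<Longrightarrow> F (\<phi> x) = R (1, x)"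
    by (rule attaching_map[OF att fY R1], erule fR, rule that)
  have hF: "homotopic_with (\<lambda>k. k ` S \<subseteq> C') B Y' (F \<circ> \<phi>) \<phi>'"
    by (rule homotopic_with_symD, rule homotopic_with_into_I[OF R]) (use SB R0 FB RS hC in auto)
  obtain G where G: "continuous_map Y' Y G" "\<And>y. y \<in> C' \<Longrightarrow> G y = g y"
    "homotopic_with (\<lambda>k. k ` S \<subseteq> C) B Y (G \<circ> \<phi>') \<phi>"
    and GF: "homotopic_with (\<lambda>_. True) Y Y (G \<circ> F) id"
    by (rule attaching_left_inverse[OF cof att att' F FC f g gf hF], assumption, rule that)
  obtain F' where F': "continuous_map Y Y' F'" and F'G: "homotopic_with (\<lambda>_. True) Y' Y' (F' \<circ> G) id"
    by (rule attaching_left_inverse[OF cof att' att G(1,2) g f fg G(3)], assumption, rule that)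
  have "homotopic_with (\<lambda>_. True) Y Y' (F' \<circ> (G \<circ> F)) (F' \<circ> id)"
    by (rule homotopic_with_compose_continuous_map_left[OF GF F']) simp
  moreover have "homotopic_with (\<lambda>_. True) Y Y' ((F' \<circ> G) \<circ> F) (id \<circ> F)"
    by (rule homotopic_with_compose_continuous_map_right[OF F'G F]) simp
  ultimately have 1: "homotopic_with (\<lambda>_. True) Y Y' (F' \<circ> (G \<circ> F)) F'"
    and 2: "homotopic_with (\<lambda>_. True) Y Y' (F' \<circ> (G \<circ> F)) F"
    by (simp_all add: comp_assoc)
  have "homotopic_with (\<lambda>_. True) Y Y' F F'"
    by (rule homotopic_with_trans[OF homotopic_with_symD[OF 2] 1])
  then have "homotopic_with (\<lambda>_. True) Y' Y' (F \<circ> G) (F' \<circ> G)"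
    by (rule homotopic_with_compose_continuous_map_right[OF _ G(1)]) simp
  then have "homotopic_with (\<lambda>_. True) Y' Y' (F \<circ> G) id"
    using F'G by (rule homotopic_with_trans)
  then show ?thesis
    using F G(1) GF unfolding homotopy_equivalent_space_def by blast
qed

section \<open>The three-dimensional cell and the sphere\<close>

lemma continuous_map_powertop_coordinate:
  assumes "continuous_map X (powertop_real UNIV) f"
  shows "continuous_map X euclideanreal (\<lambda>x. f x i)"
  using assms by (simp add: continuous_map_componentwise_UNIV)

lemma continuous_map_coordinate: "continuous_map (powertop_real UNIV) euclideanreal (\<lambda>f. f i)"
  using continuous_map_product_coordinates[of i UNIV "\<lambda>_. euclideanreal"] by simp

lemma homotopic_with_straight_line:
  assumes f: "continuous_map X (powertop_real UNIV) f" and g: "continuous_map X (powertop_real UNIV) g"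
    and D: "\<And>x t. x \<in> topspace X \<Longrightarrow> 0 \<le> t \<Longrightarrow> t \<le> 1 \<Longrightarrow> (\<lambda>i. (1 - t) * f x i + t * g x i) \<in> D"
  shows "homotopic_with (\<lambda>_. True) X (subtopology (powertop_real UNIV) D) f g"
proof -
  let ?h = "\<lambda>w i. (1 - fst w) * f (snd w) i + fst w * g (snd w) i"
  have c: "continuous_map (prod_topology unit_interval X) euclideanreal (\<lambda>w. k (snd w) i)"
    if "continuous_map X (powertop_real UNIV) k" for k i
    using continuous_map_compose[OF continuous_map_snd continuous_map_powertop_coordinate[OF that]]
    by (simp add: o_def)
  have "continuous_map (prod_topology unit_interval X) (powertop_real UNIV) ?h"
    unfolding continuous_map_componentwise_UNIV
    by (intro allI continuous_map_add continuous_map_real_mult continuous_map_diff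
        continuous_map_canonical_const continuous_map_fst_interval c f g)
  moreover have "?h w \<in> D" if "w \<in> topspace (prod_topology unit_interval X)" for w
    using that by (intro D) auto
  ultimately have "continuous_map (prod_topology unit_interval X) (subtopology (powertop_real UNIV) D) ?h"
    by (auto intro!: continuous_map_into_subtopology)
  then show ?thesis
    by (auto simp: homotopic_with)
qed

subsection \<open>Standard simplices\<close>

definition std_simplex :: "'a set \<Rightarrow> ('a \<Rightarrow> real) set" where
  "std_simplex V = {f. (\<forall>v. 0 \<le> f v) \<and> (\<forall>v. v \<notin> V \<longrightarrow> f v = 0) \<and> (\<Sum>v\<in>V. f v) = 1}"

lemma std_simplex_le_1:
  assumes "finite V" "f \<in> std_simplex V"
  shows "f v \<le> 1"
proof (cases "v \<in> V")
  case True
  then have "f v \<le> (\<Sum>v\<in>V. f v)"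
    using assms by (intro member_le_sum) (auto simp: std_simplex_def)
  then show ?thesis using assms by (simp add: std_simplex_def)
qed (use assms in \<open>auto simp: std_simplex_def\<close>)

lemma compactin_std_simplex:
  assumes "finite V"
  shows "compactin (powertop_real UNIV) (std_simplex V)"
proof (rule closed_compactin)
  show "compactin (powertop_real UNIV) (\<Pi>\<^sub>E v\<in>UNIV. {0..1::real})"
    by (simp add: compactin_PiE)
  show "std_simplex V \<subseteq> (\<Pi>\<^sub>E v\<in>UNIV. {0..1::real})"
    using std_simplex_le_1[OF assms] by (fastforce simp: std_simplex_def)
  let ?X = "powertop_real UNIV"
  let ?A = "\<lambda>v. {f \<in> topspace ?X. f v \<in> (if v \<in> V then {0..} else {0::real})}"
  have "std_simplex V = (\<Inter>v. ?A v) \<inter> {f \<in> topspace ?X. (\<Sum>v\<in>V. f v) \<in> {1}}"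
    by (auto simp: std_simplex_def split: if_splits) (metis order_refl)
  moreover have "closedin ?X (?A v)" for v
    by (rule closedin_continuous_map_preimage[OF continuous_map_product_coordinates]) auto
  moreover have "closedin ?X {f \<in> topspace ?X. (\<Sum>v\<in>V. f v) \<in> {1}}"
    by (rule closedin_continuous_map_preimage[where Y = euclideanreal])
       (auto intro!: continuous_map_sum assms continuous_map_coordinate)
  ultimately show "closedin ?X (std_simplex V)"
    by (metis (no_types, lifting) closedin_INT closedin_Int UNIV_not_empty)
qed

lemma Hausdorff_powertop_real: "Hausdorff_space (powertop_real UNIV)"
  by (simp add: Hausdorff_space_product_topology Hausdorff_space_euclidean)

lemma closedin_std_simplex: "finite V \<Longrightarrow> closedin (powertop_real UNIV) (std_simplex V)"
  by (simp add: compactin_imp_closedin compactin_std_simplex Hausdorff_powertop_real)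

subsection \<open>The standard \<open>3\<close>-cell\<close>

definition cell3 :: "(nat \<Rightarrow> real) topology" where
  "cell3 = subtopology (powertop_real UNIV) (std_simplex {..<4})"

text \<open>\<open>depth\<close> is \<open>1\<close> at the barycentre, vanishes on the boundary and is affine along each ray from the barycentre.\<close>

definition depth :: "(nat \<Rightarrow> real) \<Rightarrow> real" where
  "depth f = 4 * min (min (f 0) (f 1)) (min (f 2) (f 3))"

definition cell3_boundary :: "(nat \<Rightarrow> real) set" where
  "cell3_boundary = {f \<in> topspace cell3. depth f = 0}"

lemma lessThan_4: "{..<4::nat} = {0, 1, 2, 3}"
  by auto

lemma topspace_cell3: "topspace cell3 = std_simplex {..<4}"
  by (simp add: cell3_def)

lemma compact_space_cell3: "compact_space cell3"
  by (simp add: cell3_def compact_space_subtopology compactin_std_simplex)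

lemma mem_cell3:
  "f \<in> topspace cell3 \<longleftrightarrow> (\<forall>i. 0 \<le> f i) \<and> (\<forall>i\<ge>4. f i = 0) \<and> f 0 + f 1 + f 2 + f 3 = 1"
  by (auto simp: topspace_cell3 std_simplex_def lessThan_4 not_less add.assoc)

lemma continuous_map_cell3_coordinate: "continuous_map cell3 euclideanreal (\<lambda>f. f i)"
  by (simp add: cell3_def continuous_map_from_subtopology continuous_map_coordinate)

lemma continuous_map_depth: "continuous_map cell3 euclideanreal depth"
  unfolding depth_def
  by (intro continuous_map_real_mult continuous_map_canonical_const continuous_map_real_min
      continuous_map_cell3_coordinate)

lemma depth_le: "i < 4 \<Longrightarrow> depth f \<le> 4 * f i"
proof -
  assume "i < 4"
  then have "i = 0 \<or> i = 1 \<or> i = 2 \<or> i = 3" by auto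
  then show ?thesis by (auto simp: depth_def)
qed

lemma depth_attained: "\<exists>i<4. depth f = 4 * f i"
proof -
  have "depth f = 4 * f 0 \<or> depth f = 4 * f 1 \<or> depth f = 4 * f 2 \<or> depth f = 4 * f 3"
    by (auto simp: depth_def min_def)
  then show ?thesis
    by (metis zero_less_numeral one_less_numeral_iff semiring_norm(76) numeral_less_iff semiring_norm(78,81))
qed

lemma depth_nonneg: "f \<in> topspace cell3 \<Longrightarrow> 0 \<le> depth f"
  using depth_attained[of f] by (auto simp: mem_cell3)

text \<open>A nondecreasing affine function commutes with \<open>min\<close>; the normalising factor
  4 of \<open>depth\<close> turns the constant \<open>a\<close> into \<open>4 * a\<close>.\<close>

lemma depth_affine:
  assumes "0 \<le> s" and "\<And>i. i < 4 \<Longrightarrow> g i = a + s * f i"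
  shows "depth g = 4 * a + s * depth f"
proof -
  have m: "mono (\<lambda>x. a + s * x)"
    using assms(1) by (simp add: mono_def mult_left_mono)
  have "depth g = 4 * (a + s * (min (min (f 0) (f 1)) (min (f 2) (f 3))))"
    by (simp add: depth_def assms(2) min_of_mono[OF m])
  then show ?thesis by (simp add: depth_def)
qed

text \<open>The retraction is the projection from the point at height \<open>2\<close> above the barycentre.\<close>

lemma cofibration_cell3: "cofibration cell3 cell3_boundary"
proof -
  let ?IB = "prod_topology unit_interval cell3"
  let ?T = "{0} \<times> topspace cell3 \<union> {0..1} \<times> cell3_boundary"
  \<comment> \<open>The ray from height 2 over the barycentre through \<open>(t, f)\<close> reaches
    the sides at scale \<open>1 / (1 - depth f)\<close> and the bottom at scale
    \<open>2 / (2 - t)\<close>. \<open>s\<close> is the smaller of the two, written so that no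
    denominator vanishes at the barycentre.\<close>
  define s where "s w = 1 / max (1 - depth (snd w)) ((2 - fst w) / 2)" for w :: "real \<times> (nat \<Rightarrow> real)"
  define r where "r w = (2 - s w * (2 - fst w), \<lambda>i. if i < 4 then 1/4 + s w * (snd w i - 1/4) else 0)" for w
  have dpos: "0 < max (1 - depth (snd w)) ((2 - fst w) / 2)" if "w \<in> topspace ?IB" for w
    using that by (auto simp: less_max_iff_disj)
  have cf: "continuous_map ?IB euclideanreal (\<lambda>w. f (snd w))" if "continuous_map cell3 euclideanreal f" for f
    using continuous_map_compose[OF continuous_map_snd that] by (simp add: o_def)
  have cs: "continuous_map ?IB euclideanreal s"
    unfolding s_def
    by (intro continuous_map_real_divide continuous_map_canonical_const continuous_map_real_max
        continuous_map_diff continuous_map_fst_interval cf continuous_map_depth) (use dpos in force)+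
  have c1: "continuous_map ?IB euclideanreal (\<lambda>w. fst (r w))"
    unfolding r_def fst_conv
    by (intro continuous_map_diff continuous_map_real_mult continuous_map_canonical_const cs continuous_map_fst_interval)
  have c2: "continuous_map ?IB (powertop_real UNIV) (\<lambda>w. snd (r w))"
    unfolding continuous_map_componentwise_UNIV
  proof
    fix i
    show "continuous_map ?IB euclideanreal (\<lambda>w. snd (r w) i)"
      unfolding r_def snd_conv
      by (cases "i < 4") (auto intro!: continuous_map_diff continuous_map_add continuous_map_real_mult
          continuous_map_canonical_const cs cf continuous_map_cell3_coordinate)
  qed
  have r_in: "r w \<in> ?T" if w: "w \<in> topspace ?IB" for w
  proof -
    obtain t f where tf: "w = (t, f)" "0 \<le> t" "t \<le> 1" "f \<in> topspace cell3" using w by auto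
    let ?M = "max (1 - depth f) ((2 - t) / 2)"
    have s: "s w = 1 / ?M" and M: "0 < ?M" using dpos[OF w] by (simp_all add: s_def tf)
    have s0: "0 \<le> s w" using s M by simp
    have sd: "s w * (1 - depth f) \<le> 1" using M by (simp add: s divide_simps)
    have s2: "s w * (2 - t) \<le> 2" using M by (simp add: s divide_simps) (simp add: max_def)
    have s1: "1 \<le> s w"
    proof -
      have "?M \<le> 1" using tf depth_nonneg[of f] by simp
      then show ?thesis unfolding s using M by (simp del: max_less_iff_conj less_max_iff_disj)
    qed
    have d: "depth (snd (r w)) = 1 - s w * (1 - depth f)"
    proof -
      have "depth (snd (r w)) = 4 * (1/4 - s w / 4) + s w * depth f"
        by (rule depth_affine[OF s0]) (simp add: r_def tf algebra_simps)
      then show ?thesis by (simp add: algebra_simps)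
    qed
    have "0 \<le> snd (r w) i" for i
    proof (cases "i < 4")
      case True
      then show ?thesis using depth_le[of i "snd (r w)"] d sd by linarith
    qed (simp add: r_def)
    moreover have "snd (r w) 0 + snd (r w) 1 + snd (r w) 2 + snd (r w) 3 = 1 + s w * (f 0 + f 1 + f 2 + f 3 - 1)"
      by (simp add: r_def tf algebra_simps)
    ultimately have mem: "snd (r w) \<in> topspace cell3"
      using tf(4) unfolding mem_cell3 by (simp add: r_def)
    have fst: "0 \<le> fst (r w)" "fst (r w) \<le> 1"
    proof -
      show "0 \<le> fst (r w)" using s2 by (simp add: r_def tf)
      have "1 * 1 \<le> s w * (2 - t)" using s1 tf by (intro mult_mono) auto
      then show "fst (r w) \<le> 1" by (simp add: r_def tf)
    qed
    show ?thesis
    proof (cases "1 - depth f \<le> (2 - t) / 2")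
      case True
      then have "s w = 2 / (2 - t)" unfolding s by (simp add: max_absorb2)
      moreover have "2 - t \<noteq> 0" using tf(3) by linarith
      ultimately have "s w * (2 - t) = 2" by (metis nonzero_eq_divide_eq)
      then have "fst (r w) = 0" using tf by (simp add: r_def)
      then show ?thesis using mem by (metis SigmaI UnI1 prod.collapse singletonI)
    next
      case False
      then have "depth (snd (r w)) = 0" using d M by (simp add: s max_def)
      then have "snd (r w) \<in> cell3_boundary" using mem by (simp add: cell3_boundary_def)
      then show ?thesis using fst by (metis SigmaI UnI2 atLeastAtMost_iff prod.collapse)
    qed
  qed
  have T: "?T \<subseteq> topspace ?IB" by (auto simp: cell3_boundary_def)
  have "continuous_map ?IB (prod_topology euclideanreal (powertop_real UNIV)) (\<lambda>w. (fst (r w), snd (r w)))"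
    using c1 c2 by (rule continuous_map_pairedI)
  then have c: "continuous_map ?IB (prod_topology euclideanreal (powertop_real UNIV)) r" by simp
  have IB: "?IB = subtopology (prod_topology euclideanreal (powertop_real UNIV)) ({0..1} \<times> topspace cell3)"
    unfolding topspace_cell3 by (simp add: cell3_def subtopology_Times)
  have "topspace ?IB = {0..1} \<times> topspace cell3" by simp
  then have "r \<in> topspace ?IB \<rightarrow> {0..1} \<times> topspace cell3"
    using r_in T by blast
  then have "continuous_map ?IB ?IB r"
    using continuous_map_into_subtopology[OF c] IB by metis
  then have "continuous_map ?IB (subtopology ?IB ?T) r"
    using r_in by (intro continuous_map_into_subtopology) blast+
  moreover have "r z = z" if "z \<in> ?T" for z
  proof -
    obtain t f where z: "z = (t, f)" by (cases z)
    then have tf: "z = (t, f)" "f \<in> topspace cell3" "0 \<le> t" "t = 0 \<or> depth f = 0"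
      using that by (auto simp: cell3_boundary_def)
    then have "s z = 1" using depth_nonneg[of f] by (auto simp: s_def max_def)
    then show ?thesis using tf by (auto simp: r_def mem_cell3)
  qed
  moreover have "closedin cell3 cell3_boundary"
    unfolding cell3_boundary_def
    using closedin_continuous_map_preimage[OF continuous_map_depth, of "{0}"] by simp
  ultimately show ?thesis unfolding cofibration_def by blast
qed

lemma path_connected_cell3: "path_connected_space cell3"
proof -
  let ?c = "\<lambda>i::nat. if i = 0 then 1 else 0::real"
  have "homotopic_with (\<lambda>_. True) cell3 (subtopology (powertop_real UNIV) (std_simplex {..<4})) id (\<lambda>_. ?c)"
  proof (rule homotopic_with_straight_line)
    show "continuous_map cell3 (powertop_real UNIV) id"
      by (simp add: cell3_def continuous_map_from_subtopology)
    fix f t assume f: "f \<in> topspace cell3" and t: "0 \<le> t" "t \<le> (1::real)"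
    then have "(1 - t) * f 0 + (1 - t) * f 1 + (1 - t) * f 2 + (1 - t) * f 3 = 1 - t"
      by (simp add: mem_cell3 flip: distrib_left)
    then show "(\<lambda>i. (1 - t) * id f i + t * ?c i) \<in> std_simplex {..<4}"
      using f t unfolding topspace_cell3[symmetric] mem_cell3 by simp
  qed simp
  then have "contractible_space cell3"
    unfolding contractible_space_def cell3_def[symmetric] by blast
  then show ?thesis by (rule contractible_imp_path_connected_space)
qed


subsection \<open>Collapsing the boundary of the cell to a point\<close>

text \<open>Rescaling the interior of the simplex to a hyperplane by \<open>1 / depth\<close>, followed by inverse
  stereographic projection.\<close>

definition collapse_den :: "(nat \<Rightarrow> real) \<Rightarrow> real" where
  "collapse_den f = (f 1 - 1/4)\<^sup>2 + (f 2 - 1/4)\<^sup>2 + (f 3 - 1/4)\<^sup>2 + (depth f)\<^sup>2"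

text \<open>With \<open>x j = (f j - 1/4) / depth f\<close>, these are the coordinates of the
  inverse stereographic projection of \<open>x\<close>. Multiplying numerator and denominator by the
  square of the depth keeps them defined on the boundary, which goes to the pole
  \<open>sphere_basepoint\<close>.\<close>

definition collapse_sphere :: "(nat \<Rightarrow> real) \<Rightarrow> nat \<Rightarrow> real" where
  "collapse_sphere f j =
     (if j = 0 then 1 - 2 * (depth f)\<^sup>2 / collapse_den f
      else if j < 4 then 2 * depth f * (f j - 1/4) / collapse_den f else 0)"

lemma collapse_den_pos:
  assumes "f \<in> topspace cell3"
  shows "0 < collapse_den f"
proof (rule ccontr)
  assume "\<not> ?thesis"
  moreover have "0 \<le> (f 1 - 1/4)\<^sup>2" "0 \<le> (f 2 - 1/4)\<^sup>2" "0 \<le> (f 3 - 1/4)\<^sup>2" "0 \<le> (depth f)\<^sup>2"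
    by simp_all
  ultimately have "(f 1 - 1/4)\<^sup>2 = 0" "(f 2 - 1/4)\<^sup>2 = 0" "(f 3 - 1/4)\<^sup>2 = 0" "(depth f)\<^sup>2 = 0"
    unfolding collapse_den_def by linarith+
  then have "f 1 = 1/4" "f 2 = 1/4" "f 3 = 1/4" "depth f = 0" by simp_all
  moreover from this have "f 0 = 1/4" using assms by (simp add: mem_cell3)
  ultimately show False by (simp add: depth_def)
qed

lemma continuous_map_collapse_sphere: "continuous_map cell3 (nsphere 3) collapse_sphere"
proof -
  have den: "continuous_map cell3 euclideanreal collapse_den"
    unfolding collapse_den_def
    by (intro continuous_map_add continuous_map_real_pow continuous_map_diff continuous_map_canonical_const
        continuous_map_cell3_coordinate continuous_map_depth)
  have "continuous_map cell3 euclideanreal (\<lambda>f. collapse_sphere f j)" for j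
  proof -
    have ne: "collapse_den f \<noteq> 0" if "f \<in> topspace cell3" for f
      using collapse_den_pos[OF that] by simp
    have "continuous_map cell3 euclideanreal (\<lambda>f. 1 - 2 * (depth f)\<^sup>2 / collapse_den f)"
      by (intro continuous_map_diff continuous_map_real_divide continuous_map_real_mult
          continuous_map_real_pow continuous_map_canonical_const continuous_map_depth den ne)
    moreover have "continuous_map cell3 euclideanreal (\<lambda>f. 2 * depth f * (f j - 1/4) / collapse_den f)"
      by (intro continuous_map_diff continuous_map_real_divide continuous_map_real_mult
          continuous_map_canonical_const continuous_map_depth continuous_map_cell3_coordinate den ne)
    ultimately show ?thesis
      unfolding collapse_sphere_def by (cases "j = 0"; cases "j < 4") simp_all
  qed
  then have c: "continuous_map cell3 (powertop_real UNIV) collapse_sphere"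
    by (simp add: continuous_map_componentwise_UNIV)
  have "(\<Sum>i\<le>3. (collapse_sphere f i)\<^sup>2) = 1" if f: "f \<in> topspace cell3" for f
  proof -
    define D where "D = collapse_den f"
    define m where "m = depth f"
    define N where "N = (f 1 - 1/4)\<^sup>2 + (f 2 - 1/4)\<^sup>2 + (f 3 - 1/4)\<^sup>2"
    have D: "D = N + m\<^sup>2" by (simp add: D_def N_def m_def collapse_den_def)
    have "D \<noteq> 0" using collapse_den_pos[OF f] by (simp add: D_def)
    have "{..3::nat} = {0, 1, 2, 3}" by auto
    then have "(\<Sum>i\<le>3. (collapse_sphere f i)\<^sup>2) = (1 - 2 * m\<^sup>2 / D)\<^sup>2 +
        ((2 * m * (f 1 - 1/4) / D)\<^sup>2 + (2 * m * (f 2 - 1/4) / D)\<^sup>2 + (2 * m * (f 3 - 1/4) / D)\<^sup>2)"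
      by (simp add: collapse_sphere_def D_def m_def)
    also have "\<dots> = (1 - 2 * m\<^sup>2 / D)\<^sup>2 + 4 * m\<^sup>2 * N / D\<^sup>2"
      by (simp add: N_def power_mult_distrib power_divide add_divide_distrib distrib_left)
    also have "\<dots> = ((D - 2 * m\<^sup>2)\<^sup>2 + 4 * m\<^sup>2 * N) / D\<^sup>2"
      using \<open>D \<noteq> 0\<close> by (simp add: field_simps power2_eq_square)
    also have "(D - 2 * m\<^sup>2)\<^sup>2 + 4 * m\<^sup>2 * N = D\<^sup>2"
      by (simp add: D power2_eq_square algebra_simps)
    finally show ?thesis using \<open>D \<noteq> 0\<close> by simp
  qed
  then show ?thesis
    using c by (auto simp: nsphere continuous_map_in_subtopology collapse_sphere_def)
qed

lemma sphere_basepoint_in_nsphere: "sphere_basepoint \<in> topspace (nsphere q)"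
proof -
  have "(\<Sum>i\<le>q. (sphere_basepoint i)\<^sup>2) = (\<Sum>i\<le>q. if i = 0 then 1 else 0)"
    by (rule sum.cong) (auto simp: sphere_basepoint_def)
  then show ?thesis by (auto simp: nsphere sphere_basepoint_def)
qed

lemma collapse_sphere_eq_basepoint_iff:
  assumes f: "f \<in> topspace cell3"
  shows "collapse_sphere f = sphere_basepoint \<longleftrightarrow> f \<in> cell3_boundary"
proof
  assume "collapse_sphere f = sphere_basepoint"
  then have "collapse_sphere f 0 = 1" by (simp add: sphere_basepoint_def)
  then show "f \<in> cell3_boundary"
    using collapse_den_pos[OF f] f by (simp add: collapse_sphere_def cell3_boundary_def)
qed (auto simp: collapse_sphere_def sphere_basepoint_def cell3_boundary_def)

text \<open>Equal images make the displacements of \<open>f\<close> and \<open>g\<close> from the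
  barycentre proportional with ratio \<open>depth f / depth g\<close>. Since \<open>depth\<close> is
  affine along this ray, the ratio can only be 1.\<close>

lemma inj_on_collapse_sphere: "inj_on collapse_sphere (topspace cell3 - cell3_boundary)"
proof (rule inj_onI)
  fix f g assume f: "f \<in> topspace cell3 - cell3_boundary" and g: "g \<in> topspace cell3 - cell3_boundary"
    and eq: "collapse_sphere f = collapse_sphere g"
  define a where "a = depth f" define b where "b = depth g"
  have a: "0 < a" and b: "0 < b"
    using f g depth_nonneg[of f] depth_nonneg[of g] by (auto simp: cell3_boundary_def a_def b_def less_le)
  define D where "D = collapse_den f" define E where "E = collapse_den g"
  have D: "0 < D" and E: "0 < E" using f g collapse_den_pos by (auto simp: D_def E_def)
  have "a\<^sup>2 / D = b\<^sup>2 / E"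
    using fun_cong[OF eq, of 0] by (simp add: collapse_sphere_def a_def b_def D_def E_def)
  then have DE: "D / a\<^sup>2 = E / b\<^sup>2" using a b D E by (simp add: field_simps)
  have v: "f i - 1/4 = (a / b) * (g i - 1/4)" if "i \<in> {1, 2, 3}" for i
  proof -
    have "2 * a * (f i - 1/4) / D = 2 * b * (g i - 1/4) / E"
      using fun_cong[OF eq, of i] that by (auto simp: collapse_sphere_def a_def b_def D_def E_def)
    moreover have "D = E * a\<^sup>2 / b\<^sup>2" using DE a b by (simp add: field_simps)
    ultimately have "2 * a * (f i - 1/4) * b\<^sup>2 / (E * a\<^sup>2) = 2 * b * (g i - 1/4) / E" by simp
    then show ?thesis using a b E by (simp add: divide_simps power2_eq_square)
  qed
  have sum: "f 0 = 1 - f 1 - f 2 - f 3" "g 0 = 1 - g 1 - g 2 - g 3"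
    using f g by (auto simp: mem_cell3)
  have v0: "f 0 - 1/4 = (a / b) * (g 0 - 1/4)"
    using v[of 1] v[of 2] v[of 3] unfolding sum by (simp add: algebra_simps)
  have aff: "f i = (1/4 - (a / b) / 4) + (a / b) * g i" if "i < 4" for i
  proof -
    have "i = 0 \<or> i \<in> {1, 2, 3}" using that by auto
    then have "f i - 1/4 = (a / b) * (g i - 1/4)" using v[of i] v0 by blast
    moreover have "(a / b) * (g i - 1/4) = (a / b) * g i - (a / b) / 4" by (simp add: right_diff_distrib)
    ultimately show ?thesis by linarith
  qed
  have "0 \<le> a / b" using a b by simp
  from depth_affine[OF this aff] have "a = 4 * (1/4 - (a / b) / 4) + (a / b) * b"
    unfolding a_def b_def .
  then have "a = b" using b by (simp add: field_simps)
  then have "f i = g i" if "i < 4" for i using aff[OF that] b by simp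
  moreover have "f i = g i" if "\<not> i < 4" for i using f g that by (auto simp: mem_cell3)
  ultimately show "f = g" by blast
qed

lemma collapse_sphere_onto:
  assumes y: "y \<in> topspace (nsphere 3)" and ne: "y \<noteq> sphere_basepoint"
  obtains f where "f \<in> topspace cell3 - cell3_boundary" "collapse_sphere f = y"
proof -
  have "{..3::nat} = {0, 1, 2, 3}" by auto
  then have y1: "(y 0)\<^sup>2 + ((y 1)\<^sup>2 + (y 2)\<^sup>2 + (y 3)\<^sup>2) = 1" and y4: "\<And>i. i > 3 \<Longrightarrow> y i = 0"
    using y by (auto simp: nsphere)
  have y0: "y 0 \<noteq> 1"
  proof
    assume 1: "y 0 = 1"
    then have "(y 1)\<^sup>2 + (y 2)\<^sup>2 + (y 3)\<^sup>2 = 0" using y1 by simp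
    then have y123: "y 1 = 0" "y 2 = 0" "y 3 = 0" by (simp_all add: add_nonneg_eq_0_iff)
    have "y i = sphere_basepoint i" for i
    proof -
      have "i = 0 \<or> i = 1 \<or> i = 2 \<or> i = 3 \<or> i > 3" by linarith
      then show ?thesis using 1 y123 y4 by (auto simp: sphere_basepoint_def)
    qed
    then show False using ne by blast
  qed
  have "(y 0)\<^sup>2 \<le> 1" using y1 by (smt (verit) zero_le_power2)
  then have "y 0 < 1" using y0 abs_square_le_1[of "y 0"] by auto
  define u where "u = 1 - y 0"
  have u: "0 < u" using \<open>y 0 < 1\<close> by (simp add: u_def)
  \<comment> \<open>\<open>v\<close> is the stereographic projection of \<open>y\<close>, with
    coordinate 0 chosen to make the sum zero. The point \<open>1/4 + m * v\<close> has depth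
    \<open>1 + m * depth v\<close>, and \<open>m\<close> solves the equation that this depth be
    \<open>m\<close>.\<close>
  define v where "v i = (if i = 0 then - (y 1 + y 2 + y 3) / u else y i / u)" for i :: nat
  define m where "m = 1 / (1 - depth v)"
  have v_sum: "v 0 + v 1 + v 2 + v 3 = 0" using u by (simp add: v_def field_simps)
  then have "depth v \<le> 0"
    using depth_le[of 0 v] depth_le[of 1 v] depth_le[of 2 v] depth_le[of 3 v] by linarith
  then have m: "0 < m" and md: "m * (1 - depth v) = 1" unfolding m_def by simp_all
  define f where "f i = (if i < 4 then 1/4 + m * v i else 0)" for i :: nat
  have "depth f = 4 * (1/4) + m * depth v"
    using m by (intro depth_affine) (simp_all add: f_def)
  then have df: "depth f = m" using md by (simp add: right_diff_distrib)
  have "0 \<le> f i" for i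
    using depth_le[of i f] df m by (cases "i < 4") (auto simp: f_def)
  moreover have "f 0 + f 1 + f 2 + f 3 = 1 + m * (v 0 + v 1 + v 2 + v 3)"
    by (simp add: f_def algebra_simps)
  ultimately have fc: "f \<in> topspace cell3"
    unfolding mem_cell3 v_sum by (simp add: f_def)
  have den: "collapse_den f = 2 * m\<^sup>2 / u"
  proof -
    have "(y 1)\<^sup>2 + (y 2)\<^sup>2 + (y 3)\<^sup>2 = u * (2 - u)"
      using y1 by (simp add: u_def power2_eq_square algebra_simps)
    then have "((y 1)\<^sup>2 + (y 2)\<^sup>2 + (y 3)\<^sup>2) / u\<^sup>2 = (2 - u) / u"
      using u by (simp add: power2_eq_square)
    moreover have "collapse_den f = m\<^sup>2 * (((y 1)\<^sup>2 + (y 2)\<^sup>2 + (y 3)\<^sup>2) / u\<^sup>2) + m\<^sup>2"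
      unfolding collapse_den_def df by (simp add: f_def v_def power_mult_distrib power_divide algebra_simps add_divide_distrib)
    ultimately have "collapse_den f = m\<^sup>2 * ((2 - u) / u) + m\<^sup>2" by simp
    also have "\<dots> = 2 * m\<^sup>2 / u" using u by (simp add: field_simps)
    finally show ?thesis .
  qed
  have "collapse_sphere f j = y j" for j
  proof -
    consider "j = 0" | "0 < j" "j < 4" | "j > 3" by linarith
    then show ?thesis
    proof cases
      case 1
      then show ?thesis using m u by (simp add: collapse_sphere_def den df u_def)
    next
      case 2
      then have "collapse_sphere f j = 2 * m * (m * (y j / u)) / (2 * m\<^sup>2 / u)"
        by (simp add: collapse_sphere_def den df f_def v_def)
      then show ?thesis using m u by (simp add: field_simps power2_eq_square)
    next
      case 3
      then show ?thesis using y4 by (simp add: collapse_sphere_def)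
    qed
  qed
  moreover have "f \<notin> cell3_boundary" using m df by (simp add: cell3_boundary_def)
  ultimately show thesis using that fc by blast
qed

lemma Hausdorff_nsphere: "Hausdorff_space (nsphere q)"
  by (simp add: nsphere Hausdorff_space_subtopology Hausdorff_powertop_real)

lemma attaching_nsphere:
  "attaching (nsphere 3) {sphere_basepoint} cell3 cell3_boundary collapse_sphere"
  unfolding attaching_def
proof (intro conjI)
  show "closedin (nsphere 3) {sphere_basepoint}"
    using sphere_basepoint_in_nsphere Hausdorff_nsphere by (simp add: closedin_Hausdorff_singleton)
  show "closedin cell3 cell3_boundary" using cofibration_cell3 by (simp add: cofibration_def)
  show c: "continuous_map cell3 (nsphere 3) collapse_sphere" by (rule continuous_map_collapse_sphere)
  show "proper_map cell3 (nsphere 3) collapse_sphere"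
    using c by (simp add: continuous_imp_proper_map compact_space_cell3 Hausdorff_imp_kc_space Hausdorff_nsphere)
  show "inj_on collapse_sphere (topspace cell3 - cell3_boundary)" by (rule inj_on_collapse_sphere)
  show "collapse_sphere ` cell3_boundary \<subseteq> {sphere_basepoint}"
  proof (rule image_subsetI)
    fix f assume f: "f \<in> cell3_boundary"
    then have "f \<in> topspace cell3" by (simp add: cell3_boundary_def)
    then show "collapse_sphere f \<in> {sphere_basepoint}"
      using f by (simp add: collapse_sphere_eq_basepoint_iff)
  qed
  show "collapse_sphere ` (topspace cell3 - cell3_boundary) = topspace (nsphere 3) - {sphere_basepoint}"
  proof
    show "collapse_sphere ` (topspace cell3 - cell3_boundary) \<subseteq> topspace (nsphere 3) - {sphere_basepoint}"
    proof (rule image_subsetI)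
      fix f assume f: "f \<in> topspace cell3 - cell3_boundary"
      then have "collapse_sphere f \<in> topspace (nsphere 3)"
        using continuous_map_image_subset_topspace[OF c] by blast
      then show "collapse_sphere f \<in> topspace (nsphere 3) - {sphere_basepoint}"
        using f by (simp add: collapse_sphere_eq_basepoint_iff)
    qed
    show "topspace (nsphere 3) - {sphere_basepoint} \<subseteq> collapse_sphere ` (topspace cell3 - cell3_boundary)"
    proof
      fix y assume "y \<in> topspace (nsphere 3) - {sphere_basepoint}"
      then show "y \<in> collapse_sphere ` (topspace cell3 - cell3_boundary)"
        using collapse_sphere_onto[of y] by (metis Diff_iff imageI singletonI)
    qed
  qed
qed

text \<open>Closed injective maps transport a cell attachment, so the one explicit cell of the
  3-sphere also provides the cells of bouquets and wedges.\<close>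

lemma attaching_embed:
  assumes att: "attaching Y C B S \<phi>" and j: "continuous_map Y W j" "closed_map Y W j" "inj_on j (topspace Y)"
    and D: "closedin W D" "j ` C \<subseteq> D" "j ` (topspace Y - C) = topspace W - D"
  shows "attaching W D B S (j \<circ> \<phi>)"
  unfolding attaching_def
proof (intro conjI)
  note a = att[unfolded attaching_def]
  show "closedin W D" "closedin B S" using D a by auto
  show "continuous_map B W (j \<circ> \<phi>)" using a j continuous_map_compose by blast
  show "proper_map B W (j \<circ> \<phi>)"
    using a j by (auto intro: proper_map_compose closed_injective_imp_proper_map)
  have "\<phi> ` (topspace B - S) \<subseteq> topspace Y" using a by blast
  then show "inj_on (j \<circ> \<phi>) (topspace B - S)"
    using a j(3) by (auto intro!: comp_inj_on intro: inj_on_subset)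
  have "\<phi> ` S \<subseteq> C" using a by blast
  then show "(j \<circ> \<phi>) ` S \<subseteq> D" using D(2) by fastforce
  show "(j \<circ> \<phi>) ` (topspace B - S) = topspace W - D"
    using a D(3) by (metis image_comp)
qed

lemma path_connected_space_attaching:
  assumes att: "attaching Y C B S \<phi>" and C: "path_connected_space (subtopology Y C)"
    and B: "path_connected_space B" and S: "S \<noteq> {}"
  shows "path_connected_space Y"
proof -
  have c: "continuous_map B Y \<phi>" and CY: "C \<subseteq> topspace Y" and SB: "S \<subseteq> topspace B" and SC: "\<phi> ` S \<subseteq> C"
    and YU: "topspace Y \<subseteq> C \<union> \<phi> ` topspace B" and YB: "\<phi> ` topspace B \<subseteq> topspace Y"
    using att closedin_subset[of Y C] closedin_subset[of B S] continuous_map_image_subset_topspace[of B Y \<phi>]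
    by (auto simp: attaching_def)
  have "path_connectedin Y C" using C CY by (simp add: path_connectedin_def)
  moreover have "path_connectedin Y (\<phi> ` topspace B)"
    by (rule path_connectedin_continuous_map_image[OF c]) (use B in \<open>simp add: path_connectedin_topspace\<close>)
  moreover have "C \<inter> \<phi> ` topspace B \<noteq> {}" using S SB SC by blast
  ultimately have "path_connectedin Y (C \<union> \<phi> ` topspace B)" by (rule path_connectedin_Un)
  moreover have "C \<union> \<phi> ` topspace B = topspace Y" using CY YU YB by blast
  ultimately show ?thesis by (simp add: path_connectedin_topspace)
qed

lemma cell3_boundary_nonempty: "cell3_boundary \<noteq> {}"
proof -
  have "(\<lambda>i. if i = 0 then 1 else 0) \<in> cell3_boundary"
    by (simp add: cell3_boundary_def mem_cell3 depth_def)
  then show ?thesis by blast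
qed

section \<open>Bouquets of spheres\<close>

lemma topspace_wedge_sum:
  "topspace (wedge_sum I X p) = insert None (\<Union>i\<in>I. wedge_incl p i ` topspace (X i))" (is "_ = ?W")
proof (rule subset_antisym)
  show "topspace (wedge_sum I X p) \<subseteq> ?W"
    using openin_topspace[of "wedge_sum I X p"] unfolding openin_wedge_sum by blast
  have "{x \<in> topspace (X i). wedge_incl p i x \<in> ?W} = topspace (X i)" if "i \<in> I" for i
    using that by auto
  then have "openin (wedge_sum I X p) ?W" by (simp add: openin_wedge_sum)
  then show "?W \<subseteq> topspace (wedge_sum I X p)" by (rule openin_subset)
qed

lemma wedge_incl_eq_iff: "wedge_incl p i x = wedge_incl p j y \<longleftrightarrow> (x = p i \<and> y = p j) \<or> (i = j \<and> x = y)"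
  by (auto simp: wedge_incl_def)

lemma subtopology_wedge_sum:
  assumes "I \<subseteq> J"
  shows "subtopology (wedge_sum J X p) (topspace (wedge_sum I X p)) = wedge_sum I X p"
  unfolding topology_eq
proof (intro allI iffI)
  fix U assume "openin (subtopology (wedge_sum J X p) (topspace (wedge_sum I X p))) U"
  then obtain V where V: "openin (wedge_sum J X p) V" and U: "U = V \<inter> topspace (wedge_sum I X p)"
    unfolding openin_subtopology by blast
  show "openin (wedge_sum I X p) U"
    unfolding openin_wedge_sum
  proof (intro conjI ballI)
    show "U \<subseteq> insert None (\<Union>i\<in>I. wedge_incl p i ` topspace (X i))"
      by (simp add: U topspace_wedge_sum)
    fix i assume i: "i \<in> I"
    then have "{x \<in> topspace (X i). wedge_incl p i x \<in> U} = {x \<in> topspace (X i). wedge_incl p i x \<in> V}"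
      by (auto simp: U topspace_wedge_sum)
    moreover have "openin (X i) {x \<in> topspace (X i). wedge_incl p i x \<in> V}"
      using V subsetD[OF assms i] unfolding openin_wedge_sum by (elim conjE) (erule (1) bspec)
    ultimately show "openin (X i) {x \<in> topspace (X i). wedge_incl p i x \<in> U}" by simp
  qed
next
  fix U assume U: "openin (wedge_sum I X p) U"
  then have sub: "U \<subseteq> topspace (wedge_sum I X p)" by (rule openin_subset)
  \<comment> \<open>An open set that misses the base point is also open in the larger wedge; one
    that contains it is completed by all of the added summands.\<close>
  define V where "V = U \<union> (if None \<in> U then \<Union>j\<in>J - I. wedge_incl p j ` topspace (X j) else {})"
  have "openin (X j) {x \<in> topspace (X j). wedge_incl p j x \<in> V}" if j: "j \<in> J" for j
  proof (cases "j \<in> I")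
    case True
    have "wedge_incl p j x \<in> V \<longleftrightarrow> wedge_incl p j x \<in> U" for x
      using True by (auto simp: V_def wedge_incl_eq_iff) (auto simp: wedge_incl_def)
    then show ?thesis using U True by (simp add: openin_wedge_sum)
  next
    case False
    have "wedge_incl p j x \<in> V \<longleftrightarrow> None \<in> U" if "x \<in> topspace (X j)" for x
    proof
      assume V: "wedge_incl p j x \<in> V"
      show "None \<in> U"
      proof (rule ccontr)
        assume N: "None \<notin> U"
        then have U': "wedge_incl p j x \<in> U" using V by (simp add: V_def)
        then have "x \<noteq> p j" using N by (auto simp: wedge_incl_def)
        then have "wedge_incl p j x \<notin> topspace (wedge_sum I X p)"
          using False by (auto simp: topspace_wedge_sum wedge_incl_def split: if_splits)
        then show False using U' sub by blast
      qed
    next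
      assume "None \<in> U"
      then show "wedge_incl p j x \<in> V" using that j False by (auto simp: V_def)
    qed
    then have "{x \<in> topspace (X j). wedge_incl p j x \<in> V} = (if None \<in> U then topspace (X j) else {})"
      by auto
    then show ?thesis by simp
  qed
  moreover have "V \<subseteq> topspace (wedge_sum J X p)"
    using sub assms by (auto simp: V_def topspace_wedge_sum split: if_splits)
  ultimately have "openin (wedge_sum J X p) V"
    by (simp add: openin_wedge_sum topspace_wedge_sum)
  moreover have "U = V \<inter> topspace (wedge_sum I X p)"
  proof
    show "U \<subseteq> V \<inter> topspace (wedge_sum I X p)" using sub by (auto simp: V_def)
    show "V \<inter> topspace (wedge_sum I X p) \<subseteq> U"
      by (auto simp: V_def topspace_wedge_sum wedge_incl_eq_iff split: if_splits) (auto simp: wedge_incl_def)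
  qed
  ultimately show "openin (subtopology (wedge_sum J X p) (topspace (wedge_sum I X p))) U"
    unfolding openin_subtopology by blast
qed

lemma closedin_wedge_sum_subset:
  assumes "I \<subseteq> J" and p: "\<And>j. j \<in> J \<Longrightarrow> closedin (X j) {p j}"
  shows "closedin (wedge_sum J X p) (topspace (wedge_sum I X p))"
  unfolding closedin_def openin_wedge_sum
proof (intro conjI ballI)
  show "topspace (wedge_sum I X p) \<subseteq> topspace (wedge_sum J X p)"
    using assms(1) by (auto simp: topspace_wedge_sum)
  show "topspace (wedge_sum J X p) - topspace (wedge_sum I X p) \<subseteq> insert None (\<Union>i\<in>J. wedge_incl p i ` topspace (X i))"
    by (auto simp: topspace_wedge_sum)
  fix j assume j: "j \<in> J"
  have "{x \<in> topspace (X j). wedge_incl p j x \<in> topspace (wedge_sum J X p) - topspace (wedge_sum I X p)}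
     = (if j \<in> I then {} else topspace (X j) - {p j})"
    using j by (auto simp: topspace_wedge_sum wedge_incl_def split: if_splits)
  then show "openin (X j) {x \<in> topspace (X j).
      wedge_incl p j x \<in> topspace (wedge_sum J X p) - topspace (wedge_sum I X p)}"
    using p[OF j] by (simp add: openin_diff)
qed

lemma continuous_map_wedge_incl:
  assumes "i \<in> I"
  shows "continuous_map (X i) (wedge_sum I X p) (wedge_incl p i)"
  using assms by (auto simp: continuous_map_def openin_wedge_sum topspace_wedge_sum)

lemma closed_map_wedge_incl:
  assumes i: "i \<in> I" and p: "\<And>j. j \<in> I \<Longrightarrow> closedin (X j) {p j}"
  shows "closed_map (X i) (wedge_sum I X p) (wedge_incl p i)"
  unfolding closed_map_def
proof (intro allI impI)
  fix C assume C: "closedin (X i) C"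
  then have CX: "C \<subseteq> topspace (X i)" by (rule closedin_subset)
  show "closedin (wedge_sum I X p) (wedge_incl p i ` C)"
    unfolding closedin_def openin_wedge_sum
  proof (intro conjI ballI)
    show "wedge_incl p i ` C \<subseteq> topspace (wedge_sum I X p)"
      using CX i by (auto simp: topspace_wedge_sum)
    show "topspace (wedge_sum I X p) - wedge_incl p i ` C \<subseteq> insert None (\<Union>i\<in>I. wedge_incl p i ` topspace (X i))"
      by (auto simp: topspace_wedge_sum)
    fix j assume j: "j \<in> I"
    have "{x \<in> topspace (X j). wedge_incl p j x \<in> topspace (wedge_sum I X p) - wedge_incl p i ` C}
       = (if j = i then topspace (X j) - C else if p i \<in> C then topspace (X j) - {p j} else topspace (X j))"
      using j by (auto simp: topspace_wedge_sum wedge_incl_def image_iff split: if_splits)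
    then show "openin (X j) {x \<in> topspace (X j). wedge_incl p j x \<in> topspace (wedge_sum I X p) - wedge_incl p i ` C}"
      using p[OF j] C by (simp add: openin_diff)
  qed
qed

lemma inj_wedge_incl: "inj_on (wedge_incl p i) A"
  by (auto simp: inj_on_def wedge_incl_eq_iff)

lemma closedin_sphere_basepoint: "closedin (nsphere q) {sphere_basepoint}"
  using sphere_basepoint_in_nsphere Hausdorff_nsphere by (simp add: closedin_Hausdorff_singleton)

lemma topspace_sphere_bouquet_0: "topspace (sphere_bouquet 0 q) = {None}"
  by (simp add: sphere_bouquet_def topspace_wedge_sum)

lemma None_in_sphere_bouquet: "None \<in> topspace (sphere_bouquet k q)"
  by (simp add: sphere_bouquet_def topspace_wedge_sum)

lemma subtopology_sphere_bouquet:
  "subtopology (sphere_bouquet (Suc k) q) (topspace (sphere_bouquet k q)) = sphere_bouquet k q"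
  unfolding sphere_bouquet_def by (rule subtopology_wedge_sum) auto

lemma closedin_None_sphere_bouquet: "closedin (sphere_bouquet k q) {None}"
proof -
  have "closedin (sphere_bouquet k q) (topspace (wedge_sum {} (\<lambda>_. nsphere q) (\<lambda>_. sphere_basepoint)))"
    unfolding sphere_bouquet_def by (rule closedin_wedge_sum_subset) (simp_all add: closedin_sphere_basepoint)
  then show ?thesis by (simp add: topspace_wedge_sum)
qed

lemma attaching_sphere_bouquet:
  "attaching (sphere_bouquet (Suc k) 3) (topspace (sphere_bouquet k 3)) cell3 cell3_boundary
     (wedge_incl (\<lambda>_. sphere_basepoint) k \<circ> collapse_sphere)"
proof (rule attaching_embed[OF attaching_nsphere])
  let ?p = "\<lambda>_::nat. sphere_basepoint"
  show "continuous_map (nsphere 3) (sphere_bouquet (Suc k) 3) (wedge_incl ?p k)"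
    unfolding sphere_bouquet_def by (rule continuous_map_wedge_incl[where X = "\<lambda>_. nsphere 3"]) simp
  show "closed_map (nsphere 3) (sphere_bouquet (Suc k) 3) (wedge_incl ?p k)"
    unfolding sphere_bouquet_def
    by (rule closed_map_wedge_incl[where X = "\<lambda>_. nsphere 3"]) (simp_all add: closedin_sphere_basepoint)
  show "inj_on (wedge_incl ?p k) (topspace (nsphere 3))" by (rule inj_wedge_incl)
  show "closedin (sphere_bouquet (Suc k) 3) (topspace (sphere_bouquet k 3))"
    unfolding sphere_bouquet_def by (rule closedin_wedge_sum_subset) (auto simp: closedin_sphere_basepoint)
  show "wedge_incl ?p k ` {sphere_basepoint} \<subseteq> topspace (sphere_bouquet k 3)"
    by (simp add: wedge_incl_def None_in_sphere_bouquet)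
  have "wedge_incl ?p k x \<notin> topspace (sphere_bouquet k 3)" if "x \<noteq> sphere_basepoint" for x
    using that by (auto simp: sphere_bouquet_def topspace_wedge_sum wedge_incl_def)
  then show "wedge_incl ?p k ` (topspace (nsphere 3) - {sphere_basepoint})
      = topspace (sphere_bouquet (Suc k) 3) - topspace (sphere_bouquet k 3)"
    by (auto simp: sphere_bouquet_def topspace_wedge_sum lessThan_Suc wedge_incl_eq_iff)
       (auto simp: wedge_incl_def)
qed

lemma path_connected_sphere_bouquet: "path_connected_space (sphere_bouquet k 3)"
proof (induction k)
  case 0
  show ?case
    by (rule contractible_imp_path_connected_space, rule contractible_space_subset_singleton[of _ None])
       (simp add: topspace_sphere_bouquet_0)
next
  case (Suc k)
  show ?case
    by (rule path_connected_space_attaching[OF attaching_sphere_bouquet])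
       (simp_all add: subtopology_sphere_bouquet Suc path_connected_cell3 cell3_boundary_nonempty)
qed

lemma topspace_wedge:
  "topspace (wedge X a Y b) = insert None (wedge_inl a ` topspace X \<union> wedge_inr b ` topspace Y)" (is "_ = ?W")
proof (rule subset_antisym)
  show "topspace (wedge X a Y b) \<subseteq> ?W"
    using openin_topspace[of "wedge X a Y b"] unfolding openin_wedge by blast
  have "{x \<in> topspace X. wedge_inl a x \<in> ?W} = topspace X" "{y \<in> topspace Y. wedge_inr b y \<in> ?W} = topspace Y"
    by auto
  then have "openin (wedge X a Y b) ?W" by (simp add: openin_wedge)
  then show "?W \<subseteq> topspace (wedge X a Y b)" by (rule openin_subset)
qed

lemma wedge_inl_inr_eq_iff:
  "wedge_inl a x = wedge_inl a x' \<longleftrightarrow> x = x'" "wedge_inr b y = wedge_inr b y' \<longleftrightarrow> y = y'"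
  "wedge_inl a x = wedge_inr b y \<longleftrightarrow> x = a \<and> y = b" "wedge_inr b y = wedge_inl a x \<longleftrightarrow> x = a \<and> y = b"
  "wedge_inl a x = None \<longleftrightarrow> x = a" "wedge_inr b y = None \<longleftrightarrow> y = b"
  by (auto simp: wedge_inl_def wedge_inr_def)

lemma subtopology_wedge:
  assumes C: "C \<subseteq> topspace Y" "a \<in> C"
  shows "subtopology (wedge Y a X b) (topspace (wedge (subtopology Y C) a X b)) = wedge (subtopology Y C) a X b"
  unfolding topology_eq
proof (intro allI iffI)
  let ?W = "topspace (wedge (subtopology Y C) a X b)"
  have tC: "topspace (subtopology Y C) = C" using C by auto
  fix U
  {
    assume "openin (subtopology (wedge Y a X b) ?W) U"
    then obtain V where V: "openin (wedge Y a X b) V" and U: "U = V \<inter> ?W"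
      unfolding openin_subtopology by blast
    have e1: "{x \<in> C. wedge_inl a x \<in> U} = {x \<in> topspace Y. wedge_inl a x \<in> V} \<inter> C"
      using C by (auto simp: U topspace_wedge)
    have e2: "{y \<in> topspace X. wedge_inr b y \<in> U} = {y \<in> topspace X. wedge_inr b y \<in> V}"
      by (auto simp: U topspace_wedge)
    note V' = V[unfolded openin_wedge]
    have "U \<subseteq> insert None (wedge_inl a ` C \<union> wedge_inr b ` topspace X)"
      using U tC by (simp add: topspace_wedge)
    then show "openin (wedge (subtopology Y C) a X b) U"
      unfolding openin_wedge tC e1 e2 using V' by (simp add: openin_subtopology_Int)
  next
    assume U: "openin (wedge (subtopology Y C) a X b) U"
    then have sub: "U \<subseteq> ?W" by (rule openin_subset)
    obtain T where T: "openin Y T" "{x \<in> C. wedge_inl a x \<in> U} = T \<inter> C"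
      using U unfolding openin_wedge tC openin_subtopology by blast
    have TY: "T \<subseteq> topspace Y" using T openin_subset by blast
    \<comment> \<open>An open \<open>T\<close> of \<open>Y\<close> with the same trace on
      \<open>C\<close> supplies the missing points of the left summand. Because \<open>a\<close>
      lies in \<open>C\<close>, the base point is brought in only if \<open>U\<close> already
      contains it.\<close>
    define V where "V = U \<union> wedge_inl a ` T"
    have UC: "x \<in> C" if "wedge_inl a x \<in> U" for x
      using that sub C by (auto simp: topspace_wedge wedge_inl_inr_eq_iff)
    have "{x \<in> topspace Y. wedge_inl a x \<in> V} = T"
      using T TY UC by (auto simp: V_def wedge_inl_inr_eq_iff)
    moreover have aT: "None \<in> U" if "a \<in> T"
    proof -
      have "a \<in> {x \<in> C. wedge_inl a x \<in> U}" using T(2) that C by blast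
      then show ?thesis by (simp add: wedge_inl_def)
    qed
    have "wedge_inr b y \<in> V \<longleftrightarrow> wedge_inr b y \<in> U" for y
      using aT by (auto simp: V_def wedge_inl_inr_eq_iff) (simp add: wedge_inr_def)
    ultimately have "openin (wedge Y a X b) V"
      using U T sub C TY by (auto simp: openin_wedge V_def topspace_wedge)
    moreover have "U = V \<inter> ?W"
    proof
      show "U \<subseteq> V \<inter> ?W" using sub by (auto simp: V_def)
      show "V \<inter> ?W \<subseteq> U"
      proof
        fix z assume z: "z \<in> V \<inter> ?W"
        show "z \<in> U"
        proof (cases "z \<in> U")
          case False
          then obtain x where x: "x \<in> T" "z = wedge_inl a x" using z by (auto simp: V_def)
          then have "x \<in> C" using z C by (auto simp: topspace_wedge wedge_inl_inr_eq_iff)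
          then show ?thesis using x T by auto
        qed simp
      qed
    qed
    ultimately show "openin (subtopology (wedge Y a X b) ?W) U"
      unfolding openin_subtopology by blast
  }
qed

lemma attaching_wedge:
  assumes att: "attaching Y C B S \<phi>" and a: "a \<in> C" "closedin Y {a}" and b: "closedin X {b}"
  shows "attaching (wedge Y a X b) (topspace (wedge (subtopology Y C) a X b)) B S (wedge_inl a \<circ> \<phi>)"
proof (rule attaching_embed[OF att])
  have C: "closedin Y C" using att by (simp add: attaching_def)
  have CY: "C \<subseteq> topspace Y" using C closedin_subset by blast
  have tC: "topspace (subtopology Y C) = C" using CY by auto
  show "continuous_map Y (wedge Y a X b) (wedge_inl a)"
    by (auto simp: continuous_map_def openin_wedge topspace_wedge)
  show "inj_on (wedge_inl a) (topspace Y)"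
    by (simp add: inj_on_def wedge_inl_inr_eq_iff)
  show "closed_map Y (wedge Y a X b) (wedge_inl a)"
    unfolding closed_map_def
  proof (intro allI impI)
    fix D assume D: "closedin Y D"
    then have DY: "D \<subseteq> topspace Y" by (rule closedin_subset)
    have e1: "{x \<in> topspace Y. wedge_inl a x \<in> topspace (wedge Y a X b) - wedge_inl a ` D} = topspace Y - D"
      by (auto simp: topspace_wedge wedge_inl_inr_eq_iff)
    have e2: "{y \<in> topspace X. wedge_inr b y \<in> topspace (wedge Y a X b) - wedge_inl a ` D}
        = (if a \<in> D then topspace X - {b} else topspace X)"
      by (auto simp: topspace_wedge wedge_inl_inr_eq_iff)
    have "wedge_inl a ` D \<subseteq> topspace (wedge Y a X b)"
      using DY by (auto simp: topspace_wedge)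
    moreover have "topspace (wedge Y a X b) \<subseteq> insert None (wedge_inl a ` topspace Y \<union> wedge_inr b ` topspace X)"
      by (simp add: topspace_wedge)
    moreover have "openin X (if a \<in> D then topspace X - {b} else topspace X)"
      using b by (simp add: openin_diff)
    moreover have "openin Y (topspace Y - D)" using D by (simp add: openin_diff)
    ultimately show "closedin (wedge Y a X b) (wedge_inl a ` D)"
      unfolding closedin_def[of "wedge Y a X b"] openin_wedge e1 e2 by blast
  qed
  show "closedin (wedge Y a X b) (topspace (wedge (subtopology Y C) a X b))"
  proof -
    have e1: "{x \<in> topspace Y. wedge_inl a x \<in> topspace (wedge Y a X b) - topspace (wedge (subtopology Y C) a X b)} = topspace Y - C"
      using a CY by (auto simp: topspace_wedge wedge_inl_inr_eq_iff tC)
    have e2: "{y \<in> topspace X. wedge_inr b y \<in> topspace (wedge Y a X b) - topspace (wedge (subtopology Y C) a X b)} = {}"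
      by (auto simp: topspace_wedge)
    have "topspace (wedge (subtopology Y C) a X b) \<subseteq> topspace (wedge Y a X b)"
      by (auto simp: topspace_wedge)
    moreover have "topspace (wedge Y a X b) \<subseteq> insert None (wedge_inl a ` topspace Y \<union> wedge_inr b ` topspace X)"
      by (simp add: topspace_wedge)
    moreover have "openin Y (topspace Y - C)" using C by (simp add: openin_diff)
    ultimately show ?thesis
      unfolding closedin_def[of "wedge Y a X b"] openin_wedge e1 e2 using openin_empty by blast
  qed
  show "wedge_inl a ` C \<subseteq> topspace (wedge (subtopology Y C) a X b)"
    using CY by (auto simp: topspace_wedge)
  show "wedge_inl a ` (topspace Y - C) = topspace (wedge Y a X b) - topspace (wedge (subtopology Y C) a X b)"
    using a CY by (auto simp: topspace_wedge wedge_inl_inr_eq_iff tC)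
qed

lemma wedge_trivial_homeomorphic:
  assumes W: "topspace W = {a}" and b: "b \<in> topspace X"
  shows "X homeomorphic_space wedge W a X b"
proof -
  have "homeomorphic_map X (wedge W a X b) (wedge_inr b)"
  proof (rule bijective_open_imp_homeomorphic_map)
    show "continuous_map X (wedge W a X b) (wedge_inr b)"
      by (auto simp: continuous_map_def openin_wedge topspace_wedge)
    show "open_map X (wedge W a X b) (wedge_inr b)"
      unfolding open_map_def
    proof (intro allI impI)
      fix U assume U: "openin X U"
      then have UX: "U \<subseteq> topspace X" by (rule openin_subset)
      have e1: "{x \<in> topspace W. wedge_inl a x \<in> wedge_inr b ` U} = (if b \<in> U then topspace W else {})"
        by (auto simp: W wedge_inl_inr_eq_iff)
      have e2: "{y \<in> topspace X. wedge_inr b y \<in> wedge_inr b ` U} = U"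
        using UX by (auto simp: wedge_inl_inr_eq_iff)
      show "openin (wedge W a X b) (wedge_inr b ` U)"
        unfolding openin_wedge e1 e2 using U UX by auto
    qed
    show "wedge_inr b ` topspace X = topspace (wedge W a X b)"
      using b by (auto simp: topspace_wedge W wedge_inl_def wedge_inr_def)
    show "inj_on (wedge_inr b) (topspace X)"
      by (simp add: inj_on_def wedge_inl_inr_eq_iff)
  qed
  then show ?thesis by (rule homeomorphic_map_imp_homeomorphic_space)
qed

text \<open>A common description of all comparison spaces. Path connectedness of the bottom stage,
  inherited by all stages, allows a null-homotopic attaching map to be moved to whichever point the
  tower prescribes.\<close>

definition cell_tower :: "(nat \<Rightarrow> 'a topology) \<Rightarrow> nat \<Rightarrow> bool" where
  "cell_tower Z N \<longleftrightarrow> path_connected_space (Z 0) \<and>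
     (\<forall>j<N. subtopology (Z (Suc j)) (topspace (Z j)) = Z j \<and>
        (\<exists>\<phi> z. attaching (Z (Suc j)) (topspace (Z j)) cell3 cell3_boundary \<phi> \<and> z \<in> topspace (Z j) \<and>
           (\<forall>s \<in> cell3_boundary. \<phi> s = z)))"

lemma cell_tower_path_connected:
  assumes "cell_tower Z N" "j \<le> N"
  shows "path_connected_space (Z j)"
  using assms(2)
proof (induction j)
  case (Suc j)
  then obtain \<phi> where "attaching (Z (Suc j)) (topspace (Z j)) cell3 cell3_boundary \<phi>"
    and "subtopology (Z (Suc j)) (topspace (Z j)) = Z j"
    using assms(1) unfolding cell_tower_def by (meson Suc_le_lessD)
  moreover have "path_connected_space (Z j)" using Suc by simp
  ultimately show ?case
    by (metis path_connected_space_attaching path_connected_cell3 cell3_boundary_nonempty)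
qed (use assms in \<open>simp add: cell_tower_def\<close>)

lemma cell3_boundary_collapse: "s \<in> cell3_boundary \<Longrightarrow> collapse_sphere s = sphere_basepoint"
  by (simp add: collapse_sphere_eq_basepoint_iff cell3_boundary_def)

lemma cell_tower_sphere_bouquet: "cell_tower (\<lambda>j. sphere_bouquet (k + j) 3) N"
  unfolding cell_tower_def
proof (intro conjI allI impI)
  show "path_connected_space (sphere_bouquet (k + 0) 3)" by (rule path_connected_sphere_bouquet)
  fix j
  show "subtopology (sphere_bouquet (k + Suc j) 3) (topspace (sphere_bouquet (k + j) 3)) = sphere_bouquet (k + j) 3"
    by (simp add: subtopology_sphere_bouquet)
  show "\<exists>\<phi> z. attaching (sphere_bouquet (k + Suc j) 3) (topspace (sphere_bouquet (k + j) 3)) cell3 cell3_boundary \<phi> \<and>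
      z \<in> topspace (sphere_bouquet (k + j) 3) \<and> (\<forall>s \<in> cell3_boundary. \<phi> s = z)"
    by (intro exI[of _ "wedge_incl (\<lambda>_. sphere_basepoint) (k + j) \<circ> collapse_sphere"] exI[of _ None] conjI)
       (simp_all add: attaching_sphere_bouquet None_in_sphere_bouquet wedge_incl_def cell3_boundary_collapse)
qed

lemma cell_tower_nsphere:
  "cell_tower (\<lambda>j. if j = 0 then subtopology (nsphere 3) {sphere_basepoint} else nsphere 3) 1"
  unfolding cell_tower_def
proof (intro conjI allI impI)
  have t: "topspace (subtopology (nsphere 3) {sphere_basepoint}) = {sphere_basepoint}"
    using sphere_basepoint_in_nsphere by auto
  show "path_connected_space (if 0 = (0::nat) then subtopology (nsphere 3) {sphere_basepoint} else nsphere 3)"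
    by (simp add: contractible_imp_path_connected_space)
  fix j :: nat assume j: "j < 1"
  show "subtopology (if Suc j = 0 then subtopology (nsphere 3) {sphere_basepoint} else nsphere 3)
      (topspace (if j = 0 then subtopology (nsphere 3) {sphere_basepoint} else nsphere 3))
    = (if j = 0 then subtopology (nsphere 3) {sphere_basepoint} else nsphere 3)"
    using j t by simp
  show "\<exists>\<phi> z. attaching (if Suc j = 0 then subtopology (nsphere 3) {sphere_basepoint} else nsphere 3)
      (topspace (if j = 0 then subtopology (nsphere 3) {sphere_basepoint} else nsphere 3)) cell3 cell3_boundary \<phi> \<and>
      z \<in> topspace (if j = 0 then subtopology (nsphere 3) {sphere_basepoint} else nsphere 3) \<and>
      (\<forall>s \<in> cell3_boundary. \<phi> s = z)"
    by (intro exI[of _ collapse_sphere] exI[of _ sphere_basepoint] conjI)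
       (use attaching_nsphere t j in \<open>simp_all add: cell3_boundary_collapse\<close>)
qed

text \<open>The empty bouquet is a point, so stage 0 is a copy of \<open>X\<close>; each further
  cell is attached inside the bouquet summand, at the common base point.\<close>

lemma cell_tower_wedge:
  assumes X: "path_connected_space X" and x: "x \<in> topspace X" "closedin X {x}"
  shows "cell_tower (\<lambda>j. wedge (sphere_bouquet j 3) bouquet_basepoint X x) N"
  unfolding cell_tower_def bouquet_basepoint_def
proof (intro conjI allI impI)
  have "X homeomorphic_space wedge (sphere_bouquet 0 3) None X x"
    by (rule wedge_trivial_homeomorphic) (simp_all add: topspace_sphere_bouquet_0 x)
  then show "path_connected_space (wedge (sphere_bouquet 0 3) None X x)"
    using X homeomorphic_path_connected_space by blast
  fix j
  let ?C = "topspace (sphere_bouquet j 3)"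
  have sub: "subtopology (sphere_bouquet (Suc j) 3) ?C = sphere_bouquet j 3"
    by (rule subtopology_sphere_bouquet)
  have C: "?C \<subseteq> topspace (sphere_bouquet (Suc j) 3)"
    by (auto simp: sphere_bouquet_def topspace_wedge_sum lessThan_Suc)
  show "subtopology (wedge (sphere_bouquet (Suc j) 3) None X x) (topspace (wedge (sphere_bouquet j 3) None X x))
      = wedge (sphere_bouquet j 3) None X x"
    using subtopology_wedge[OF C, of None X x] by (simp add: sub None_in_sphere_bouquet)
  let ?\<phi> = "wedge_inl None \<circ> (wedge_incl (\<lambda>_. sphere_basepoint) j \<circ> collapse_sphere)"
  have 1: "attaching (wedge (sphere_bouquet (Suc j) 3) None X x) (topspace (wedge (sphere_bouquet j 3) None X x))
      cell3 cell3_boundary ?\<phi>"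
    using attaching_wedge[OF attaching_sphere_bouquet[of j] None_in_sphere_bouquet[of j 3]
        closedin_None_sphere_bouquet[of "Suc j" 3] x(2)]
    by (simp only: sub)
  have 2: "None \<in> topspace (wedge (sphere_bouquet j 3) None X x)"
    by (simp add: topspace_wedge)
  have 3: "\<forall>s \<in> cell3_boundary. ?\<phi> s = None"
    by (simp add: cell3_boundary_collapse wedge_incl_def wedge_inl_def)
  show "\<exists>\<phi> z. attaching (wedge (sphere_bouquet (Suc j) 3) None X x)
      (topspace (wedge (sphere_bouquet j 3) None X x)) cell3 cell3_boundary \<phi> \<and>
      z \<in> topspace (wedge (sphere_bouquet j 3) None X x) \<and> (\<forall>s \<in> cell3_boundary. \<phi> s = z)"
    by (intro exI[of _ ?\<phi>] exI[of _ None] conjI 1 2 3)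
qed

section \<open>Finite simplicial complexes\<close>

definition finite_complex :: "'a set set \<Rightarrow> bool" where
  "finite_complex K \<longleftrightarrow> finite K \<and>
     (\<forall>S\<in>K. finite S \<and> S \<noteq> {} \<and> (\<forall>T. T \<subseteq> S \<longrightarrow> T \<noteq> {} \<longrightarrow> T \<in> K))"

lemma finite_complexD:
  assumes "finite_complex K" "S \<in> K"
  shows "finite S" "S \<noteq> {}" "\<And>T. T \<subseteq> S \<Longrightarrow> T \<noteq> {} \<Longrightarrow> T \<in> K"
proof -
  have "\<forall>S\<in>K. finite S \<and> S \<noteq> {} \<and> (\<forall>T. T \<subseteq> S \<longrightarrow> T \<noteq> {} \<longrightarrow> T \<in> K)"
    using assms(1) unfolding finite_complex_def by (rule conjunct2)
  then have S: "finite S \<and> S \<noteq> {} \<and> (\<forall>T. T \<subseteq> S \<longrightarrow> T \<noteq> {} \<longrightarrow> T \<in> K)"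
    using assms(2) by (rule bspec)
  from S show "finite S" by (rule conjunct1)
  from S show "S \<noteq> {}" by (elim conjE)
  from S show "T \<in> K" if "T \<subseteq> S" "T \<noteq> {}" for T using that by (elim conjE allE impE) assumption+
qed

lemma finite_complex_finite: "finite_complex K \<Longrightarrow> finite K"
  by (simp add: finite_complex_def)

lemma support_std_simplex:
  assumes "finite S" "f \<in> std_simplex S"
  shows "support f \<subseteq> S" "support f \<noteq> {}" "f \<in> std_simplex (support f)"
proof -
  show sub: "support f \<subseteq> S" using assms by (auto simp: support_def std_simplex_def)
  have "(\<Sum>v\<in>support f. f v) = (\<Sum>v\<in>S. f v)"
    using assms sub by (intro sum.mono_neutral_left) (auto simp: support_def)
  then have 1: "(\<Sum>v\<in>support f. f v) = 1" using assms by (simp add: std_simplex_def)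
  then show "support f \<noteq> {}" by auto
  show "f \<in> std_simplex (support f)" using assms 1 by (auto simp: std_simplex_def support_def)
qed

lemma std_simplex_mono:
  assumes "finite T" "S \<subseteq> T"
  shows "std_simplex S \<subseteq> std_simplex T"
proof
  fix f assume f: "f \<in> std_simplex S"
  have "(\<Sum>v\<in>S. f v) = (\<Sum>v\<in>T. f v)"
    using assms f by (intro sum.mono_neutral_left) (auto simp: std_simplex_def)
  then show "f \<in> std_simplex T" using assms f by (auto simp: std_simplex_def)
qed

lemma std_simplex_convex:
  assumes "f \<in> std_simplex S" "g \<in> std_simplex S" "0 \<le> t" "t \<le> 1"
  shows "(\<lambda>v. (1 - t) * f v + t * g v) \<in> std_simplex S"
proof -
  have "(\<Sum>v\<in>S. (1 - t) * f v + t * g v) = (1 - t) * (\<Sum>v\<in>S. f v) + t * (\<Sum>v\<in>S. g v)"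
    by (simp add: sum.distrib sum_distrib_left)
  then show ?thesis using assms by (auto simp: std_simplex_def)
qed

lemma realization_points_support:
  assumes "f \<in> realization_points K"
  shows "support f \<in> K" "f \<in> std_simplex (support f)" "\<And>v. 0 \<le> f v"
proof -
  from assms have f: "(\<forall>v. 0 \<le> f v) \<and> support f \<in> K \<and> (\<Sum>v\<in>support f. f v) = 1"
    unfolding realization_points_def by (rule CollectD)
  then show "support f \<in> K" "0 \<le> f v" for v by simp_all
  have "\<forall>v. v \<notin> support f \<longrightarrow> f v = 0" by (simp add: support_def)
  with f show "f \<in> std_simplex (support f)" unfolding std_simplex_def by simp
qed

lemma mem_realization_points:
  assumes K: "finite_complex K"
  shows "f \<in> realization_points K \<longleftrightarrow> (\<exists>S\<in>K. f \<in> std_simplex S)"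
proof
  assume "f \<in> realization_points K"
  then show "\<exists>S\<in>K. f \<in> std_simplex S"
    using realization_points_support by blast
next
  assume "\<exists>S\<in>K. f \<in> std_simplex S"
  then obtain S where S: "S \<in> K" "f \<in> std_simplex S" by blast
  note s = support_std_simplex[OF finite_complexD(1)[OF K S(1)] S(2)]
  have "support f \<in> K" using finite_complexD(3)[OF K S(1) s(1,2)] .
  then show "f \<in> realization_points K"
    using s(3) by (simp add: realization_points_def std_simplex_def)
qed

lemma closed_simplex_eq:
  assumes K: "finite_complex K" and S: "S \<in> K"
  shows "closed_simplex K S = std_simplex S"
proof
  show "closed_simplex K S \<subseteq> std_simplex S"
  proof
    fix f assume "f \<in> closed_simplex K S"
    then have f: "f \<in> realization_points K" "support f \<subseteq> S" by (simp_all add: closed_simplex_def)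
    show "f \<in> std_simplex S"
      using realization_points_support(2)[OF f(1)] std_simplex_mono[OF finite_complexD(1)[OF K S] f(2)] by blast
  qed
  show "std_simplex S \<subseteq> closed_simplex K S"
  proof
    fix f assume f: "f \<in> std_simplex S"
    then have "f \<in> realization_points K" using S mem_realization_points[OF K] by blast
    then show "f \<in> closed_simplex K S"
      using support_std_simplex(1)[OF finite_complexD(1)[OF K S] f] by (simp add: closed_simplex_def)
  qed
qed

lemma closedin_realization_points:
  assumes "finite_complex K"
  shows "closedin (powertop_real UNIV) (realization_points K)"
proof -
  have "realization_points K = (\<Union>S\<in>K. std_simplex S)"
    using mem_realization_points[OF assms] by blast
  moreover have "closedin (powertop_real UNIV) (\<Union>S\<in>K. std_simplex S)"
    using finite_complex_finite[OF assms] finite_complexD(1)[OF assms] by (intro closedin_Union) (auto intro: closedin_std_simplex)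
  ultimately show ?thesis by simp
qed

text \<open>There are finitely many simplices, each closed in the product space, so a set that is
  closed in every simplex is closed in the product. Hence the weak and the subspace topology agree
  and continuity can be checked coordinatewise.\<close>

lemma geometric_realization_eq:
  assumes K: "finite_complex K"
  shows "geometric_realization K = subtopology (powertop_real UNIV) (realization_points K)"
  unfolding topology_eq
proof (intro allI iffI)
  let ?P = "powertop_real UNIV" and ?X = "realization_points K"
  have sub: "std_simplex S \<subseteq> ?X" if "S \<in> K" for S
    using that mem_realization_points[OF K] by blast
  fix U
  {
    assume U: "openin (geometric_realization K) U"
    have "closedin ?P (std_simplex S - U)" if S: "S \<in> K" for S
    proof -
      have "openin (subtopology ?P (std_simplex S)) (U \<inter> std_simplex S)"
        using U S closed_simplex_eq[OF K S] unfolding openin_geometric_realization by metis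
      then have "closedin (subtopology ?P (std_simplex S)) (std_simplex S - U \<inter> std_simplex S)"
        using closedin_diff[OF closedin_topspace] by fastforce
      then show ?thesis
        using closedin_std_simplex[OF finite_complexD(1)[OF K S]]
        by (metis Diff_Int2 Diff_Int_distrib2 Int_absorb closedin_trans_full)
    qed
    then have "closedin ?P (\<Union>S\<in>K. std_simplex S - U)"
      using finite_complex_finite[OF K] by (intro closedin_Union) auto
    moreover have "?X - U = (\<Union>S\<in>K. std_simplex S - U)"
      using mem_realization_points[OF K] by blast
    ultimately have "closedin ?P (?X - U)" by simp
    moreover have "U = (topspace ?P - (?X - U)) \<inter> ?X"
      using U by (auto simp: openin_geometric_realization)
    ultimately show "openin (subtopology ?P ?X) U"
      unfolding openin_subtopology by blast
  next
    assume "openin (subtopology ?P ?X) U"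
    then obtain V where V: "openin ?P V" and U: "U = V \<inter> ?X" unfolding openin_subtopology by blast
    have "openin (subtopology ?P (closed_simplex K S)) (U \<inter> closed_simplex K S)" if "S \<in> K" for S
    proof -
      have "U \<inter> closed_simplex K S = V \<inter> closed_simplex K S"
        using sub[OF that] by (auto simp: U closed_simplex_eq[OF K that])
      then show ?thesis using V by (simp add: openin_subtopology_Int)
    qed
    then show "openin (geometric_realization K) U"
      by (auto simp: openin_geometric_realization U)
  }
qed

lemma continuous_map_into_realization:
  assumes "finite_complex K"
  shows "continuous_map X (geometric_realization K) f \<longleftrightarrow>
    continuous_map X (powertop_real UNIV) f \<and> f \<in> topspace X \<rightarrow> realization_points K"
  by (simp add: geometric_realization_eq[OF assms] continuous_map_in_subtopology)

lemma continuous_map_realization_id: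
  assumes "finite_complex K"
  shows "continuous_map (geometric_realization K) (powertop_real UNIV) id"
  by (simp add: geometric_realization_eq[OF assms] continuous_map_from_subtopology)

lemma continuous_map_realization_coordinate:
  assumes "finite_complex K"
  shows "continuous_map (geometric_realization K) euclideanreal (\<lambda>f. f v)"
  by (simp add: geometric_realization_eq[OF assms] continuous_map_from_subtopology continuous_map_coordinate)

lemma Hausdorff_geometric_realization:
  "finite_complex K \<Longrightarrow> Hausdorff_space (geometric_realization K)"
  by (simp add: geometric_realization_eq Hausdorff_space_subtopology Hausdorff_powertop_real)

lemma realization_points_mono: "K \<subseteq> L \<Longrightarrow> realization_points K \<subseteq> realization_points L"
  by (auto simp: realization_points_def)

lemma subtopology_geometric_realization:
  assumes "finite_complex K" "finite_complex L" "K \<subseteq> L"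
  shows "subtopology (geometric_realization L) (realization_points K) = geometric_realization K"
  using realization_points_mono[OF assms(3)]
  by (simp add: geometric_realization_eq assms subtopology_subtopology Int_absorb1)

subsection \<open>Collapses\<close>

lemma continuous_map_Min:
  assumes "finite A" "A \<noteq> {}" "\<And>a. a \<in> A \<Longrightarrow> continuous_map X euclideanreal (\<lambda>x. f x a)"
  shows "continuous_map X euclideanreal (\<lambda>x. Min (f x ` A))"
  using assms
proof (induction A rule: finite_ne_induct)
  case (insert a A)
  then have "(\<lambda>x. Min (f x ` insert a A)) = (\<lambda>x. min (f x a) (Min (f x ` A)))"
    by simp
  then show ?case
    using insert continuous_map_real_min[of X "\<lambda>x. f x a"] by simp
qed simp

text \<open>The retraction pushes the mass \<open>min\<close> of \<open>\<rho>\<close> over to \<open>v\<close>; the homotopy is linear.\<close>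

lemma realization_collapse:
  assumes K: "finite_complex K" and \<rho>: "\<rho> \<noteq> {}" and v: "v \<notin> \<rho>"
    and cone: "\<And>S. S \<in> K \<Longrightarrow> \<rho> \<subseteq> S \<Longrightarrow> insert v S \<in> K"
  shows "finite_complex {S \<in> K. \<not> \<rho> \<subseteq> S}"
    and "geometric_realization K homotopy_equivalent_space geometric_realization {S \<in> K. \<not> \<rho> \<subseteq> S}"
proof -
  let ?L = "{S \<in> K. \<not> \<rho> \<subseteq> S}"
  show L: "finite_complex ?L"
    using K by (auto simp: finite_complex_def)
  show "geometric_realization K homotopy_equivalent_space geometric_realization ?L"
  proof (cases "finite \<rho>")
    case False
    then have "?L = K" using K finite_subset by (auto simp: finite_complex_def)
    then show ?thesis
      by (simp add: homeomorphic_imp_homotopy_equivalent_space homeomorphic_space_refl)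
  next
    case fin: True
    define \<mu> where "\<mu> f = Min (f ` \<rho>)" for f :: "'a \<Rightarrow> real"
    define r where "r f u = f u - (if u \<in> \<rho> then \<mu> f else 0) + (if u = v then of_nat (card \<rho>) * \<mu> f else 0)"
      for f :: "'a \<Rightarrow> real" and u
    have \<mu>_le: "\<mu> f \<le> f u" if "u \<in> \<rho>" for f u
      using that fin by (simp add: \<mu>_def)
    obtain w where w: "\<And>f. w f \<in> \<rho>" "\<And>f. \<mu> f = f (w f)"
    proof -
      have "\<exists>u\<in>\<rho>. \<mu> f = f u" for f
        unfolding \<mu>_def using Min_in[of "f ` \<rho>"] fin \<rho> by blast
      then show thesis using that by metis
    qed
    have r_fix: "r f = f" if f: "f \<in> realization_points K" "\<not> \<rho> \<subseteq> support f" for f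
    proof -
      obtain u where "u \<in> \<rho>" "f u = 0" using f(2) by (auto simp: support_def)
      then have "\<mu> f = 0"
        using \<mu>_le[of u f] w[of f] realization_points_support(3)[OF f(1)] by (metis antisym)
      then show ?thesis by (auto simp: r_def)
    qed
    have r_std: "r f \<in> std_simplex (insert v (support f))"
      if f: "f \<in> realization_points K" "\<rho> \<subseteq> support f" for f
    proof -
      note s = realization_points_support[OF f(1)]
      have finS: "finite (support f)" using finite_complexD(1)[OF K s(1)] .
      have \<mu>0: "0 \<le> \<mu> f" using w[of f] s(3) by simp
      have "0 \<le> r f u" for u
        using \<mu>_le[of u f] \<mu>0 s(3)[of u] v by (auto simp: r_def)
      moreover have "r f u = 0" if "u \<notin> insert v (support f)" for u
        using that f(2) by (auto simp: r_def support_def)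
      moreover have "(\<Sum>u\<in>insert v (support f). r f u) = 1"
      proof -
        let ?V = "insert v (support f)"
        have "(\<Sum>u\<in>?V. r f u) = (\<Sum>u\<in>?V. f u) - (\<Sum>u\<in>?V. if u \<in> \<rho> then \<mu> f else 0)
            + (\<Sum>u\<in>?V. if u = v then of_nat (card \<rho>) * \<mu> f else 0)"
          unfolding r_def by (simp only: sum.distrib sum_subtractf)
        also have "(\<Sum>u\<in>?V. if u \<in> \<rho> then \<mu> f else 0) = of_nat (card \<rho>) * \<mu> f"
        proof -
          have "?V \<inter> \<rho> = \<rho>" using f(2) by auto
          then show ?thesis using finS by (simp add: sum.inter_restrict[symmetric])
        qed
        also have "(\<Sum>u\<in>?V. if u = v then of_nat (card \<rho>) * \<mu> f else 0) = of_nat (card \<rho>) * \<mu> f"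
          using finS by (simp add: sum.delta)
        also have "(\<Sum>u\<in>?V. f u) = 1"
        proof -
          have "f \<in> std_simplex ?V" using s(2) std_simplex_mono[of ?V "support f"] finS by blast
          then show ?thesis by (simp add: std_simplex_def)
        qed
        finally show ?thesis by simp
      qed
      ultimately show ?thesis by (simp add: std_simplex_def)
    qed
    have r_in: "r f \<in> realization_points ?L" if f: "f \<in> realization_points K" for f
    proof (cases "\<rho> \<subseteq> support f")
      case True
      note s = realization_points_support[OF f]
      have vS: "insert v (support f) \<in> K" using cone[OF s(1) True] .
      note t = support_std_simplex[OF finite_complexD(1)[OF K vS] r_std[OF f True]]
      have "support (r f) \<in> K" using finite_complexD(3)[OF K vS t(1,2)] .
      \<comment> \<open>The vertex \<open>w f\<close> at which the minimum is attained loses all its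
        mass, so the new support no longer contains \<open>\<rho>\<close>.\<close>
      moreover have "w f \<notin> support (r f)"
        using w[of f] v by (auto simp: r_def support_def)
      ultimately show ?thesis
        using t(3) w(1)[of f] by (auto simp: realization_points_def std_simplex_def)
    next
      case False
      then show ?thesis
        using f r_fix[OF f] by (auto simp: realization_points_def)
    qed
    have "continuous_map (geometric_realization K) euclideanreal (\<lambda>f. r f u)" for u
    proof -
      have "continuous_map (geometric_realization K) euclideanreal \<mu>"
        unfolding \<mu>_def
        by (rule continuous_map_Min[OF fin \<rho>]) (rule continuous_map_realization_coordinate[OF K])
      then show ?thesis
        unfolding r_def
        by (cases "u \<in> \<rho>"; cases "u = v")
           (simp_all add: continuous_map_diff continuous_map_add continuous_map_real_mult
             continuous_map_realization_coordinate[OF K])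
    qed
    then have rc: "continuous_map (geometric_realization K) (powertop_real UNIV) r"
      by (simp add: continuous_map_componentwise_UNIV)
    have r: "continuous_map (geometric_realization K) (geometric_realization ?L) r"
      using rc r_in by (auto simp: continuous_map_into_realization[OF L] topspace_geometric_realization)
    have LK: "realization_points ?L \<subseteq> realization_points K"
      by (rule realization_points_mono) auto
    have i: "continuous_map (geometric_realization ?L) (geometric_realization K) id"
      using continuous_map_realization_id[OF L] LK
      by (auto simp: continuous_map_into_realization[OF K] topspace_geometric_realization)
    have "homotopic_with (\<lambda>_. True) (geometric_realization ?L) (geometric_realization ?L) (r \<circ> id) id"
    proof (rule homotopic_with_equal)
      show "continuous_map (geometric_realization ?L) (geometric_realization ?L) (r \<circ> id)"
        by (rule continuous_map_compose[OF i r])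
      fix f assume "f \<in> topspace (geometric_realization ?L)"
      then have "f \<in> realization_points ?L" by (simp add: topspace_geometric_realization)
      then show "(r \<circ> id) f = id f"
        using r_fix[of f] LK realization_points_support(1)[of f ?L] by auto
    qed auto
    moreover have "homotopic_with (\<lambda>_. True) (geometric_realization K) (geometric_realization K) (id \<circ> r) id"
    proof -
      have "homotopic_with (\<lambda>_. True) (geometric_realization K)
          (subtopology (powertop_real UNIV) (realization_points K)) r id"
      proof (rule homotopic_with_straight_line[OF rc continuous_map_realization_id[OF K]])
        fix f and t :: real assume "f \<in> topspace (geometric_realization K)" and t: "0 \<le> t" "t \<le> 1"
        then have f: "f \<in> realization_points K" by (simp add: topspace_geometric_realization)
        note s = realization_points_support[OF f]
        \<comment> \<open>Both points lie in one simplex, the support of \<open>f\<close>, enlarged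
          by \<open>v\<close> when it contains \<open>\<rho>\<close>. The segment between them
          therefore stays in the realization.\<close>
        have "\<exists>S\<in>K. f \<in> std_simplex S \<and> r f \<in> std_simplex S"
        proof (cases "\<rho> \<subseteq> support f")
          case True
          have vS: "insert v (support f) \<in> K" using cone[OF s(1) True] .
          then show ?thesis
            using r_std[OF f True] s(2) std_simplex_mono[OF finite_complexD(1)[OF K vS], of "support f"] by blast
        next
          case False
          then show ?thesis using r_fix[OF f] s by auto
        qed
        then show "(\<lambda>i. (1 - t) * r f i + t * id f i) \<in> realization_points K"
          using std_simplex_convex[OF _ _ t] by (auto simp: mem_realization_points[OF K])
      qed
      then show ?thesis by (simp add: geometric_realization_eq[OF K])
    qed
    ultimately show ?thesis
      using r i unfolding homotopy_equivalent_space_def by blast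
  qed
qed

text \<open>The condition \<open>v \<rho> \<notin> \<Union>R\<close> ensures that inserting a cone
  vertex never completes another face of \<open>R\<close>, so the collapses can be carried out one
  after the other.\<close>

lemma realization_collapse_family:
  assumes K: "finite_complex K" and R: "finite R"
    and \<rho>: "\<And>\<rho>. \<rho> \<in> R \<Longrightarrow> \<rho> \<noteq> {}" and v: "\<And>\<rho>. \<rho> \<in> R \<Longrightarrow> v \<rho> \<notin> \<Union>R"
    and cone: "\<And>\<rho> S. \<rho> \<in> R \<Longrightarrow> S \<in> K \<Longrightarrow> \<rho> \<subseteq> S \<Longrightarrow> insert (v \<rho>) S \<in> K"
  shows "finite_complex {S \<in> K. \<forall>\<rho>\<in>R. \<not> \<rho> \<subseteq> S} \<and>
    geometric_realization K homotopy_equivalent_space geometric_realization {S \<in> K. \<forall>\<rho>\<in>R. \<not> \<rho> \<subseteq> S}"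
  using R subset_refl[of R]
proof (induction R rule: finite_subset_induct')
  case empty
  then show ?case
    using K by (simp add: homeomorphic_imp_homotopy_equivalent_space homeomorphic_space_refl)
next
  case (insert \<rho> R')
  let ?K' = "{S \<in> K. \<forall>\<rho>\<in>R'. \<not> \<rho> \<subseteq> S}"
  have eq: "{S \<in> K. \<forall>\<rho>\<in>insert \<rho> R'. \<not> \<rho> \<subseteq> S} = {S \<in> ?K'. \<not> \<rho> \<subseteq> S}" by auto
  have v': "v \<rho> \<notin> \<rho>" using v insert by auto
  have c: "insert (v \<rho>) S \<in> ?K'" if "S \<in> ?K'" "\<rho> \<subseteq> S" for S
  proof -
    have "insert (v \<rho>) S \<in> K" using cone[of \<rho> S] that insert by auto
    moreover have "\<not> \<rho>' \<subseteq> insert (v \<rho>) S" if "\<rho>' \<in> R'" for \<rho>'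
    proof -
      have "v \<rho> \<notin> \<rho>'" using v[of \<rho>] insert that by auto
      then show ?thesis using \<open>S \<in> ?K'\<close> that by auto
    qed
    ultimately show ?thesis by simp
  qed
  have K': "finite_complex ?K'" using insert by blast
  note col = realization_collapse[OF K' \<rho>[OF insert(2)] v' c]
  show ?case
    unfolding eq using col insert.IH by (meson homotopy_eqv_trans homotopy_equivalent_space_sym)
qed

lemma contractible_realization_vertex: "contractible_space (geometric_realization {{v}})"
proof (rule contractible_space_subset_singleton)
  show "topspace (geometric_realization {{v}}) \<subseteq> {\<lambda>u. if u = v then 1 else 0}"
  proof
    fix f assume "f \<in> topspace (geometric_realization {{v}})"
    then have f: "f \<in> realization_points {{v}}" by (simp add: topspace_geometric_realization)
    have "f \<in> std_simplex {v}" using realization_points_support[OF f] by auto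
    then show "f \<in> {\<lambda>u. if u = v then 1 else 0}" by (auto simp: std_simplex_def)
  qed
qed

text \<open>Collapsing along the faces \<open>{u}\<close> for all vertices \<open>u\<close> other
  than \<open>v\<close>, always with \<open>v\<close> as the cone vertex, leaves the single vertex
  \<open>v\<close>.\<close>

lemma contractible_realization_cone:
  assumes K: "finite_complex K" and v: "\<And>S. S \<in> K \<Longrightarrow> insert v S \<in> K" and ne: "K \<noteq> {}"
  shows "contractible_space (geometric_realization K)"
proof -
  have finK: "finite (\<Union>K)" using K by (auto simp: finite_complex_def)
  let ?R = "(\<lambda>u. {u}) ` (\<Union>K - {v})"
  have "geometric_realization K homotopy_equivalent_space geometric_realization {S \<in> K. \<forall>\<rho>\<in>?R. \<not> \<rho> \<subseteq> S}"
    using realization_collapse_family[OF K, of ?R "\<lambda>_. v"] finK v by auto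
  moreover have "{S \<in> K. \<forall>\<rho>\<in>?R. \<not> \<rho> \<subseteq> S} = {{v}}"
  proof
    show "{S \<in> K. \<forall>\<rho>\<in>?R. \<not> \<rho> \<subseteq> S} \<subseteq> {{v}}"
      using finite_complexD(2)[OF K] by auto
    obtain S where "S \<in> K" using ne by blast
    then have "{v} \<in> K" using finite_complexD(3)[OF K v] by blast
    then show "{{v}} \<subseteq> {S \<in> K. \<forall>\<rho>\<in>?R. \<not> \<rho> \<subseteq> S}" by auto
  qed
  ultimately show ?thesis
    using contractible_realization_vertex homotopy_equivalent_space_contractibility by metis
qed

text \<open>Since \<open>g\<close> is its own inverse, precomposition with \<open>g\<close>
  transports barycentric coordinates in both directions.\<close>

lemma homeomorphic_realization_involution:
  assumes K: "finite_complex K" and g: "\<And>x. g (g x) = x"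
  shows "finite_complex ((`) g ` K)"
    and "geometric_realization K homeomorphic_space geometric_realization ((`) g ` K)"
proof -
  have gg: "g ` g ` S = S" for S using g by (auto simp: image_image)
  have inj: "inj g" using g by (metis injI)
  show L: "finite_complex ((`) g ` K)"
    unfolding finite_complex_def
  proof (intro conjI ballI allI impI)
    show "finite ((`) g ` K)" using K by (simp add: finite_complex_def)
    fix S assume "S \<in> (`) g ` K"
    then obtain S' where S': "S' \<in> K" "S = g ` S'" by blast
    then show "finite S" "S \<noteq> {}" using finite_complexD[OF K S'(1)] by auto
    fix T assume T: "T \<subseteq> S" "T \<noteq> {}"
    then have "g ` T \<subseteq> S'" using S' gg by blast
    then have "g ` T \<in> K" using finite_complexD(3)[OF K S'(1)] T by blast
    then show "T \<in> (`) g ` K" using gg by blast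
  qed
  have std: "f \<circ> g \<in> std_simplex (g ` S)" if "f \<in> std_simplex S" for f :: "'a \<Rightarrow> real" and S
  proof -
    have "(\<Sum>v\<in>g ` S. f (g v)) = (\<Sum>v\<in>S. f v)"
      by (subst sum.reindex) (use inj g in \<open>auto intro: inj_on_subset\<close>)
    moreover have "f (g u) = 0" if "u \<notin> g ` S" for u
      using that g \<open>f \<in> std_simplex S\<close> by (metis (mono_tags, lifting) image_eqI mem_Collect_eq std_simplex_def)
    ultimately show ?thesis using that by (simp add: std_simplex_def)
  qed
  have c: "continuous_map (geometric_realization K) (geometric_realization L) (\<lambda>f. f \<circ> g)"
    if "finite_complex K" "finite_complex L" "\<And>S. S \<in> K \<Longrightarrow> g ` S \<in> L" for K L
    unfolding continuous_map_into_realization[OF that(2)] topspace_geometric_realization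
  proof
    show "continuous_map (geometric_realization K) (powertop_real UNIV) (\<lambda>f. f \<circ> g)"
      by (simp add: continuous_map_componentwise_UNIV continuous_map_realization_coordinate[OF that(1)])
    show "(\<lambda>f. f \<circ> g) \<in> realization_points K \<rightarrow> realization_points L"
      using std that(3) by (fastforce simp: mem_realization_points[OF that(1)] mem_realization_points[OF that(2)])
  qed
  have "continuous_map (geometric_realization K) (geometric_realization ((`) g ` K)) (\<lambda>f. f \<circ> g)"
    by (rule c[OF K L]) simp
  moreover have "continuous_map (geometric_realization ((`) g ` K)) (geometric_realization K) (\<lambda>f. f \<circ> g)"
    by (rule c[OF L K]) (use gg in auto)
  moreover have "(f \<circ> g) \<circ> g = f" for f :: "'a \<Rightarrow> real"
    by (rule ext) (simp add: g)
  ultimately have "homeomorphic_maps (geometric_realization K) (geometric_realization ((`) g ` K))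
      (\<lambda>f. f \<circ> g) (\<lambda>f. f \<circ> g)"
    unfolding homeomorphic_maps_def by blast
  then show "geometric_realization K homeomorphic_space geometric_realization ((`) g ` K)"
    unfolding homeomorphic_space_def by blast
qed

lemma finite_complex_insert:
  assumes K: "finite_complex K" and "finite \<sigma>" "\<sigma> \<noteq> {}"
    and faces: "\<And>T. T \<subset> \<sigma> \<Longrightarrow> T \<noteq> {} \<Longrightarrow> T \<in> K"
  shows "finite_complex (insert \<sigma> K)"
  unfolding finite_complex_def
proof (intro conjI ballI allI impI)
  show "finite (insert \<sigma> K)" using finite_complex_finite[OF K] by simp
  fix S assume S: "S \<in> insert \<sigma> K"
  show "finite S" "S \<noteq> {}" using S assms finite_complexD(1,2)[OF K] by blast+
  fix T assume T: "T \<subseteq> S" "T \<noteq> {}"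
  show "T \<in> insert \<sigma> K"
  proof (cases "S = \<sigma>")
    case True
    then show ?thesis using T faces by blast
  next
    case False
    then show ?thesis using S T finite_complexD(3)[OF K] by blast
  qed
qed

text \<open>An enumeration of \<open>\<sigma>\<close> identifies \<open>cell3\<close> with the new
  closed simplex, whose boundary points are those without full support. The last property lets the
  attaching map be factored through any subcomplex that contains the proper faces.\<close>

lemma attaching_realization:
  assumes K: "finite_complex K" and \<sigma>: "\<sigma> \<notin> K" "card \<sigma> = 4"
    and faces: "\<And>T. T \<subset> \<sigma> \<Longrightarrow> T \<noteq> {} \<Longrightarrow> T \<in> K"
  obtains \<phi> where
    "attaching (geometric_realization (insert \<sigma> K)) (realization_points K) cell3 cell3_boundary \<phi>"
    "continuous_map cell3 (powertop_real UNIV) \<phi>"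
    "\<And>f. f \<in> cell3_boundary \<Longrightarrow> support (\<phi> f) \<subset> \<sigma> \<and> support (\<phi> f) \<noteq> {} \<and> \<phi> f \<in> std_simplex (support (\<phi> f))"
proof -
  have fin: "finite \<sigma>" and ne: "\<sigma> \<noteq> {}" using \<sigma>(2) by (auto intro: card_ge_0_finite)
  have K': "finite_complex (insert \<sigma> K)" by (rule finite_complex_insert[OF K fin ne faces])
  obtain idx where idx: "bij_betw idx \<sigma> {..<4::nat}"
    using \<sigma>(2) ex_bij_betw_finite_nat[OF fin] by (auto simp: atLeast0LessThan)
  define \<phi> where "\<phi> f u = (if u \<in> \<sigma> then f (idx u) else 0)" for f :: "nat \<Rightarrow> real" and u
  have im: "idx ` \<sigma> = {..<4}" and inj: "inj_on idx \<sigma>" using idx by (auto simp: bij_betw_def)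
  have sum: "(\<Sum>u\<in>\<sigma>. \<phi> f u) = (\<Sum>i<4. f i)" for f
    using sum.reindex_bij_betw[OF idx, of f] by (simp add: \<phi>_def)
  have std: "\<phi> f \<in> std_simplex \<sigma>" if "f \<in> topspace cell3" for f
    using that sum[of f] by (auto simp: std_simplex_def topspace_cell3 \<phi>_def)
  have c: "continuous_map cell3 (powertop_real UNIV) \<phi>"
    unfolding continuous_map_componentwise_UNIV
  proof
    fix u
    show "continuous_map cell3 euclideanreal (\<lambda>f. \<phi> f u)"
      by (cases "u \<in> \<sigma>") (simp_all add: \<phi>_def continuous_map_cell3_coordinate)
  qed
  have depth0: "depth f = 0 \<longleftrightarrow> (\<exists>i<4. f i = 0)" if "f \<in> topspace cell3" for f
  proof
    assume "depth f = 0"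
    then show "\<exists>i<4. f i = 0" using depth_attained[of f] by auto
  next
    assume "\<exists>i<4. f i = 0"
    then obtain i where "i < 4" "f i = 0" by blast
    then show "depth f = 0" using depth_le[of i f] depth_nonneg[OF that] by simp
  qed
  have full: "support (\<phi> f) = \<sigma> \<longleftrightarrow> f \<notin> cell3_boundary" if f: "f \<in> topspace cell3" for f
  proof -
    have "support (\<phi> f) = \<sigma> \<longleftrightarrow> (\<forall>u\<in>\<sigma>. f (idx u) \<noteq> 0)" by (auto simp: support_def \<phi>_def)
    also have "\<dots> \<longleftrightarrow> (\<forall>i<4. f i \<noteq> 0)" using im by (metis (no_types, lifting) imageE imageI lessThan_iff)
    finally show ?thesis using depth0[OF f] f by (auto simp: cell3_boundary_def)
  qed
  have bd: "support (\<phi> f) \<subset> \<sigma> \<and> support (\<phi> f) \<noteq> {} \<and> \<phi> f \<in> std_simplex (support (\<phi> f))"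
    if f: "f \<in> cell3_boundary" for f
  proof -
    have f': "f \<in> topspace cell3" using f by (simp add: cell3_boundary_def)
    show ?thesis
      using support_std_simplex[OF fin std[OF f']] full[OF f'] f by blast
  qed
  have "attaching (geometric_realization (insert \<sigma> K)) (realization_points K) cell3 cell3_boundary \<phi>"
    unfolding attaching_def
  proof (intro conjI)
    have sub: "realization_points K \<subseteq> realization_points (insert \<sigma> K)"
      by (rule realization_points_mono) auto
    show "closedin (geometric_realization (insert \<sigma> K)) (realization_points K)"
      unfolding geometric_realization_eq[OF K']
      by (rule closedin_subset_topspace[OF closedin_realization_points[OF K] sub])
    show "closedin cell3 cell3_boundary" using cofibration_cell3 by (simp add: cofibration_def)
    show c': "continuous_map cell3 (geometric_realization (insert \<sigma> K)) \<phi>"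
      unfolding continuous_map_into_realization[OF K']
    proof
      show "\<phi> \<in> topspace cell3 \<rightarrow> realization_points (insert \<sigma> K)"
        using std mem_realization_points[OF K'] by blast
    qed (rule c)
    show "proper_map cell3 (geometric_realization (insert \<sigma> K)) \<phi>"
      by (rule continuous_imp_proper_map[OF compact_space_cell3
            Hausdorff_imp_kc_space[OF Hausdorff_geometric_realization[OF K']] c'])
    show "inj_on \<phi> (topspace cell3 - cell3_boundary)"
    proof (rule inj_onI)
      fix f g assume f: "f \<in> topspace cell3 - cell3_boundary" and g: "g \<in> topspace cell3 - cell3_boundary"
        and eq: "\<phi> f = \<phi> g"
      have "f i = g i" for i
      proof (cases "i < 4")
        case True
        then obtain u where "u \<in> \<sigma>" "idx u = i" using im by (metis imageE lessThan_iff)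
        then show ?thesis using fun_cong[OF eq, of u] by (simp add: \<phi>_def)
      next
        case False
        then show ?thesis using f g by (auto simp: mem_cell3)
      qed
      then show "f = g" by blast
    qed
    show "\<phi> ` cell3_boundary \<subseteq> realization_points K"
    proof (rule image_subsetI)
      fix f assume "f \<in> cell3_boundary"
      then show "\<phi> f \<in> realization_points K"
        using bd[of f] faces mem_realization_points[OF K] by blast
    qed
    show "\<phi> ` (topspace cell3 - cell3_boundary) = topspace (geometric_realization (insert \<sigma> K)) - realization_points K"
      unfolding topspace_geometric_realization
    proof
      show "\<phi> ` (topspace cell3 - cell3_boundary) \<subseteq> realization_points (insert \<sigma> K) - realization_points K"
      proof (rule image_subsetI)
        fix f assume f: "f \<in> topspace cell3 - cell3_boundary"
        then have "support (\<phi> f) = \<sigma>" using full by blast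
        then have "\<phi> f \<notin> realization_points K" using realization_points_support(1) \<sigma>(1) by metis
        then show "\<phi> f \<in> realization_points (insert \<sigma> K) - realization_points K"
          using f std[of f] mem_realization_points[OF K'] by blast
      qed
      show "realization_points (insert \<sigma> K) - realization_points K \<subseteq> \<phi> ` (topspace cell3 - cell3_boundary)"
      proof
        fix h assume h: "h \<in> realization_points (insert \<sigma> K) - realization_points K"
        then have h': "h \<in> realization_points (insert \<sigma> K)" by blast
        note s = realization_points_support[OF h']
        have "support h = \<sigma>"
          using h s(1) s(2) mem_realization_points[OF K] by blast
        then have hs: "h \<in> std_simplex \<sigma>" and h0: "\<And>u. u \<notin> \<sigma> \<Longrightarrow> h u = 0" using s by (auto simp: support_def)
        define f where "f i = (if i < 4 then h (inv_into \<sigma> idx i) else 0)" for i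
        have fi: "f (idx u) = h u" if "u \<in> \<sigma>" for u
        proof -
          have "idx u < 4" using im that by blast
          then show ?thesis using that inj by (simp add: f_def)
        qed
        have \<phi>f: "\<phi> f = h"
        proof
          fix u show "\<phi> f u = h u" using fi h0 by (cases "u \<in> \<sigma>") (auto simp: \<phi>_def)
        qed
        have "(\<Sum>i<4. f i) = 1" using sum[of f] hs unfolding \<phi>f by (simp add: std_simplex_def)
        moreover have "0 \<le> f i" for i using s(3) by (simp add: f_def)
        ultimately have "f \<in> topspace cell3"
          unfolding topspace_cell3 std_simplex_def by (simp add: f_def)
        moreover from this have "f \<notin> cell3_boundary" using full[of f] \<phi>f \<open>support h = \<sigma>\<close> by simp
        ultimately show "h \<in> \<phi> ` (topspace cell3 - cell3_boundary)" using \<phi>f by blast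
      qed
    qed
  qed
  then show thesis using that c bd by blast
qed

text \<open>The contractible subcomplex \<open>Q\<close> contains the whole boundary of
  \<open>\<sigma>\<close>, so the attaching map of \<open>\<sigma>\<close> is null-homotopic in
  \<open>K\<close>.\<close>

definition fillable :: "'a set set \<Rightarrow> 'a set \<Rightarrow> bool" where
  "fillable K \<sigma> \<longleftrightarrow> (\<exists>Q\<subseteq>K. finite_complex Q \<and> contractible_space (geometric_realization Q) \<and>
     (\<forall>T. T \<subset> \<sigma> \<longrightarrow> T \<noteq> {} \<longrightarrow> T \<in> Q))"

lemma fillable_mono: "fillable K \<sigma> \<Longrightarrow> K \<subseteq> L \<Longrightarrow> fillable L \<sigma>"
  unfolding fillable_def by (meson subset_trans)

text \<open>Factoring through \<open>Q\<close> makes the attaching map null-homotopic after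
  transport to \<open>Z j\<close>, and a path there moves the constant to the point at which the
  tower attaches its next cell. The two attaching maps are then homotopic.\<close>

lemma fillable_attach:
  assumes K: "finite_complex K" and \<sigma>: "\<sigma> \<notin> K" "card \<sigma> = 4" and fill: "fillable K \<sigma>"
    and Z: "cell_tower Z N" "j < N" and eqv: "geometric_realization K homotopy_equivalent_space Z j"
  shows "finite_complex (insert \<sigma> K)"
    and "geometric_realization (insert \<sigma> K) homotopy_equivalent_space Z (Suc j)"
proof -
  obtain Q where QK: "Q \<subseteq> K" and Q: "finite_complex Q" and con: "contractible_space (geometric_realization Q)"
    and faces: "\<And>T. T \<subset> \<sigma> \<Longrightarrow> T \<noteq> {} \<Longrightarrow> T \<in> Q"
    using fill unfolding fillable_def by meson
  have facesK: "T \<in> K" if "T \<subset> \<sigma>" "T \<noteq> {}" for T using faces[OF that] QK by blast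
  have fin: "finite \<sigma>" and ne: "\<sigma> \<noteq> {}" using \<sigma>(2) by (auto intro: card_ge_0_finite)
  show K': "finite_complex (insert \<sigma> K)"
    by (rule finite_complex_insert[OF K fin ne facesK])
  obtain \<phi> where att: "attaching (geometric_realization (insert \<sigma> K)) (realization_points K) cell3 cell3_boundary \<phi>"
    and c: "continuous_map cell3 (powertop_real UNIV) \<phi>"
    and bd: "\<And>f. f \<in> cell3_boundary \<Longrightarrow> support (\<phi> f) \<subset> \<sigma> \<and> support (\<phi> f) \<noteq> {} \<and> \<phi> f \<in> std_simplex (support (\<phi> f))"
    by (rule attaching_realization[OF K \<sigma> facesK], assumption, assumption, rule that)
  obtain \<psi> z where sub: "subtopology (Z (Suc j)) (topspace (Z j)) = Z j"
    and att': "attaching (Z (Suc j)) (topspace (Z j)) cell3 cell3_boundary \<psi>" and z: "z \<in> topspace (Z j)"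
    and \<psi>: "\<And>s. s \<in> cell3_boundary \<Longrightarrow> \<psi> s = z"
    using Z unfolding cell_tower_def by meson
  let ?B = "subtopology cell3 cell3_boundary"
  have tB: "topspace ?B = cell3_boundary" by (auto simp: cell3_boundary_def)
  have subK: "subtopology (geometric_realization (insert \<sigma> K)) (realization_points K) = geometric_realization K"
    by (rule subtopology_geometric_realization[OF K K']) auto
  obtain f g where f: "continuous_map (geometric_realization K) (Z j) f"
    and g: "continuous_map (Z j) (geometric_realization K) g"
    and gf: "homotopic_with (\<lambda>_. True) (geometric_realization K) (geometric_realization K) (g \<circ> f) id"
    and fg: "homotopic_with (\<lambda>_. True) (Z j) (Z j) (f \<circ> g) id"
    using eqv unfolding homotopy_equivalent_space_def by meson
  have "continuous_map ?B (geometric_realization Q) \<phi>"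
    unfolding continuous_map_into_realization[OF Q]
  proof
    show "continuous_map ?B (powertop_real UNIV) \<phi>" by (rule continuous_map_from_subtopology[OF c])
    show "\<phi> \<in> topspace ?B \<rightarrow> realization_points Q"
    proof
      fix s assume "s \<in> topspace ?B"
      then have "s \<in> cell3_boundary" by (simp add: tB)
      then show "\<phi> s \<in> realization_points Q"
        using bd[of s] faces mem_realization_points[OF Q] by blast
    qed
  qed
  moreover have "continuous_map (geometric_realization Q) (geometric_realization K) id"
    unfolding continuous_map_into_realization[OF K] topspace_geometric_realization
    using continuous_map_realization_id[OF Q] realization_points_mono[OF QK] by auto
  then have "continuous_map (geometric_realization Q) (Z j) (f \<circ> id)"
    using f continuous_map_compose by blast
  ultimately obtain a where a: "homotopic_with (\<lambda>_. True) ?B (Z j) ((f \<circ> id) \<circ> \<phi>) (\<lambda>_. a)"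
    using nullhomotopic_through_contractible_space con by metis
  have "a \<in> topspace (Z j)"
    using homotopic_with_imp_continuous_maps[OF a] tB cell3_boundary_nonempty
      continuous_map_image_subset_topspace[of ?B "Z j" "\<lambda>_. a"] by auto
  moreover have "path_connected_space (Z j)"
    by (rule cell_tower_path_connected[OF Z(1)]) (use Z in simp)
  ultimately have "path_component_of (Z j) a z"
    using z by (simp add: path_connected_space_iff_path_component)
  then have "homotopic_with (\<lambda>_. True) ?B (Z j) (\<lambda>_. a) (\<lambda>_. z)"
    by (simp add: homotopic_constant_maps)
  then have "homotopic_with (\<lambda>_. True) ?B (Z j) ((f \<circ> id) \<circ> \<phi>) (\<lambda>_. z)"
    using a homotopic_with_trans by blast
  then have "homotopic_with (\<lambda>_. True) ?B (Z j) (f \<circ> \<phi>) \<psi>"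
    by (rule homotopic_with_eq) (use \<psi> tB in auto)
  then show "geometric_realization (insert \<sigma> K) homotopy_equivalent_space Z (Suc j)"
    using attaching_homotopy_equivalent[OF cofibration_cell3 att att', unfolded subK sub, OF f g gf fg] by blast
qed

text \<open>Fillability passes to larger complexes, so every simplex of the family can be tested
  against the initial \<open>K\<close>.\<close>

lemma fillable_attach_family:
  assumes "finite \<Sigma>" and K: "finite_complex K" and Z: "cell_tower Z N" "j + card \<Sigma> \<le> N"
    and \<sigma>: "\<And>\<sigma>. \<sigma> \<in> \<Sigma> \<Longrightarrow> \<sigma> \<notin> K \<and> card \<sigma> = 4 \<and> fillable K \<sigma>"
    and eqv: "geometric_realization K homotopy_equivalent_space Z j"
  shows "finite_complex (K \<union> \<Sigma>) \<and> geometric_realization (K \<union> \<Sigma>) homotopy_equivalent_space Z (j + card \<Sigma>)"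
  using assms(1) Z(2) \<sigma>
proof (induction \<Sigma> rule: finite_induct)
  case empty
  then show ?case using K eqv by simp
next
  case (insert \<sigma> \<Sigma>)
  have IH: "finite_complex (K \<union> \<Sigma>)" "geometric_realization (K \<union> \<Sigma>) homotopy_equivalent_space Z (j + card \<Sigma>)"
    using insert by auto
  have "fillable (K \<union> \<Sigma>) \<sigma>" using insert.prems(2)[of \<sigma>] fillable_mono[of K \<sigma> "K \<union> \<Sigma>"] by blast
  moreover have "\<sigma> \<notin> K \<union> \<Sigma>" "card \<sigma> = 4" using insert by auto
  moreover have "j + card \<Sigma> < N" using insert by simp
  ultimately have "finite_complex (insert \<sigma> (K \<union> \<Sigma>)) \<and>
      geometric_realization (insert \<sigma> (K \<union> \<Sigma>)) homotopy_equivalent_space Z (Suc (j + card \<Sigma>))"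
    using fillable_attach[OF IH(1) _ _ _ Z(1) _ IH(2)] by blast
  then show ?case using insert by simp
qed

text \<open>Seven faces of the octahedron with antipodal pairs \<open>{a, a'}\<close>, \<open>{b, b'}\<close>, \<open>{c, c'}\<close> coned off from \<open>p\<close>
  form a ball; coning off all eight faces from \<open>t\<close> gives a second ball, which meets the first one in the disc
  made of these seven faces, so the union is contractible.\<close>

lemma octahedron_fillable:
  assumes K: "finite_complex K"
    and dist: "distinct [p, t, a, b, c, a', b', c']"
    and t: "\<And>x y z. x \<in> {a, a'} \<Longrightarrow> y \<in> {b, b'} \<Longrightarrow> z \<in> {c, c'} \<Longrightarrow> {t, x, y, z} \<in> K"
    and p: "\<And>x y z. x \<in> {a, a'} \<Longrightarrow> y \<in> {b, b'} \<Longrightarrow> z \<in> {c, c'} \<Longrightarrow> (x, y, z) \<noteq> (a, b, c) \<Longrightarrow> {p, x, y, z} \<in> K"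
  shows "fillable K {p, a, b, c}"
proof -
  let ?V = "{p, t, a, b, c, a', b', c'}"
  \<comment> \<open>With \<open>p\<close> and \<open>t\<close> as a further antipodal pair, these
    are the simplices of the suspension of the octahedron with the single facet
    \<open>{p, a, b, c}\<close> left out: a triangulated 3-sphere without one open cell.\<close>
  define Q where "Q = {S. S \<subseteq> ?V \<and> S \<noteq> {} \<and> \<not> {p, t} \<subseteq> S \<and> \<not> {a, a'} \<subseteq> S \<and> \<not> {b, b'} \<subseteq> S \<and>
      \<not> {c, c'} \<subseteq> S \<and> \<not> {p, a, b, c} \<subseteq> S}"
  have memQ: "S \<in> Q \<longleftrightarrow> S \<subseteq> ?V \<and> S \<noteq> {} \<and> \<not> (p \<in> S \<and> t \<in> S) \<and> \<not> (a \<in> S \<and> a' \<in> S) \<and>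
      \<not> (b \<in> S \<and> b' \<in> S) \<and> \<not> (c \<in> S \<and> c' \<in> S) \<and> \<not> (p \<in> S \<and> a \<in> S \<and> b \<in> S \<and> c \<in> S)" for S
    by (simp add: Q_def)
  have ne: "p \<noteq> t" "a \<noteq> p" "b \<noteq> p" "c \<noteq> p" "a' \<noteq> p" "b' \<noteq> p" "c' \<noteq> p" "a' \<noteq> t" "b' \<noteq> t" "c' \<noteq> t"
      "t \<noteq> p" "p \<noteq> a'" "p \<noteq> b'" "p \<noteq> c'" "t \<noteq> a'" "t \<noteq> b'" "t \<noteq> c'"
      "a' \<noteq> a" "a' \<noteq> b" "a' \<noteq> c" "b' \<noteq> a" "b' \<noteq> b" "b' \<noteq> c" "c' \<noteq> a" "c' \<noteq> b" "c' \<noteq> c"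
      "a \<noteq> a'" "b \<noteq> a'" "c \<noteq> a'" "a \<noteq> b'" "b \<noteq> b'" "c \<noteq> b'" "a \<noteq> c'" "b \<noteq> c'" "c \<noteq> c'"
      "a' \<noteq> b'" "a' \<noteq> c'" "b' \<noteq> c'" "b' \<noteq> a'" "c' \<noteq> a'" "c' \<noteq> b'" "a \<noteq> t" "b \<noteq> t" "c \<noteq> t"
      "t \<noteq> a" "t \<noteq> b" "t \<noteq> c"
    using dist by auto
  have Q: "finite_complex Q"
    unfolding finite_complex_def
  proof (intro conjI ballI allI impI)
    have "Q \<subseteq> Pow ?V" unfolding Q_def by blast
    then show "finite Q" by (rule finite_subset) simp
    fix S assume S: "S \<in> Q"
    have "S \<subseteq> ?V" using S by (simp add: Q_def)
    then show "finite S" by (rule finite_subset) simp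
    show "S \<noteq> {}" using S by (simp add: Q_def)
    fix T assume "T \<subseteq> S" "T \<noteq> {}"
    then show "T \<in> Q" using S unfolding Q_def by blast
  qed
  have QK: "Q \<subseteq> K"
  proof
    fix S assume S: "S \<in> Q"
    define x where "x = (if a \<in> S then a else a')"
    define y where "y = (if b \<in> S then b else b')"
    define z where "z = (if c \<in> S then c else c')"
    have xyz: "x \<in> {a, a'}" "y \<in> {b, b'}" "z \<in> {c, c'}" by (auto simp: x_def y_def z_def)
    have sub: "S \<subseteq> {p, t, x, y, z}"
      using S by (auto simp: Q_def x_def y_def z_def)
    show "S \<in> K"
    proof (cases "p \<in> S")
      case True
      then have "S \<subseteq> {p, x, y, z}" using S sub by (auto simp: Q_def)
      moreover have "(x, y, z) \<noteq> (a, b, c)"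
        using S True dist by (auto simp: Q_def x_def y_def z_def split: if_splits)
      then have "{p, x, y, z} \<in> K" using p xyz by blast
      ultimately show ?thesis using finite_complexD(3)[OF K] S by (auto simp: Q_def)
    next
      case False
      then have "S \<subseteq> {t, x, y, z}" using sub by auto
      then show ?thesis using finite_complexD(3)[OF K t[OF xyz]] S by (auto simp: Q_def)
    qed
  qed
  have faces: "T \<in> Q" if "T \<subset> {p, a, b, c}" "T \<noteq> {}" for T
    using that dist by (auto simp: Q_def)
  \<comment> \<open>A simplex of \<open>Q\<close> containing \<open>p\<close>, \<open>a\<close>,
    \<open>b\<close> can be enlarged by \<open>c'\<close> only, because \<open>{p, a, b, c}\<close>
    is absent. The three triangles next to the missing facet are thus free.\<close>
  let ?R1 = "{{p, a, b}, {p, b, c}, {p, a, c}}"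
  define v1 where "v1 \<rho> = (if \<rho> = {p, a, b} then c' else if \<rho> = {p, b, c} then a' else b')" for \<rho>
  define Q1 where "Q1 = {S \<in> Q. \<forall>\<rho>\<in>?R1. \<not> \<rho> \<subseteq> S}"
  have memQ1: "S \<in> Q1 \<longleftrightarrow> S \<in> Q \<and> \<not> (p \<in> S \<and> a \<in> S \<and> b \<in> S) \<and> \<not> (p \<in> S \<and> b \<in> S \<and> c \<in> S)
      \<and> \<not> (p \<in> S \<and> a \<in> S \<and> c \<in> S)" for S
    by (simp add: Q1_def)
  have v1: "v1 {p, a, b} = c'" "v1 {p, b, c} = a'" "v1 {p, a, c} = b'"
  proof -
    have "{p, b, c} \<noteq> {p, a, b}" "{p, a, c} \<noteq> {p, a, b}" "{p, a, c} \<noteq> {p, b, c}"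
      using dist by auto
    then show "v1 {p, a, b} = c'" "v1 {p, b, c} = a'" "v1 {p, a, c} = b'" by (simp_all add: v1_def)
  qed
  have "finite_complex Q1 \<and> geometric_realization Q homotopy_equivalent_space geometric_realization Q1"
    unfolding Q1_def
  proof (rule realization_collapse_family[OF Q, of ?R1 v1])
    fix \<rho> assume \<rho>: "\<rho> \<in> ?R1"
    then have "v1 \<rho> \<in> {a', b', c'}" using v1 by auto
    then show "v1 \<rho> \<notin> \<Union>?R1" using ne by auto
    fix S assume S: "S \<in> Q" "\<rho> \<subseteq> S"
    consider "\<rho> = {p, a, b}" | "\<rho> = {p, b, c}" | "\<rho> = {p, a, c}" using \<rho> by blast
    then show "insert (v1 \<rho>) S \<in> Q"
      by cases (use S v1 ne in \<open>simp_all add: memQ\<close>)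
  qed auto
  then have Q1: "finite_complex Q1" and e1: "geometric_realization Q homotopy_equivalent_space geometric_realization Q1"
    by auto
  \<comment> \<open>With those triangles gone, a simplex on \<open>p\<close> and \<open>a\<close>
    contains neither \<open>b\<close> nor \<open>c\<close>, which makes room for \<open>b'\<close>;
    simplices on \<open>{p, b}\<close> or \<open>{p, c}\<close> likewise avoid \<open>a\<close> and
    accept \<open>a'\<close>.\<close>
  let ?R2 = "{{p, a}, {p, b}, {p, c}}"
  define v2 where "v2 \<rho> = (if \<rho> = {p, a} then b' else a')" for \<rho>
  define Q2 where "Q2 = {S \<in> Q1. \<forall>\<rho>\<in>?R2. \<not> \<rho> \<subseteq> S}"
  have memQ2: "S \<in> Q2 \<longleftrightarrow> S \<in> Q1 \<and> \<not> (p \<in> S \<and> a \<in> S) \<and> \<not> (p \<in> S \<and> b \<in> S) \<and> \<not> (p \<in> S \<and> c \<in> S)" for S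
    by (simp add: Q2_def)
  have v2: "v2 {p, a} = b'" "v2 {p, b} = a'" "v2 {p, c} = a'"
  proof -
    have "{p, b} \<noteq> {p, a}" "{p, c} \<noteq> {p, a}" using dist by (auto simp: doubleton_eq_iff)
    then show "v2 {p, a} = b'" "v2 {p, b} = a'" "v2 {p, c} = a'" by (simp_all add: v2_def)
  qed
  have "finite_complex Q2 \<and> geometric_realization Q1 homotopy_equivalent_space geometric_realization Q2"
    unfolding Q2_def
  proof (rule realization_collapse_family[OF Q1, of ?R2 v2])
    fix \<rho> assume \<rho>: "\<rho> \<in> ?R2"
    then have "v2 \<rho> \<in> {a', b'}" using v2 by auto
    then show "v2 \<rho> \<notin> \<Union>?R2" using ne by auto
    fix S assume S: "S \<in> Q1" "\<rho> \<subseteq> S"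
    consider "\<rho> = {p, a}" | "\<rho> = {p, b}" | "\<rho> = {p, c}" using \<rho> by blast
    then show "insert (v2 \<rho>) S \<in> Q1"
      by cases (use S v2 ne in \<open>simp_all add: memQ1 memQ\<close>)
  qed auto
  then have Q2: "finite_complex Q2" and e2: "geometric_realization Q1 homotopy_equivalent_space geometric_realization Q2"
    by auto
  \<comment> \<open>Simplices on \<open>p\<close> now avoid \<open>a\<close>, \<open>b\<close> and
    \<open>c\<close>, so \<open>p\<close> itself collapses towards \<open>a'\<close>. What remains
    is a cone with apex \<open>t\<close>.\<close>
  define Q3 where "Q3 = {S \<in> Q2. \<not> {p} \<subseteq> S}"
  have c3: "insert a' S \<in> Q2" if "S \<in> Q2" "{p} \<subseteq> S" for S
    using that ne by (simp add: memQ2 memQ1 memQ)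
  have a'p: "a' \<notin> {p}" using ne by simp
  have Q3: "finite_complex Q3"
    unfolding Q3_def by (rule realization_collapse(1)[OF Q2 _ a'p c3]) simp
  have e3: "geometric_realization Q2 homotopy_equivalent_space geometric_realization Q3"
    unfolding Q3_def by (rule realization_collapse(2)[OF Q2 _ a'p c3]) simp
  have c4: "insert t S \<in> Q3" if "S \<in> Q3" for S
    using that ne by (simp add: Q3_def memQ2 memQ1 memQ)
  have "{t} \<in> Q3" using ne by (simp add: Q3_def memQ2 memQ1 memQ)
  then have "contractible_space (geometric_realization Q3)"
    using contractible_realization_cone[OF Q3 c4] by blast
  then have "contractible_space (geometric_realization Q)"
    using e1 e2 e3 homotopy_equivalent_space_contractibility by metis
  then show ?thesis
    unfolding fillable_def using Q QK faces by blast
qed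

section \<open>The link of a set\<close>

definition near :: "'a set \<Rightarrow> 'a set \<Rightarrow> bool" where
  "near D E \<longleftrightarrow> card (sym_diff D E) \<le> 2"

lemma mem_vietoris_rips_2:
  "S \<in> vietoris_rips symdiff_dist F 2 \<longleftrightarrow>
     S \<subseteq> F \<and> finite S \<and> S \<noteq> {} \<and> (\<forall>D\<in>S. \<forall>E\<in>S. near D E)"
proof -
  have "finite_diameter symdiff_dist S \<le> 2 \<longleftrightarrow> (\<forall>D\<in>S. \<forall>E\<in>S. near D E)" if "finite S" "S \<noteq> {}"
  proof -
    have eq: "{symdiff_dist x y |x y. x \<in> S \<and> y \<in> S} = (\<lambda>(x, y). symdiff_dist x y) ` (S \<times> S)" by auto
    have "finite_diameter symdiff_dist S \<le> 2 \<longleftrightarrow> (\<forall>d \<in> (\<lambda>(x, y). symdiff_dist x y) ` (S \<times> S). d \<le> 2)"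
      unfolding finite_diameter_def eq using that by (subst Max_le_iff) auto
    also have "\<dots> \<longleftrightarrow> (\<forall>D\<in>S. \<forall>E\<in>S. near D E)"
      by (auto simp: symdiff_dist_def near_def)
    finally show ?thesis .
  qed
  then show ?thesis unfolding vietoris_rips_def by blast
qed

lemma finite_complex_vietoris_rips:
  assumes "finite F"
  shows "finite_complex (vietoris_rips symdiff_dist F 2)"
  unfolding finite_complex_def
proof (intro conjI ballI allI impI)
  have "vietoris_rips symdiff_dist F 2 \<subseteq> Pow F" by (auto simp: vietoris_rips_def)
  then show "finite (vietoris_rips symdiff_dist F 2)" using assms finite_subset by blast
  fix S assume S: "S \<in> vietoris_rips symdiff_dist F 2"
  then show "finite S" "S \<noteq> {}" by (simp_all add: mem_vietoris_rips_2)
  fix T assume T: "T \<subseteq> S" "T \<noteq> {}"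
  then have "finite T" using S finite_subset by (auto simp: mem_vietoris_rips_2)
  then show "T \<in> vietoris_rips symdiff_dist F 2"
    using S T unfolding mem_vietoris_rips_2 by blast
qed

lemma near_iff:
  assumes "finite D" "finite E"
  shows "near D E \<longleftrightarrow> card D + card E \<le> 2 + 2 * card (D \<inter> E)"
proof -
  have "card (sym_diff D E) = card (D - E) + card (E - D)"
    using assms by (intro card_Un_disjoint) auto
  moreover have "card D = card (D - E) + card (D \<inter> E)"
    using assms by (metis card_Int_Diff add.commute)
  moreover have "card E = card (E - D) + card (D \<inter> E)"
    using assms by (metis card_Int_Diff add.commute inf_commute)
  ultimately show ?thesis unfolding near_def by linarith
qed

lemma near_commute: "near D E \<longleftrightarrow> near E D"
  by (simp add: near_def Un_commute)

lemma near_refl [simp]: "near D D"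
  by (simp add: near_def)

lemma near_empty: "finite D \<Longrightarrow> near {} D \<longleftrightarrow> card D \<le> 2"
  by (simp add: near_iff)

lemma near_singletons: "near {x} {y}"
  by (simp add: near_iff)

lemma near_singleton_pair: "u \<noteq> w \<Longrightarrow> near {x} {u, w} \<longleftrightarrow> x \<in> {u, w}"
  by (cases "x \<in> {u, w}") (auto simp: near_iff Int_insert_left)

lemma near_pairs:
  assumes "u \<noteq> w" "u' \<noteq> w'"
  shows "near {u, w} {u', w'} \<longleftrightarrow> {u, w} \<inter> {u', w'} \<noteq> {}"
proof -
  have "near {u, w} {u', w'} \<longleftrightarrow> 1 \<le> card ({u, w} \<inter> {u', w'})"
    using assms by (simp add: near_iff) arith
  also have "\<dots> \<longleftrightarrow> {u, w} \<inter> {u', w'} \<noteq> {}"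
    by (simp add: Suc_le_eq card_gt_0_iff)
  finally show ?thesis .
qed

lemma near_subset:
  assumes "finite E" "D \<subseteq> E" "card E \<le> 2 + card D"
  shows "near D E"
  using assms finite_subset[of D E] by (simp add: near_iff Int_absorb2)

definition triangle :: "'a \<Rightarrow> 'a \<Rightarrow> 'a \<Rightarrow> 'a set set" where
  "triangle u v w = {{u, v}, {v, w}, {u, w}}"

lemma triangle_commute: "triangle u v w = triangle v u w" "triangle u v w = triangle u w v"
  by (auto simp: triangle_def insert_commute)

lemma Union_triangle: "\<Union>(triangle u v w) = {u, v, w}"
  by (auto simp: triangle_def)

lemma triangle_no_common_element:
  assumes "u \<noteq> v" "v \<noteq> w" "u \<noteq> w"
  shows "\<exists>D \<in> triangle u v w. y \<notin> D"
  using assms by (auto simp: triangle_def)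

lemma card_triangle:
  assumes "u \<noteq> v" "v \<noteq> w" "u \<noteq> w"
  shows "card (triangle u v w) = 3"
  using assms by (auto simp: triangle_def doubleton_eq_iff card_insert_if)

text \<open>The vertices of \<open>G\<close> are to be read as symmetric differences with \<open>A\<close>, so that \<open>{}\<close> stands for \<open>A\<close>
  itself and \<open>{y, x}\<close> with \<open>y \<in> Y\<close> for the exchange of \<open>x \<in> A\<close> for a smaller element outside \<open>A\<close>.\<close>

locale cube_link =
  fixes A Y :: "nat set" and G :: "nat set set"
  assumes finite_A: "finite A" and A_nonempty: "A \<noteq> {}" and disjoint: "A \<inter> Y = {}" and finite_Y: "finite Y"
    and finite_G: "finite G" and finite_mem_G: "\<And>D. D \<in> G \<Longrightarrow> finite D" and empty_notin_G: "{} \<notin> G"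
    and small_G: "\<And>D. D \<in> G \<and> card D \<le> 2 \<longleftrightarrow>
      (\<exists>x\<in>A. D = {x}) \<or> (\<exists>x\<in>A. \<exists>w. w \<noteq> x \<and> (w \<in> A \<or> w \<in> Y \<and> w < x) \<and> D = {w, x})"
    and triple_G: "\<And>u v w. u \<in> A \<Longrightarrow> v \<in> A \<Longrightarrow> w \<in> A \<Longrightarrow> u < v \<Longrightarrow> v < w \<Longrightarrow> {u, v, w} \<in> G"
    and quadruple_G: "\<And>u v w. u \<in> Y \<Longrightarrow> v \<in> A \<Longrightarrow> w \<in> A \<Longrightarrow> u < v \<Longrightarrow> v < w \<Longrightarrow> w < Max A \<Longrightarrow>
      {u, v, w, Max A} \<in> G"
begin

abbreviation "z \<equiv> Max A"
abbreviation "VG \<equiv> vietoris_rips symdiff_dist G 2"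

definition V where "V = {D \<in> G. card D \<le> 2}"
text \<open>The empty simplex is included, so that adding the vertex \<open>{}\<close> to the
  members of \<open>L\<close> also produces that vertex alone.\<close>

definition L where "L = {S. S \<subseteq> V \<and> (\<forall>D\<in>S. \<forall>E\<in>S. near D E)}"
definition T1 where "T1 = {triangle u v w |u v w. u \<in> A \<and> v \<in> A \<and> w \<in> A \<and> u < v \<and> v < w}"
definition T2 where "T2 = {triangle u v w |u v w. u \<in> Y \<and> v \<in> A \<and> w \<in> A \<and> u < v \<and> v < w \<and> w < z}"
definition L0 where "L0 = {S \<in> L. \<forall>\<tau> \<in> T1 \<union> T2. \<not> \<tau> \<subseteq> S}"
text \<open>The apex \<open>{}\<close> of this cone is the new vertex \<open>A\<close>; shrinking
  \<open>M\<close> changes only simplices that contain it.\<close>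

definition cplx where "cplx M = VG \<union> insert {} ` M"

lemma z_in: "z \<in> A" and z_ge: "x \<in> A \<Longrightarrow> x \<le> z"
  using finite_A A_nonempty by auto

lemma notin_Y: "x \<in> A \<Longrightarrow> x \<notin> Y"
  using disjoint by blast

lemma V_cases:
  assumes "D \<in> V"
  obtains (single) x where "x \<in> A" "D = {x}"
  | (pair) w x where "x \<in> A" "w \<noteq> x" "w \<in> A \<or> w \<in> Y \<and> w < x" "D = {w, x}"
proof -
  have "(\<exists>x\<in>A. D = {x}) \<or> (\<exists>x\<in>A. \<exists>w. w \<noteq> x \<and> (w \<in> A \<or> w \<in> Y \<and> w < x) \<and> D = {w, x})"
    using assms small_G[of D] by (simp add: V_def)
  then show thesis using that by blast
qed

lemma single_V: "x \<in> A \<Longrightarrow> {x} \<in> V"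
  using small_G[of "{x}"] by (auto simp: V_def)

lemma pair_V:
  assumes "x \<in> A" "w \<noteq> x" "w \<in> A \<or> w \<in> Y \<and> w < x"
  shows "{w, x} \<in> V" "{x, w} \<in> V"
proof -
  show "{w, x} \<in> V" using small_G[of "{w, x}"] assms by (auto simp: V_def)
  then show "{x, w} \<in> V" by (simp add: insert_commute)
qed

lemma V_nonempty: "{} \<notin> V"
  using empty_notin_G by (simp add: V_def)

lemma finite_V: "finite V"
  using finite_G by (simp add: V_def)

lemma V_common_near:
  assumes "D \<in> V" "E \<in> V" "x \<in> D" "x \<in> E"
  shows "near D E"
  using assms(1)
proof (cases rule: V_cases)
  case (single a)
  from assms(2) show ?thesis
  proof (cases rule: V_cases)
    case (single b)
    then show ?thesis using \<open>D = {a}\<close> by (simp add: near_singletons)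
  next
    case (pair w b)
    then show ?thesis using \<open>D = {a}\<close> assms by (simp add: near_singleton_pair)
  qed
next
  case (pair w a)
  note D = pair
  from assms(2) show ?thesis
  proof (cases rule: V_cases)
    case (single b)
    then show ?thesis using D assms near_commute[of D E] by (simp add: near_singleton_pair)
  next
    case (pair w' b)
    then have "{w, a} \<inter> {w', b} \<noteq> {}" using D assms by blast
    then show ?thesis using pair D near_pairs by metis
  qed
qed

lemma V_with_Y:
  assumes "E \<in> V" "y \<in> E" "y \<in> Y"
  obtains x where "x \<in> A" "y < x" "E = {y, x}"
  using assms(1)
proof (cases rule: V_cases)
  case (single x)
  then show thesis using assms notin_Y by auto
next
  case (pair w x)
  then have "w = y" using assms notin_Y by auto
  then show thesis using pair that assms notin_Y by auto
qed

text \<open>A pair meeting both \<open>{c, a}\<close> and \<open>{c, b}\<close> either passes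
  through \<open>c\<close> or closes the triangle; a singleton adjacent to both must be
  \<open>{c}\<close>. This choice between star and triangle governs the simplices of the
  link.\<close>

lemma near_two_pairs:
  assumes E: "E \<in> V" and d: "c \<noteq> a" "c \<noteq> b" "a \<noteq> b" and n: "near E {c, a}" "near E {c, b}"
  shows "c \<in> E \<or> E = {a, b}"
  using E
proof (cases rule: V_cases)
  case (single x)
  then show ?thesis using n d by (auto simp: near_singleton_pair)
next
  case (pair w x)
  then have "{w, x} \<inter> {c, a} \<noteq> {}" "{w, x} \<inter> {c, b} \<noteq> {}" using n d near_pairs by metis+
  then show ?thesis using pair d by auto
qed

lemma L_subset: "S \<in> L \<Longrightarrow> T \<subseteq> S \<Longrightarrow> T \<in> L"
  unfolding L_def by blast

lemma L0_subset: "S \<in> L0 \<Longrightarrow> T \<subseteq> S \<Longrightarrow> T \<in> L0"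
  unfolding L0_def using L_subset by blast

lemma insert_L:
  assumes "S \<in> L" "v \<in> V" "\<And>E. E \<in> S \<Longrightarrow> near v E"
  shows "insert v S \<in> L"
  using assms near_commute unfolding L_def by auto

lemma T_cases:
  assumes "\<tau> \<in> T1 \<union> T2"
  obtains u v w where "\<tau> = triangle u v w" "v \<in> A" "w \<in> A" "u < v" "v < w" "u \<in> A \<or> u \<in> Y \<and> w < z"
proof -
  have "\<exists>u v w. \<tau> = triangle u v w \<and> v \<in> A \<and> w \<in> A \<and> u < v \<and> v < w \<and> (u \<in> A \<or> u \<in> Y \<and> w < z)"
    using assms unfolding T1_def T2_def by blast
  then show thesis using that by blast
qed

text \<open>The three pairs of a triangle have no element in common, so a star never contains a
  removed triangle.\<close>

lemma common_element_L0:
  assumes "S \<subseteq> V" "\<And>E. E \<in> S \<Longrightarrow> x \<in> E"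
  shows "S \<in> L0"
proof -
  have "S \<in> L" using assms V_common_near unfolding L_def by blast
  moreover have "\<not> \<tau> \<subseteq> S" if "\<tau> \<in> T1 \<union> T2" for \<tau>
    using that
  proof (cases rule: T_cases)
    case (1 u v w)
    then show ?thesis using triangle_no_common_element[of u v w x] assms(2) by auto
  qed
  ultimately show ?thesis by (simp add: L0_def)
qed

lemma triangle_in_L:
  assumes "v \<in> A" "w \<in> A" "u < v" "v < w" "u \<in> A \<or> u \<in> Y"
  shows "triangle u v w \<in> L"
proof -
  have "{u, v} \<in> V" "{v, w} \<in> V" "{u, w} \<in> V"
    using assms by (auto intro: pair_V)
  moreover have "near {u, v} {v, w}" "near {u, v} {u, w}" "near {v, w} {u, w}"
    using assms by (auto simp: near_pairs)
  ultimately show ?thesis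
    using near_commute unfolding L_def triangle_def by auto
qed

text \<open>A vertex adjacent to all three pairs of a triangle, but not among them, would contain
  \<open>u\<close>, \<open>v\<close> and \<open>w\<close>, which is too many for at most two
  elements. Deleting the triangles from the link therefore deletes nothing else.\<close>

lemma T_maximal:
  assumes "\<tau> \<in> T1 \<union> T2" "S \<in> L" "\<tau> \<subseteq> S"
  shows "S = \<tau>"
  using assms(1)
proof (cases rule: T_cases)
  case (1 u v w)
  have "E \<in> \<tau>" if "E \<in> S" for E
  proof -
    have E: "E \<in> V" "near E {u, v}" "near E {v, w}" "near E {u, w}"
      using that assms 1 by (auto simp: L_def triangle_def)
    have "u \<in> E \<or> E = {v, w}" using near_two_pairs[OF E(1), of u v w] E 1 by auto
    moreover have "v \<in> E \<or> E = {u, w}"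
      using near_two_pairs[OF E(1), of v u w] E 1 by (auto simp: insert_commute)
    moreover have "w \<in> E \<or> E = {u, v}"
      using near_two_pairs[OF E(1), of w u v] E 1 by (auto simp: insert_commute)
    moreover have "card E \<le> 2" "finite E" using E(1) finite_mem_G by (auto simp: V_def)
    moreover have "\<not> {u, v, w} \<subseteq> E"
    proof
      assume "{u, v, w} \<subseteq> E"
      then have "card {u, v, w} \<le> card E" using \<open>finite E\<close> card_mono by blast
      then show False using \<open>card E \<le> 2\<close> 1 by simp
    qed
    ultimately show ?thesis unfolding 1 triangle_def by auto
  qed
  then show ?thesis using assms(3) by blast
qed

lemma T_in_L: "\<tau> \<in> T1 \<union> T2 \<Longrightarrow> \<tau> \<in> L"
  by (erule T_cases) (use triangle_in_L in blast)

lemma L_eq: "L = L0 \<union> T1 \<union> T2"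
  using T_in_L T_maximal unfolding L0_def by blast

text \<open>Removed triangles meeting \<open>Y\<close> have all their elements below
  \<open>z\<close>, so those ending in \<open>z\<close> survive. They are the room into which stage
  2 collapses, and faces of the octahedra in \<open>fillable_T2\<close>.\<close>

lemma triangle_z_in_L0:
  assumes y: "y \<in> Y" and x: "x \<in> A" "y < x" "x < z"
  shows "triangle y x z \<in> L0"
proof -
  have "triangle y x z \<in> L" using triangle_in_L[of x z y] assms z_in by blast
  moreover have "\<not> \<tau> \<subseteq> triangle y x z" if \<tau>: "\<tau> \<in> T1 \<union> T2" for \<tau>
  proof
    assume "\<tau> \<subseteq> triangle y x z"
    then have "\<tau> = triangle y x z" using T_maximal[OF \<tau> \<open>triangle y x z \<in> L\<close>] by simp
    with \<tau> show False
    proof (cases rule: T_cases)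
      case (1 u v w)
      then have "{u, v, w} = {y, x, z}" using \<open>\<tau> = triangle y x z\<close> Union_triangle by metis
      then have "y \<in> {u, v, w}" "z \<in> {u, v, w}" by blast+
      then show False using 1 y x notin_Y[of y] z_ge[of w] by auto
    qed
  qed
  ultimately show ?thesis by (simp add: L0_def)
qed

text \<open>Nearness to \<open>{}\<close> means having at most two elements, so the neighbours of
  the apex are exactly the members of \<open>V\<close>. Simplices with and without the apex are
  compared separately.\<close>

lemma cplx_L: "cplx L = vietoris_rips symdiff_dist (insert {} G) 2"
proof (rule set_eqI)
  fix S
  show "S \<in> cplx L \<longleftrightarrow> S \<in> vietoris_rips symdiff_dist (insert {} G) 2"
  proof (cases "{} \<in> S")
    case False
    then have "S \<in> cplx L \<longleftrightarrow> S \<in> VG" by (auto simp: cplx_def)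
    also have "\<dots> \<longleftrightarrow> S \<in> vietoris_rips symdiff_dist (insert {} G) 2"
      using False by (auto simp: mem_vietoris_rips_2)
    finally show ?thesis .
  next
    case True
    have "S \<notin> VG" using True empty_notin_G by (auto simp: mem_vietoris_rips_2)
    then have "S \<in> cplx L \<longleftrightarrow> S - {{}} \<in> L"
      using True V_nonempty by (auto simp: cplx_def L_def insert_absorb intro: image_eqI[of _ _ "S - {{}}"])
    also have "\<dots> \<longleftrightarrow> S \<in> vietoris_rips symdiff_dist (insert {} G) 2"
    proof
      assume S: "S - {{}} \<in> L"
      then have sub: "S \<subseteq> insert {} V" by (auto simp: L_def)
      then have "finite S" using finite_V finite_subset by blast
      moreover have "near D E" if "D \<in> S" "E \<in> S" for D E
      proof -
        have "near {} F" if "F \<in> S" for F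
          using sub that finite_mem_G by (cases "F = {}") (auto simp: near_empty V_def)
        then show ?thesis using that S near_commute unfolding L_def by blast
      qed
      moreover have "S \<subseteq> insert {} G" using sub by (auto simp: V_def)
      ultimately show "S \<in> vietoris_rips symdiff_dist (insert {} G) 2"
        using True by (auto simp: mem_vietoris_rips_2)
    next
      assume S: "S \<in> vietoris_rips symdiff_dist (insert {} G) 2"
      have "D \<in> V" if "D \<in> S - {{}}" for D
      proof -
        have "near {} D" "D \<in> G" using S True that by (auto simp: mem_vietoris_rips_2)
        then show ?thesis using finite_mem_G by (simp add: V_def near_empty)
      qed
      then show "S - {{}} \<in> L" using S by (auto simp: L_def mem_vietoris_rips_2)
    qed
    finally show ?thesis .
  qed
qed

lemma cplx_L_complex: "finite_complex (cplx L)"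
  unfolding cplx_L using finite_G by (intro finite_complex_vietoris_rips) simp

lemma cplx_L0_complex: "finite_complex (cplx L0)"
  unfolding finite_complex_def
proof (intro conjI ballI allI impI)
  have sub: "cplx L0 \<subseteq> cplx L" by (auto simp: cplx_def L0_def)
  then show "finite (cplx L0)" using finite_complex_finite[OF cplx_L_complex] finite_subset by blast
  fix S assume S: "S \<in> cplx L0"
  then show "finite S" "S \<noteq> {}" using sub finite_complexD(1,2)[OF cplx_L_complex] by blast+
  fix T assume T: "T \<subseteq> S" "T \<noteq> {}"
  show "T \<in> cplx L0"
  proof (cases "S \<in> VG")
    case True
    then show ?thesis
      using T finite_complexD(3)[OF finite_complex_vietoris_rips[OF finite_G]] unfolding cplx_def by blast
  next
    case False
    then obtain S' where S': "S' \<in> L0" "S = insert {} S'" using S by (auto simp: cplx_def)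
    have T': "T - {{}} \<in> L0" using L0_subset[OF S'(1), of "T - {{}}"] T S'(2) by blast
    show ?thesis
    proof (cases "{} \<in> T")
      case True
      then have "T = insert {} (T - {{}})" by blast
      then show ?thesis using T' unfolding cplx_def by blast
    next
      case False
      then have "T \<in> L" "T \<subseteq> G" using T' by (auto simp: L0_def L_def V_def)
      then have "T \<in> VG"
        using T(2) finite_subset[OF _ finite_V, of T] by (auto simp: mem_vietoris_rips_2 L_def)
      then show ?thesis by (simp add: cplx_def)
    qed
  qed
qed

text \<open>A collapse of the link becomes a collapse of the complex along the faces
  \<open>insert {} \<rho>\<close>: only simplices through the apex are affected, and these
  correspond to members of \<open>M\<close>. The face \<open>\<rho> = {}\<close> is allowed and
  removes the apex itself.\<close>

lemma cplx_collapse: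
  assumes M: "finite_complex (cplx M)" "M \<subseteq> L" and R: "finite R" "\<And>\<rho>. \<rho> \<in> R \<Longrightarrow> {} \<notin> \<rho>"
    and v: "\<And>\<rho>. \<rho> \<in> R \<Longrightarrow> \<exists>v. v \<noteq> {} \<and> v \<notin> \<Union>R \<and> (\<forall>S\<in>M. \<rho> \<subseteq> S \<longrightarrow> insert v S \<in> M)"
    and M': "M' = {S \<in> M. \<forall>\<rho>\<in>R. \<not> \<rho> \<subseteq> S}"
  shows "finite_complex (cplx M')"
    and "geometric_realization (cplx M) homotopy_equivalent_space geometric_realization (cplx M')"
proof -
  have "\<exists>f. \<forall>\<rho>\<in>R. f \<rho> \<noteq> {} \<and> f \<rho> \<notin> \<Union>R \<and> (\<forall>S\<in>M. \<rho> \<subseteq> S \<longrightarrow> insert (f \<rho>) S \<in> M)"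
    by (rule bchoice, rule ballI, rule v)
  then obtain f where F: "\<forall>\<rho>\<in>R. f \<rho> \<noteq> {} \<and> f \<rho> \<notin> \<Union>R \<and> (\<forall>S\<in>M. \<rho> \<subseteq> S \<longrightarrow> insert (f \<rho>) S \<in> M)" ..
  have f: "f \<rho> \<noteq> {}" "f \<rho> \<notin> \<Union>R" "S \<in> M \<Longrightarrow> \<rho> \<subseteq> S \<Longrightarrow> insert (f \<rho>) S \<in> M" if "\<rho> \<in> R" for \<rho> S
    using bspec[OF F that] by simp_all
  have notin: "{} \<notin> S" if "S \<in> M" for S using that M(2) V_nonempty by (auto simp: L_def)
  have notin': "{} \<notin> S" if "S \<in> VG" for S using that empty_notin_G by (auto simp: mem_vietoris_rips_2)
  let ?R = "insert {} ` R" and ?f = "\<lambda>\<rho>. f (\<rho> - {{}})"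
  have strip: "insert {} \<rho> - {{}} = \<rho>" if "\<rho> \<in> R" for \<rho> using R(2)[OF that] by blast
  have "finite_complex {S \<in> cplx M. \<forall>\<rho>\<in>?R. \<not> \<rho> \<subseteq> S} \<and>
    geometric_realization (cplx M) homotopy_equivalent_space geometric_realization {S \<in> cplx M. \<forall>\<rho>\<in>?R. \<not> \<rho> \<subseteq> S}"
  proof (rule realization_collapse_family[OF M(1), of ?R ?f])
    show "finite ?R" using R(1) by simp
    fix \<rho>' assume "\<rho>' \<in> ?R"
    then obtain \<rho> where \<rho>: "\<rho> \<in> R" "\<rho>' = insert {} \<rho>" by blast
    show "\<rho>' \<noteq> {}" using \<rho> by blast
    have f': "f (\<rho>' - {{}}) = f \<rho>" using \<rho> strip by simp
    show "f (\<rho>' - {{}}) \<notin> \<Union>?R" unfolding f' using f(1,2)[OF \<rho>(1)] by auto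
    fix S' assume S': "S' \<in> cplx M" "\<rho>' \<subseteq> S'"
    then have "{} \<in> S'" using \<rho> by blast
    then have "S' \<notin> VG" using notin' by blast
    then obtain S where S: "S \<in> M" "S' = insert {} S" using S' by (auto simp: cplx_def)
    have "\<rho> \<subseteq> S" using S'(2) S(2) \<rho> R(2)[OF \<rho>(1)] by blast
    then have "insert (f \<rho>) S \<in> M" using f(3)[OF \<rho>(1) S(1)] by blast
    moreover have "insert (f \<rho>) S' = insert {} (insert (f \<rho>) S)" using S(2) by blast
    ultimately show "insert (f (\<rho>' - {{}})) S' \<in> cplx M" unfolding f' cplx_def by blast
  qed
  moreover have "{S \<in> cplx M. \<forall>\<rho>\<in>?R. \<not> \<rho> \<subseteq> S} = cplx M'"
  proof (rule set_eqI)
    fix S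
    have 1: "insert {} \<rho> \<subseteq> insert {} S' \<longleftrightarrow> \<rho> \<subseteq> S'" if "\<rho> \<in> R" "S' \<in> M" for \<rho> S'
      using R(2)[OF that(1)] by blast
    show "S \<in> {S \<in> cplx M. \<forall>\<rho>\<in>?R. \<not> \<rho> \<subseteq> S} \<longleftrightarrow> S \<in> cplx M'"
    proof
      assume S: "S \<in> {S \<in> cplx M. \<forall>\<rho>\<in>?R. \<not> \<rho> \<subseteq> S}"
      show "S \<in> cplx M'"
      proof (cases "S \<in> VG")
        case False
        then obtain S' where S': "S' \<in> M" "S = insert {} S'" using S by (auto simp: cplx_def)
        have "\<not> \<rho> \<subseteq> S'" if "\<rho> \<in> R" for \<rho>
        proof -
          have "\<not> insert {} \<rho> \<subseteq> S" using S that by simp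
          then show ?thesis using 1[OF that S'(1)] S'(2) by simp
        qed
        then have "S' \<in> M'" using S'(1) by (simp add: M')
        then show ?thesis using S'(2) by (simp add: cplx_def)
      qed (simp add: cplx_def)
    next
      assume S: "S \<in> cplx M'"
      show "S \<in> {S \<in> cplx M. \<forall>\<rho>\<in>?R. \<not> \<rho> \<subseteq> S}"
      proof (cases "S \<in> VG")
        case True
        then show ?thesis using notin'[OF True] by (auto simp: cplx_def)
      next
        case False
        then obtain S' where S': "S' \<in> M'" "S = insert {} S'" using S by (auto simp: cplx_def)
        then have M: "S' \<in> M" "\<And>\<rho>. \<rho> \<in> R \<Longrightarrow> \<not> \<rho> \<subseteq> S'" by (simp_all add: M')
        have "S \<in> cplx M" using M(1) S'(2) by (simp add: cplx_def)
        moreover have "\<not> insert {} \<rho> \<subseteq> S" if "\<rho> \<in> R" for \<rho>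
          using M(2)[OF that] 1[OF that M(1)] S'(2) by simp
        ultimately show ?thesis by simp
      qed
    qed
  qed
  ultimately show "finite_complex (cplx M')"
    and "geometric_realization (cplx M) homotopy_equivalent_space geometric_realization (cplx M')"
    by simp_all
qed

end

section \<open>Collapsing the cone over the reduced link\<close>

context cube_link
begin

lemma L_nearD: "S \<in> L \<Longrightarrow> D \<in> S \<Longrightarrow> E \<in> S \<Longrightarrow> near D E"
  unfolding L_def by blast

lemma L_VD: "S \<in> L \<Longrightarrow> D \<in> S \<Longrightarrow> D \<in> V"
  unfolding L_def by blast

lemma T_pairs:
  assumes "\<tau> \<in> T1 \<union> T2" "D \<in> \<tau>"
  shows "D \<noteq> {x}"
  using assms(1)
proof (cases rule: T_cases)
  case (1 u v w)
  then have "D = {u, v} \<or> D = {v, w} \<or> D = {u, w}" "u \<noteq> v" "v \<noteq> w" "u \<noteq> w"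
    using assms(2) by (auto simp: triangle_def)
  then show ?thesis by (metis insertCI singletonD)
qed

text \<open>Removed triangles consist of pairs, so adding a singleton cannot complete one.\<close>

lemma insert_single_L0:
  assumes S: "S \<in> L0" and x: "x \<in> A" and n: "\<And>E. E \<in> S \<Longrightarrow> near {x} E"
  shows "insert {x} S \<in> L0"
proof -
  have "insert {x} S \<in> L" using S insert_L[OF _ single_V[OF x] n] by (simp add: L0_def)
  moreover have "\<not> \<tau> \<subseteq> insert {x} S" if "\<tau> \<in> T1 \<union> T2" for \<tau>
  proof -
    have "{x} \<notin> \<tau>" using T_pairs[OF that] by blast
    moreover have "\<not> \<tau> \<subseteq> S" using S that by (simp add: L0_def)
    ultimately show ?thesis by blast
  qed
  ultimately show ?thesis by (simp add: L0_def)
qed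

text \<open>Each family lists faces that acquire a common free vertex once the previous families are
  gone: \<open>{y, z}\<close> for \<open>R1\<close>, \<open>{x, z}\<close> for \<open>R2\<close>,
  and \<open>{x}\<close> for \<open>R3\<close>, \<open>R4\<close> and \<open>R5\<close>.\<close>

definition R1 where "R1 = {{{y, x}, {y, x'}} |y x x'. y \<in> Y \<and> x \<in> A \<and> x' \<in> A \<and> y < x \<and> y < x' \<and> x < x' \<and> x' < z}"
definition R2 where "R2 = {{{y, x}, {y, z}} |y x. y \<in> Y \<and> x \<in> A \<and> y < x \<and> x < z}"
definition R3 where "R3 = {{{y, x}} |y x. y \<in> Y \<and> x \<in> A \<and> y < x}"
definition R4 where "R4 = {{{x, a}, {x, b}} |x a b. x \<in> A \<and> a \<in> A \<and> b \<in> A \<and> x \<noteq> a \<and> x \<noteq> b \<and> a \<noteq> b}"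
definition R5 where "R5 = {{{x, a}} |x a. x \<in> A \<and> a \<in> A \<and> x \<noteq> a}"

definition L1 where "L1 = {S \<in> L0. \<forall>\<rho>\<in>R1. \<not> \<rho> \<subseteq> S}"
definition L2 where "L2 = {S \<in> L1. \<forall>\<rho>\<in>R2. \<not> \<rho> \<subseteq> S}"
definition L3 where "L3 = {S \<in> L2. \<forall>\<rho>\<in>R3. \<not> \<rho> \<subseteq> S}"
definition L4 where "L4 = {S \<in> L3. \<forall>\<rho>\<in>R4. \<not> \<rho> \<subseteq> S}"
definition L5 where "L5 = {S \<in> L4. \<forall>\<rho>\<in>R5. \<not> \<rho> \<subseteq> S}"

lemma L_chain: "L5 \<subseteq> L4" "L4 \<subseteq> L3" "L3 \<subseteq> L2" "L2 \<subseteq> L1" "L1 \<subseteq> L0" "L0 \<subseteq> L"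
  by (auto simp: L5_def L4_def L3_def L2_def L1_def L0_def)

lemma finite_sub_V:
  assumes "\<And>\<rho>. \<rho> \<in> R \<Longrightarrow> \<rho> \<subseteq> V"
  shows "finite R"
proof -
  have "R \<subseteq> Pow V" using assms by blast
  then show ?thesis using finite_V finite_subset by (metis finite_Pow_iff)
qed

lemma R_elements:
  assumes "\<rho> \<in> R1 \<union> R2 \<union> R3 \<union> R4 \<union> R5" "D \<in> \<rho>"
  shows "D \<in> V \<and> (\<exists>u w. u \<noteq> w \<and> D = {u, w})"
proof -
  consider "\<rho> \<in> R1" | "\<rho> \<in> R2" | "\<rho> \<in> R3" | "\<rho> \<in> R4" | "\<rho> \<in> R5" using assms(1) by blast
  then show ?thesis
  proof cases
    case 1
    then obtain y x x' where *: "\<rho> = {{y, x}, {y, x'}}" "y \<in> Y" "x \<in> A" "x' \<in> A" "y < x" "y < x'"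
      unfolding R1_def by blast
    then have "D = {y, x} \<or> D = {y, x'}" using assms(2) by blast
    then show ?thesis using * pair_V(1)[of x y] pair_V(1)[of x' y] by (metis nat_neq_iff)
  next
    case 2
    then obtain y x where *: "\<rho> = {{y, x}, {y, z}}" "y \<in> Y" "x \<in> A" "y < x" "x < z"
      unfolding R2_def by blast
    then have "D = {y, x} \<or> D = {y, z}" "y < z" using assms(2) by auto
    then show ?thesis using * z_in pair_V(1)[of x y] pair_V(1)[of z y] by (metis nat_neq_iff)
  next
    case 3
    then obtain y x where *: "\<rho> = {{y, x}}" "y \<in> Y" "x \<in> A" "y < x"
      unfolding R3_def by blast
    then have "D = {y, x}" using assms(2) by blast
    then show ?thesis using * pair_V(1)[of x y] by (metis nat_neq_iff)
  next
    case 4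
    then obtain x a b where *: "\<rho> = {{x, a}, {x, b}}" "x \<in> A" "a \<in> A" "b \<in> A" "x \<noteq> a" "x \<noteq> b"
      unfolding R4_def by blast
    then have "D = {x, a} \<or> D = {x, b}" using assms(2) by blast
    then show ?thesis using * pair_V(1)[of a x] pair_V(1)[of b x] by metis
  next
    case 5
    then obtain x a where *: "\<rho> = {{x, a}}" "x \<in> A" "a \<in> A" "x \<noteq> a"
      unfolding R5_def by blast
    then have "D = {x, a}" using assms(2) by blast
    then show ?thesis using * pair_V(1)[of a x] by metis
  qed
qed

lemma R_finite: "finite R1" "finite R2" "finite R3" "finite R4" "finite R5"
proof -
  have sub: "\<rho> \<subseteq> V" if "\<rho> \<in> R1 \<union> R2 \<union> R3 \<union> R4 \<union> R5" for \<rho>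
    using R_elements[OF that] by blast
  show "finite R1" by (rule finite_sub_V, rule sub) simp
  show "finite R2" by (rule finite_sub_V, rule sub) simp
  show "finite R3" by (rule finite_sub_V, rule sub) simp
  show "finite R4" by (rule finite_sub_V, rule sub) simp
  show "finite R5" by (rule finite_sub_V, rule sub) simp
qed

lemma R_nonempty_vertices:
  assumes "\<rho> \<in> R1 \<union> R2 \<union> R3 \<union> R4 \<union> R5"
  shows "{} \<notin> \<rho>"
  using R_elements[OF assms, of "{}"] by blast

lemma single_notin_R:
  assumes "\<rho> \<in> R1 \<union> R2 \<union> R3 \<union> R4 \<union> R5"
  shows "{x} \<notin> \<rho>"
proof
  assume "{x} \<in> \<rho>"
  then obtain u w where "u \<noteq> w" "{x} = {u, w}" using R_elements[OF assms] by blast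
  then show False by (metis insertCI singletonD)
qed

text \<open>Stages 1 to 3 push the exchanges \<open>{y, x}\<close> into the simplex on \<open>A\<close>, stages 4 and 5 do this with
  the pairs inside \<open>A\<close>; what remains is a cone over a simplex.\<close>

lemma stage1:
  assumes \<rho>: "\<rho> \<in> R1"
  shows "\<exists>v. v \<noteq> {} \<and> v \<notin> \<Union>R1 \<and> (\<forall>S\<in>L0. \<rho> \<subseteq> S \<longrightarrow> insert v S \<in> L0)"
proof -
  obtain y x x' where *: "\<rho> = {{y, x}, {y, x'}}" "y \<in> Y" "x \<in> A" "x' \<in> A" "y < x" "y < x'" "x < x'" "x' < z"
    using \<rho> unfolding R1_def by blast
  have vV: "{y, z} \<in> V" using * z_in by (intro pair_V(1)) auto
  have "z \<notin> D" if "D \<in> \<Union>R1" for D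
    using that notin_Y[OF z_in] unfolding R1_def by auto
  then have n1: "{y, z} \<notin> \<Union>R1" by blast
  have n2: "insert {y, z} S \<in> L0" if S: "S \<in> L0" "\<rho> \<subseteq> S" for S
  proof (rule common_element_L0)
    have SL: "S \<in> L" using S L_chain by blast
    show "insert {y, z} S \<subseteq> V" using vV L_VD[OF SL] by blast
    fix E assume E: "E \<in> insert {y, z} S"
    show "y \<in> E"
    proof (cases "E \<in> S")
      case True
      have "near E {y, x}" "near E {y, x'}" using L_nearD[OF SL True] S(2) * by blast+
      then have "y \<in> E \<or> E = {x, x'}"
        using near_two_pairs[OF L_VD[OF SL True], of y x x'] * by auto
      moreover have "E \<noteq> {x, x'}"
      proof
        assume "E = {x, x'}"
        then have "triangle y x x' \<subseteq> S" using True S(2) * by (simp add: triangle_def)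
        moreover have "triangle y x x' \<in> T2" using * unfolding T2_def by blast
        ultimately show False using S(1) by (auto simp: L0_def)
      qed
      ultimately show ?thesis by blast
    next
      case False
      then have "E = {y, z}" using E by blast
      then show ?thesis by simp
    qed
  qed
  show ?thesis
    by (intro exI[of _ "{y, z}"] conjI ballI impI n1 n2) (assumption | simp)+
qed

lemma L1_pairs:
  assumes S: "S \<in> L1" and y: "y \<in> Y" and m: "{y, a} \<in> S" "{y, b} \<in> S" and ab: "a \<in> A" "b \<in> A" "y < a" "y < b" "a \<noteq> b"
  shows "a = z \<or> b = z"
proof (rule ccontr)
  assume "\<not> ?thesis"
  then have "a < z" "b < z" using ab z_ge[of a] z_ge[of b] by auto
  then have "{{y, a}, {y, b}} \<in> R1"
  proof (cases "a < b")
    case True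
    then show ?thesis using y ab \<open>b < z\<close> unfolding R1_def by blast
  next
    case False
    then have "b < a" using ab by simp
    then have "{{y, b}, {y, a}} \<in> R1" using y ab \<open>a < z\<close> unfolding R1_def by blast
    then show ?thesis by (simp only: insert_commute)
  qed
  moreover have "\<forall>\<rho>\<in>R1. \<not> \<rho> \<subseteq> S" using S unfolding L1_def by (elim CollectE conjE)
  ultimately have "\<not> {{y, a}, {y, b}} \<subseteq> S" by (metis (no_types))
  then show False using m by simp
qed

text \<open>After stage 1 the exchanges with \<open>y\<close> in such a simplex are only those with
  \<open>x\<close> and \<open>z\<close>. It lies therefore in the triangle on \<open>y\<close>,
  \<open>x\<close>, \<open>z\<close>, which belongs to \<open>L0\<close> and offers
  \<open>{x, z}\<close>; every vertex of a face in \<open>R2\<close> meets \<open>Y\<close>, but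
  \<open>{x, z}\<close> does not.\<close>

lemma stage2:
  assumes \<rho>: "\<rho> \<in> R2"
  shows "\<exists>v. v \<noteq> {} \<and> v \<notin> \<Union>R2 \<and> (\<forall>S\<in>L1. \<rho> \<subseteq> S \<longrightarrow> insert v S \<in> L1)"
proof -
  obtain y x where *: "\<rho> = {{y, x}, {y, z}}" "y \<in> Y" "x \<in> A" "y < x" "x < z"
    using \<rho> unfolding R2_def by blast
  have D: "D \<inter> Y \<noteq> {}" if D: "D \<in> \<Union>R2" for D
  proof -
    obtain u w where "u \<in> Y" "D = {u, w} \<or> D = {u, z}" using D unfolding R2_def by blast
    then show ?thesis by blast
  qed
  have "{x, z} \<inter> Y = {}" using notin_Y[OF z_in] notin_Y[OF *(3)] by simp
  then have n1: "{x, z} \<notin> \<Union>R2" using D by metis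
  have n2: "insert {x, z} S \<in> L1" if S: "S \<in> L1" "\<rho> \<subseteq> S" for S
  proof -
    have SL: "S \<in> L" using S L_chain by blast
    have "E \<in> triangle y x z" if E: "E \<in> S" for E
    proof -
      have "near E {y, x}" "near E {y, z}" using L_nearD[OF SL E] S(2) * by blast+
      then have "y \<in> E \<or> E = {x, z}"
        using near_two_pairs[OF L_VD[OF SL E], of y x z] * by auto
      then show ?thesis
      proof
        assume "y \<in> E"
        then obtain x2 where x2: "x2 \<in> A" "y < x2" "E = {y, x2}"
          using V_with_Y[OF L_VD[OF SL E]] *(2) by blast
        have "x2 = x \<or> x2 = z"
        proof (rule ccontr)
          assume n: "\<not> ?thesis"
          have "x = z \<or> x2 = z"
            by (rule L1_pairs[OF S(1) *(2), of x x2]) (use S(2) * x2 E n in auto)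
          then show False using n * by simp
        qed
        then show ?thesis using x2 by (auto simp: triangle_def)
      qed (simp add: triangle_def)
    qed
    then have "insert {x, z} S \<subseteq> triangle y x z" by (auto simp: triangle_def)
    then have "insert {x, z} S \<in> L0"
      using triangle_z_in_L0[OF *(2-5)] L0_subset by blast
    moreover have "\<not> \<rho>' \<subseteq> insert {x, z} S" if \<rho>': "\<rho>' \<in> R1" for \<rho>'
    proof -
      have "\<not> \<rho>' \<subseteq> S" using S(1) \<rho>' by (simp add: L1_def)
      moreover have "{x, z} \<notin> \<rho>'" using \<rho>' notin_Y[OF z_in] notin_Y[OF *(3)]
        unfolding R1_def by (auto simp: doubleton_eq_iff)
      ultimately show ?thesis by blast
    qed
    ultimately show ?thesis by (simp add: L1_def)
  qed
  show ?thesis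
    by (intro exI[of _ "{x, z}"] conjI ballI impI n1 n2) (assumption | simp)+
qed

lemma L2_pairs:
  assumes S: "S \<in> L2" and y: "y \<in> Y" and m: "{y, a} \<in> S" "{y, b} \<in> S" and ab: "a \<in> A" "b \<in> A" "y < a" "y < b"
  shows "a = b"
proof (rule ccontr)
  assume ne: "a \<noteq> b"
  have "S \<in> L1" using S L_chain by blast
  from L1_pairs[OF this y m ab ne] have "a = z \<or> b = z" .
  then have "{{y, a}, {y, b}} \<in> R2"
  proof
    assume "b = z"
    then have "a < z" using ne z_ge[OF ab(1)] by simp
    then show ?thesis using y ab unfolding R2_def \<open>b = z\<close> by blast
  next
    assume "a = z"
    then have "b < z" using ne z_ge[OF ab(2)] by simp
    then have "{{y, b}, {y, z}} \<in> R2" using y ab unfolding R2_def by blast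
    then show ?thesis unfolding \<open>a = z\<close> by (simp only: insert_commute)
  qed
  moreover have "\<forall>\<rho>\<in>R2. \<not> \<rho> \<subseteq> S" using S unfolding L2_def by (elim CollectE conjE)
  ultimately have "\<not> {{y, a}, {y, b}} \<subseteq> S" by (metis (no_types))
  then show False using m by simp
qed

lemma insert_single_L2:
  assumes "S \<in> L2" "x \<in> A" "\<And>E. E \<in> S \<Longrightarrow> near {x} E"
  shows "insert {x} S \<in> L2"
proof -
  have "insert {x} S \<in> L0" using insert_single_L0 assms L_chain by blast
  moreover have "\<not> \<rho> \<subseteq> insert {x} S" if "\<rho> \<in> R1 \<union> R2" for \<rho>
  proof -
    have "{x} \<notin> \<rho>" using single_notin_R that by blast
    moreover have "\<not> \<rho> \<subseteq> S" using that assms(1) by (auto simp: L2_def L1_def)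
    ultimately show ?thesis by blast
  qed
  ultimately show ?thesis by (simp add: L1_def L2_def)
qed

lemma insert_single_L3:
  assumes "S \<in> L3" "x \<in> A" "\<And>E. E \<in> S \<Longrightarrow> near {x} E"
  shows "insert {x} S \<in> L3"
proof -
  have "insert {x} S \<in> L2" using insert_single_L2 assms L_chain by blast
  moreover have "\<not> \<rho> \<subseteq> insert {x} S" if "\<rho> \<in> R3" for \<rho>
  proof -
    have "{x} \<notin> \<rho>" using single_notin_R that by blast
    moreover have "\<not> \<rho> \<subseteq> S" using that assms(1) by (simp add: L3_def)
    ultimately show ?thesis by blast
  qed
  ultimately show ?thesis by (simp add: L3_def)
qed

lemma insert_single_L5:
  assumes "S \<in> L5" "x \<in> A" "\<And>E. E \<in> S \<Longrightarrow> near {x} E"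
  shows "insert {x} S \<in> L5"
proof -
  have "insert {x} S \<in> L3" using insert_single_L3 assms L_chain by blast
  moreover have "\<not> \<rho> \<subseteq> insert {x} S" if "\<rho> \<in> R4 \<union> R5" for \<rho>
  proof -
    have "{x} \<notin> \<rho>" using single_notin_R that by blast
    moreover have "\<not> \<rho> \<subseteq> S" using that assms(1) by (auto simp: L5_def L4_def)
    ultimately show ?thesis by blast
  qed
  ultimately show ?thesis by (simp add: L4_def L5_def)
qed

lemma insert_single_L4:
  assumes "S \<in> L4" "x \<in> A" "\<And>E. E \<in> S \<Longrightarrow> near {x} E"
  shows "insert {x} S \<in> L4"
proof -
  have "insert {x} S \<in> L3" using insert_single_L3 assms L_chain by blast
  moreover have "\<not> \<rho> \<subseteq> insert {x} S" if "\<rho> \<in> R4" for \<rho>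
  proof -
    have "{x} \<notin> \<rho>" using single_notin_R that by blast
    moreover have "\<not> \<rho> \<subseteq> S" using that assms(1) by (simp add: L4_def)
    ultimately show ?thesis by blast
  qed
  ultimately show ?thesis by (simp add: L4_def)
qed

lemma single_notin_Union_R: "{x} \<notin> \<Union>R1" "{x} \<notin> \<Union>R2" "{x} \<notin> \<Union>R3" "{x} \<notin> \<Union>R4" "{x} \<notin> \<Union>R5"
  using single_notin_R by blast+

lemma near_single_if_mem:
  assumes "x \<in> A" "E \<in> V" "x \<in> E"
  shows "near {x} E"
  using V_common_near[OF single_V assms(2) _ assms(3)] assms(1) by blast

lemma near_pair_cases:
  assumes "E \<in> V" "near E {y, x}" "y \<noteq> x"
  shows "y \<in> E \<or> x \<in> E"
  using assms(1)
proof (cases rule: V_cases)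
  case (single a)
  then show ?thesis using assms by (auto simp: near_singleton_pair)
next
  case (pair w a)
  then have "{w, a} \<inter> {y, x} \<noteq> {}" using assms near_pairs by metis
  then show ?thesis using pair by blast
qed

text \<open>A simplex now has at most one exchange involving \<open>y\<close>, so every vertex of a
  simplex through \<open>{y, x}\<close> contains \<open>x\<close>, and \<open>{x}\<close> can be
  added.\<close>

lemma stage3:
  assumes \<rho>: "\<rho> \<in> R3"
  shows "\<exists>v. v \<noteq> {} \<and> v \<notin> \<Union>R3 \<and> (\<forall>S\<in>L2. \<rho> \<subseteq> S \<longrightarrow> insert v S \<in> L2)"
proof -
  obtain y x where *: "\<rho> = {{y, x}}" "y \<in> Y" "x \<in> A" "y < x"
    using \<rho> unfolding R3_def by blast
  have n2: "insert {x} S \<in> L2" if S: "S \<in> L2" "\<rho> \<subseteq> S" for S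
  proof (rule insert_single_L2[OF S(1) *(3)])
    fix E assume E: "E \<in> S"
    have SL: "S \<in> L" using S L_chain by blast
    have "near E {y, x}" using L_nearD[OF SL E] S(2) * by blast
    then have "y \<in> E \<or> x \<in> E" using near_pair_cases[OF L_VD[OF SL E]] * by auto
    moreover have "x \<in> E" if yE: "y \<in> E"
    proof -
      obtain x2 where x2: "x2 \<in> A" "y < x2" "E = {y, x2}"
        using V_with_Y[OF L_VD[OF SL E] yE *(2)] by blast
      have "x = x2" by (rule L2_pairs[OF S(1) *(2)]) (use S(2) * x2 E in auto)
      then show ?thesis using x2 by blast
    qed
    ultimately show "near {x} E" using near_single_if_mem[OF *(3) L_VD[OF SL E]] by blast
  qed
  show ?thesis
    by (intro exI[of _ "{x}"] conjI ballI impI single_notin_Union_R(3) n2) (assumption | simp)+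
qed

lemma L3_cases:
  assumes "S \<in> L3" "E \<in> S"
  obtains (single) x where "x \<in> A" "E = {x}" | (pair) w x where "w \<in> A" "x \<in> A" "w \<noteq> x" "E = {w, x}"
proof -
  have "E \<in> V" using assms L_chain L_VD by blast
  then show thesis
  proof (cases rule: V_cases)
    case (single x)
    then show ?thesis using that by blast
  next
    case (pair w x)
    have "w \<in> A"
    proof (rule ccontr)
      assume "w \<notin> A"
      then have "{E} \<in> R3" using pair unfolding R3_def by blast
      then show False using assms by (auto simp: L3_def)
    qed
    then show ?thesis using pair that by blast
  qed
qed

text \<open>The triangle on \<open>x\<close>, \<open>a\<close>, \<open>b\<close> is in
  \<open>T1\<close> and hence absent, which leaves only a star at \<open>x\<close>; all its vertices
  are adjacent to \<open>{x}\<close>.\<close>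

lemma stage4:
  assumes \<rho>: "\<rho> \<in> R4"
  shows "\<exists>v. v \<noteq> {} \<and> v \<notin> \<Union>R4 \<and> (\<forall>S\<in>L3. \<rho> \<subseteq> S \<longrightarrow> insert v S \<in> L3)"
proof -
  obtain x a b where *: "\<rho> = {{x, a}, {x, b}}" "x \<in> A" "a \<in> A" "b \<in> A" "x \<noteq> a" "x \<noteq> b" "a \<noteq> b"
    using \<rho> unfolding R4_def by blast
  have T: "triangle x a b \<in> T1"
  proof -
    have T1I: "triangle u v w \<in> T1" if "u \<in> A" "v \<in> A" "w \<in> A" "u < v" "v < w" for u v w
      using that unfolding T1_def by blast
    consider "x < a" "a < b" | "x < b" "b < a" | "a < x" "x < b" | "a < b" "b < x" | "b < x" "x < a" | "b < a" "a < x"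
      using * by (metis nat_neq_iff)
    then show ?thesis
      by cases (use T1I * triangle_commute in metis)+
  qed
  have n2: "insert {x} S \<in> L3" if S: "S \<in> L3" "\<rho> \<subseteq> S" for S
  proof (rule insert_single_L3[OF S(1) *(2)])
    fix E assume E: "E \<in> S"
    have SL: "S \<in> L" and S0: "S \<in> L0" using S L_chain by blast+
    have "near E {x, a}" "near E {x, b}" using L_nearD[OF SL E] S(2) * by blast+
    then have "x \<in> E \<or> E = {a, b}" using near_two_pairs[OF L_VD[OF SL E]] * by blast
    moreover have "E \<noteq> {a, b}"
    proof
      assume "E = {a, b}"
      then have "triangle x a b \<subseteq> S" using E S(2) * by (simp add: triangle_def)
      then show False using S0 T by (auto simp: L0_def)
    qed
    ultimately show "near {x} E" using near_single_if_mem[OF *(2) L_VD[OF SL E]] by blast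
  qed
  show ?thesis
    by (intro exI[of _ "{x}"] conjI ballI impI single_notin_Union_R(4) n2) (assumption | simp)+
qed

text \<open>Adjacent pairs meet, but two pairs with a common element were excluded by stage 4.
  Besides \<open>{x, a}\<close> the simplex has only singletons, all adjacent to
  \<open>{x}\<close>.\<close>

lemma stage5:
  assumes \<rho>: "\<rho> \<in> R5"
  shows "\<exists>v. v \<noteq> {} \<and> v \<notin> \<Union>R5 \<and> (\<forall>S\<in>L4. \<rho> \<subseteq> S \<longrightarrow> insert v S \<in> L4)"
proof -
  obtain x a where *: "\<rho> = {{x, a}}" "x \<in> A" "a \<in> A" "x \<noteq> a"
    using \<rho> unfolding R5_def by blast
  have n2: "insert {x} S \<in> L4" if S: "S \<in> L4" "\<rho> \<subseteq> S" for S
  proof (rule insert_single_L4[OF S(1) *(2)])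
    fix E assume E: "E \<in> S"
    have SL: "S \<in> L" and S3: "S \<in> L3" using S L_chain by blast+
    have m: "{x, a} \<in> S" using S(2) * by blast
    have n: "near E {x, a}" using L_nearD[OF SL E m] .
    from S3 E show "near {x} E"
    proof (cases rule: L3_cases)
      case (single b)
      then show ?thesis by (simp add: near_singletons)
    next
      case (pair w b)
      have "x \<in> E"
      proof (rule ccontr)
        assume x: "x \<notin> E"
        then have "a \<in> E" using near_pair_cases[OF L_VD[OF SL E] n *(4)] by blast
        then obtain c where c: "c \<in> A" "c \<noteq> a" "E = {a, c}" using pair by blast
        then have "{{a, x}, {a, c}} \<in> R4" using * x unfolding R4_def by blast
        moreover have "{{a, x}, {a, c}} \<subseteq> S" using m E c by (simp add: insert_commute)
        moreover have "\<forall>\<rho>\<in>R4. \<not> \<rho> \<subseteq> S" using S(1) unfolding L4_def by (elim CollectE conjE)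
        ultimately show False by (metis (no_types))
      qed
      then show ?thesis using near_single_if_mem[OF *(2) L_VD[OF SL E]] by blast
    qed
  qed
  show ?thesis
    by (intro exI[of _ "{x}"] conjI ballI impI single_notin_Union_R(5) n2) (assumption | simp)+
qed

text \<open>Only singletons remain as vertices, so \<open>{z}\<close> fits into every simplex. Then
  even the empty face of the link is free, and the apex can be removed.\<close>

lemma stage6: "\<exists>v. v \<noteq> {} \<and> v \<notin> \<Union>{{}} \<and> (\<forall>S\<in>L5. {} \<subseteq> S \<longrightarrow> insert v S \<in> L5)"
proof -
  have "insert {z} S \<in> L5" if S: "S \<in> L5" for S
  proof (rule insert_single_L5[OF S z_in])
    fix E assume E: "E \<in> S"
    have "S \<in> L3" using S L_chain by blast
    then show "near {z} E" using E
    proof (cases rule: L3_cases)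
      case (single b)
      then show ?thesis by (simp add: near_singletons)
    next
      case (pair w b)
      then have "{E} \<in> R5" unfolding R5_def by blast
      then show ?thesis using S E by (auto simp: L5_def)
    qed
  qed
  then show ?thesis by blast
qed

lemma cplx_L0_equivalent: "geometric_realization (cplx L0) homotopy_equivalent_space geometric_realization VG"
proof -
  have sub: "L5 \<subseteq> L" "L4 \<subseteq> L" "L3 \<subseteq> L" "L2 \<subseteq> L" "L1 \<subseteq> L" "L0 \<subseteq> L"
    using L_chain by blast+
  have ne: "\<rho> \<in> R1 \<Longrightarrow> {} \<notin> \<rho>" "\<rho> \<in> R2 \<Longrightarrow> {} \<notin> \<rho>" "\<rho> \<in> R3 \<Longrightarrow> {} \<notin> \<rho>"
    "\<rho> \<in> R4 \<Longrightarrow> {} \<notin> \<rho>" "\<rho> \<in> R5 \<Longrightarrow> {} \<notin> \<rho>" for \<rho>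
    using R_nonempty_vertices[of \<rho>] by blast+
  have c1: "finite_complex (cplx L1)" "geometric_realization (cplx L0) homotopy_equivalent_space geometric_realization (cplx L1)"
    by (rule cplx_collapse[OF cplx_L0_complex sub(6) R_finite(1) ne(1) stage1 L1_def]; assumption)+
  have c2: "finite_complex (cplx L2)" "geometric_realization (cplx L1) homotopy_equivalent_space geometric_realization (cplx L2)"
    by (rule cplx_collapse[OF c1(1) sub(5) R_finite(2) ne(2) stage2 L2_def]; assumption)+
  have c3: "finite_complex (cplx L3)" "geometric_realization (cplx L2) homotopy_equivalent_space geometric_realization (cplx L3)"
    by (rule cplx_collapse[OF c2(1) sub(4) R_finite(3) ne(3) stage3 L3_def]; assumption)+
  have c4: "finite_complex (cplx L4)" "geometric_realization (cplx L3) homotopy_equivalent_space geometric_realization (cplx L4)"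
    by (rule cplx_collapse[OF c3(1) sub(3) R_finite(4) ne(4) stage4 L4_def]; assumption)+
  have c5: "finite_complex (cplx L5)" "geometric_realization (cplx L4) homotopy_equivalent_space geometric_realization (cplx L5)"
    by (rule cplx_collapse[OF c4(1) sub(2) R_finite(5) ne(5) stage5 L5_def]; assumption)+
  \<comment> \<open>The face \<open>\<rho> = {}\<close> is contained in every member of
    \<open>L5\<close>, so nothing of the cone survives; \<open>cplx {}\<close> is
    \<open>VG\<close>.\<close>
  have "geometric_realization (cplx L5) homotopy_equivalent_space geometric_realization (cplx {})"
    by (rule cplx_collapse(2)[OF c5(1) sub(1), of "{{}}"]) (use stage6 in auto)
  then show ?thesis
    using c1(2) c2(2) c3(2) c4(2) c5(2) homotopy_eqv_trans by (metis cplx_def image_empty sup_bot_right)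
qed

end

section \<open>Filling the boundaries of the removed simplices\<close>

lemma near_pair_singleton: "u \<noteq> w \<Longrightarrow> near {u, w} {x} \<longleftrightarrow> x \<in> {u, w}"
  using near_singleton_pair[of u w x] near_commute[of "{u, w}" "{x}"] by simp

context cube_link
begin

lemma four_in_VG:
  assumes "{t, a, b, c} \<subseteq> G" "near t a" "near t b" "near t c" "near a b" "near b c" "near a c"
  shows "{t, a, b, c} \<in> VG"
  using assms near_commute unfolding mem_vietoris_rips_2 by auto

lemma three_in_L:
  assumes "{a, b, c} \<subseteq> V" "near a b" "near b c" "near a c"
  shows "{a, b, c} \<in> L"
  using assms near_commute unfolding L_def by auto

lemma card_T:
  assumes "\<tau> \<in> T1 \<union> T2"
  shows "card \<tau> = 3" "{} \<notin> \<tau>"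
proof -
  from assms show "card \<tau> = 3"
    by (cases rule: T_cases) (auto intro: card_triangle)
  show "{} \<notin> \<tau>" using assms T_in_L L_VD V_nonempty by blast
qed

lemma single_three_in_L0:
  assumes "{a, b, c} \<in> L" "{x} \<in> {a, b, c}"
  shows "{a, b, c} \<in> L0"
proof -
  have "\<not> \<tau> \<subseteq> {a, b, c}" if \<tau>: "\<tau> \<in> T1 \<union> T2" for \<tau>
  proof
    assume "\<tau> \<subseteq> {a, b, c}"
    then have "\<tau> = {a, b, c}" using T_maximal[OF \<tau> assms(1)] by simp
    then have "{x} \<in> \<tau>" using assms(2) by simp
    then show False using T_pairs[OF \<tau>] by blast
  qed
  then show ?thesis using assms(1) by (simp add: L0_def)
qed

text \<open>The antipodes of \<open>{u, v}\<close>, \<open>{v, w}\<close>, \<open>{u, w}\<close> are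
  \<open>{w}\<close>, \<open>{u}\<close>, \<open>{v}\<close>, and the apex \<open>{u, v, w}\<close>
  is near all six. Each of the seven other faces contains a singleton and so lies in
  \<open>L0\<close>.\<close>

lemma fillable_T1:
  assumes "\<tau> \<in> T1"
  shows "fillable (cplx L0) (insert {} \<tau>)"
proof -
  obtain u v w where \<tau>: "\<tau> = triangle u v w" and A: "u \<in> A" "v \<in> A" "w \<in> A" and lt: "u < v" "v < w"
    using assms unfolding T1_def by blast
  let ?t = "{u, v, w}"
  have ne: "u \<noteq> v" "v \<noteq> w" "u \<noteq> w" "v \<noteq> u" "w \<noteq> v" "w \<noteq> u" using lt by auto
  have V: "{u, v} \<in> V" "{v, w} \<in> V" "{u, w} \<in> V" "{u} \<in> V" "{v} \<in> V" "{w} \<in> V"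
    using pair_V(1)[of v u] pair_V(1)[of w v] pair_V(1)[of w u] single_V A ne by simp_all
  have tG: "?t \<in> G" using triple_G A lt by blast
  have VsubG: "V \<subseteq> G" by (auto simp: V_def)
  have ct: "card ?t = 3" using ne by simp
  have nt: "near ?t D" if "D \<in> {{u, v}, {v, w}, {u, w}, {u}, {v}, {w}}" for D
  proof -
    from that have "D = {u, v} \<or> D = {v, w} \<or> D = {u, w} \<or> D = {u} \<or> D = {v} \<or> D = {w}"
      by (simp only: insert_iff empty_iff simp_thms)
    then have "D \<subseteq> ?t \<and> 1 \<le> card D" by (elim disjE) (simp_all add: ne)
    then have "near D ?t" using ct by (intro near_subset) simp_all
    then show ?thesis by (simp only: near_commute)
  qed
  have n: "near {u, v} {v, w}" "near {v, w} {u, w}" "near {u, v} {u, w}"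
    "near {u, v} {u}" "near {u, v} {v}" "near {w} {v, w}" "near {w} {u, w}" "near {w} {u}" "near {w} {v}"
    "near {u} {u, w}" "near {u} {v}" "near {v, w} {v}"
    using ne by (simp_all add: near_pairs near_singletons near_singleton_pair near_pair_singleton)
  have "fillable (cplx L0) {{}, {u, v}, {v, w}, {u, w}}"
  proof (rule octahedron_fillable[OF cplx_L0_complex, of _ ?t _ _ _ "{w}" "{u}" "{v}"])
    have big: "?t \<noteq> D" if "card D \<le> 2" for D using that ct by auto
    have t2: "?t \<noteq> {p, q}" for p q by (rule big) (simp add: card_insert_if)
    have t1: "?t \<noteq> {p}" for p by (rule big) simp
    have pq: "{p, q} \<noteq> {r}" if "p \<noteq> q" for p q r :: nat using that by (metis insertCI singletonD)
    show "distinct [{}, ?t, {u, v}, {v, w}, {u, w}, {w}, {u}, {v}]"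
      using ne t1 t2 pq by (simp add: doubleton_eq_iff)
    fix a b c assume abc: "a \<in> {{u, v}, {w}}" "b \<in> {{v, w}, {u}}" "c \<in> {{u, w}, {v}}"
    have nabc: "near a b" "near b c" "near a c"
      using abc n by (elim insertE emptyE; simp)+
    have sub: "{a, b, c} \<subseteq> V" using abc V by (elim insertE emptyE) simp_all
    have "{?t, a, b, c} \<in> VG"
    proof (rule four_in_VG)
      show "{?t, a, b, c} \<subseteq> G" using subset_trans[OF sub VsubG] tG by simp
      show "near ?t a" "near ?t b" "near ?t c" by (rule nt; use abc in auto)+
    qed (rule nabc)+
    then show "{?t, a, b, c} \<in> cplx L0" by (simp add: cplx_def)
    assume "(a, b, c) \<noteq> ({u, v}, {v, w}, {u, w})"
    then have "{w} \<in> {a, b, c} \<or> {u} \<in> {a, b, c} \<or> {v} \<in> {a, b, c}" using abc by auto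
    moreover have "{a, b, c} \<in> L" by (rule three_in_L[OF sub nabc])
    ultimately have "{a, b, c} \<in> L0" using single_three_in_L0 by blast
    then show "{{}, a, b, c} \<in> cplx L0" by (simp add: cplx_def)
  qed
  then show ?thesis by (simp add: \<tau> triangle_def)
qed

text \<open>Here the antipodes are \<open>{w, z}\<close>, \<open>{u, z}\<close>,
  \<open>{v, z}\<close> and the second apex is \<open>{u, v, w, z}\<close>. Of the seven faces, four
  are stars at \<open>u\<close>, \<open>v\<close>, \<open>w\<close> and \<open>z\<close>, and two
  are surviving triangles on \<open>u\<close> and \<open>z\<close>. The last, on \<open>v\<close>,
  \<open>w\<close>, \<open>z\<close>, is in \<open>T1\<close>, whose simplices must therefore be
  present already.\<close>

lemma fillable_T2:
  assumes "\<tau> \<in> T2" and K: "finite_complex (cplx L0 \<union> insert {} ` T1)"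
  shows "fillable (cplx L0 \<union> insert {} ` T1) (insert {} \<tau>)"
proof -
  let ?K = "cplx L0 \<union> insert {} ` T1"
  obtain u v w where \<tau>: "\<tau> = triangle u v w" and A: "u \<in> Y" "v \<in> A" "w \<in> A" and lt: "u < v" "v < w" "w < z"
    using assms unfolding T2_def by blast
  let ?t = "{u, v, w, z}"
  have ne: "u \<noteq> v" "v \<noteq> w" "u \<noteq> w" "v \<noteq> u" "w \<noteq> v" "w \<noteq> u" "u \<noteq> z" "v \<noteq> z" "w \<noteq> z" "z \<noteq> u" "z \<noteq> v" "z \<noteq> w"
    using lt by auto
  have V: "{u, v} \<in> V" "{v, w} \<in> V" "{u, w} \<in> V" "{w, z} \<in> V" "{u, z} \<in> V" "{v, z} \<in> V"
    using pair_V(1)[of v u] pair_V(1)[of w v] pair_V(1)[of w u] pair_V(1)[of z w] pair_V(1)[of z u] pair_V(1)[of z v]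
      A lt z_in ne by simp_all
  have tG: "?t \<in> G" using quadruple_G A lt by blast
  have VsubG: "V \<subseteq> G" by (auto simp: V_def)
  have ct: "card ?t = 4" using ne by simp
  have nt: "near ?t D" if "D \<in> {{u, v}, {v, w}, {u, w}, {w, z}, {u, z}, {v, z}}" for D
  proof -
    from that have "D = {u, v} \<or> D = {v, w} \<or> D = {u, w} \<or> D = {w, z} \<or> D = {u, z} \<or> D = {v, z}"
      by (simp only: insert_iff empty_iff simp_thms)
    then have "D \<subseteq> ?t \<and> card D = 2" by (elim disjE) (simp_all add: ne)
    then have "near D ?t" using ct by (intro near_subset) simp_all
    then show ?thesis by (simp only: near_commute)
  qed
  have n: "near {u, v} {v, w}" "near {v, w} {u, w}" "near {u, v} {u, w}"
    "near {u, v} {u, z}" "near {u, v} {v, z}" "near {w, z} {v, w}" "near {w, z} {u, w}" "near {w, z} {u, z}" "near {w, z} {v, z}"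
    "near {u, z} {u, w}" "near {u, z} {v, z}" "near {v, w} {v, z}"
    using ne by (simp_all add: near_pairs)
  have "fillable ?K {{}, {u, v}, {v, w}, {u, w}}"
  proof (rule octahedron_fillable[OF K, of _ ?t _ _ _ "{w, z}" "{u, z}" "{v, z}"])
    have big: "?t \<noteq> D" if "card D \<le> 2" for D using that ct by auto
    have "?t \<noteq> {p, q}" for p q by (rule big) (simp add: card_insert_if)
    then show "distinct [{}, ?t, {u, v}, {v, w}, {u, w}, {w, z}, {u, z}, {v, z}]"
      using ne by (simp add: doubleton_eq_iff)
    fix a b c assume "a \<in> {{u, v}, {w, z}}" "b \<in> {{v, w}, {u, z}}" "c \<in> {{u, w}, {v, z}}"
    then have abc: "a = {u, v} \<or> a = {w, z}" "b = {v, w} \<or> b = {u, z}" "c = {u, w} \<or> c = {v, z}"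
      by (simp_all only: insert_iff empty_iff simp_thms)
    have nabc: "near a b" "near b c" "near a c"
      using abc n by (elim disjE; simp)+
    have sub: "{a, b, c} \<subseteq> V" using abc V by (elim disjE) simp_all
    have nt6: "near ?t {u, v}" "near ?t {v, w}" "near ?t {u, w}" "near ?t {w, z}" "near ?t {u, z}" "near ?t {v, z}"
      by (rule nt, simp only: insert_iff simp_thms)+
    have "{?t, a, b, c} \<in> VG"
    proof (rule four_in_VG)
      show "{?t, a, b, c} \<subseteq> G" using subset_trans[OF sub VsubG] tG by simp
      show "near ?t a" using abc(1) nt6 by (elim disjE) simp_all
      show "near ?t b" using abc(2) nt6 by (elim disjE) simp_all
      show "near ?t c" using abc(3) nt6 by (elim disjE) simp_all
    qed (rule nabc)+
    then show "{?t, a, b, c} \<in> ?K" by (simp add: cplx_def)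
    assume ne': "(a, b, c) \<noteq> ({u, v}, {v, w}, {u, w})"
    have com: "{a, b, c} \<in> L0" if "x \<in> a" "x \<in> b" "x \<in> c" "{a, b, c} \<subseteq> V" for a b c x
      by (rule common_element_L0[OF that(4), of x]) (use that in auto)
    have f1: "{{u, v}, {v, w}, {v, z}} \<in> L0" by (rule com[of v]) (simp_all add: V)
    have f2: "{{u, v}, {u, z}, {u, w}} \<in> L0" by (rule com[of u]) (simp_all add: V)
    have f3: "{{w, z}, {v, w}, {u, w}} \<in> L0" by (rule com[of w]) (simp_all add: V)
    have f4: "{{w, z}, {u, z}, {v, z}} \<in> L0" by (rule com[of z]) (simp_all add: V)
    have "triangle u v z = {{u, v}, {u, z}, {v, z}}" by (simp add: triangle_def insert_commute)
    then have f5: "{{u, v}, {u, z}, {v, z}} \<in> L0"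
      using triangle_z_in_L0[OF A(1,2) lt(1)] lt by simp
    have "triangle u w z = {{w, z}, {u, z}, {u, w}}" by (simp add: triangle_def insert_commute)
    then have f6: "{{w, z}, {u, z}, {u, w}} \<in> L0"
      using triangle_z_in_L0[OF A(1,3)] lt by simp
    have "triangle v w z = {{w, z}, {v, w}, {v, z}}" by (simp add: triangle_def insert_commute)
    moreover have "triangle v w z \<in> T1" using A lt z_in unfolding T1_def by blast
    ultimately have f7: "{{w, z}, {v, w}, {v, z}} \<in> T1" by simp
    have "{a, b, c} \<in> L0 \<or> {a, b, c} \<in> T1"
      using abc ne' f1 f2 f3 f4 f5 f6 f7 by (elim disjE) simp_all
    then show "{{}, a, b, c} \<in> ?K" by (auto simp: cplx_def)
  qed
  then show ?thesis by (simp add: \<tau> triangle_def)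
qed

lemma T_disjoint: "T1 \<inter> T2 = {}"
proof -
  have 1: "\<Union>\<tau> \<subseteq> A" if "\<tau> \<in> T1" for \<tau>
    using that unfolding T1_def by (auto simp: triangle_def)
  have 2: "\<Union>\<tau> \<inter> Y \<noteq> {}" if \<tau>: "\<tau> \<in> T2" for \<tau>
  proof -
    obtain u v w where "\<tau> = triangle u v w" "u \<in> Y" using \<tau> unfolding T2_def by blast
    then show ?thesis using Union_triangle[of u v w] by auto
  qed
  have "\<tau> \<notin> T2" if "\<tau> \<in> T1" for \<tau>
    using 1[OF that] 2[of \<tau>] disjoint by auto
  then show ?thesis by auto
qed

lemma finite_T: "finite T1" "finite T2"
  using T_in_L L_VD by (auto intro!: finite_subset[OF _ iffD2[OF finite_Pow_iff finite_V]])

lemma insert_empty_T: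
  assumes "T \<subseteq> T1 \<union> T2"
  shows "card (insert {} ` T) = card T"
    and "\<And>\<sigma>. \<sigma> \<in> insert {} ` T \<Longrightarrow> card \<sigma> = 4"
    and "\<And>\<sigma>. \<sigma> \<in> insert {} ` T \<Longrightarrow> \<sigma> \<notin> cplx L0"
proof -
  have e: "{} \<notin> \<tau>" "card \<tau> = 3" if "\<tau> \<in> T" for \<tau>
    using card_T that assms by blast+
  have "inj_on (insert {}) T"
    by (rule inj_onI) (metis e(1) Diff_insert_absorb)
  then show "card (insert {} ` T) = card T" by (rule card_image)
  fix \<sigma> assume "\<sigma> \<in> insert {} ` T"
  then obtain \<tau> where \<tau>: "\<tau> \<in> T" "\<sigma> = insert {} \<tau>" by blast
  have "finite \<tau>" using e(2)[OF \<tau>(1)] by (metis card.infinite zero_neq_numeral)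
  then show "card \<sigma> = 4" using e[OF \<tau>(1)] \<tau>(2) by simp
  show "\<sigma> \<notin> cplx L0"
  proof
    assume "\<sigma> \<in> cplx L0"
    moreover have "\<sigma> \<notin> VG" using \<tau>(2) empty_notin_G by (auto simp: mem_vietoris_rips_2)
    ultimately obtain S where S: "S \<in> L0" "\<sigma> = insert {} S" by (auto simp: cplx_def)
    have "{} \<notin> S" using S(1) V_nonempty by (auto simp: L0_def L_def)
    then have "S = \<tau>" using S(2) \<tau>(2) e(1)[OF \<tau>(1)] by (metis Diff_insert_absorb)
    then show False using S(1) \<tau>(1) assms by (auto simp: L0_def)
  qed
qed

text \<open>The simplices return in two rounds, because the fillings for \<open>T2\<close> run
  through simplices that belong to \<open>T1\<close>.\<close>

theorem attach_link:
  assumes Z: "cell_tower Z N" and N: "N = card T1 + card T2"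
    and eqv: "geometric_realization VG homotopy_equivalent_space Z 0"
  shows "geometric_realization (vietoris_rips symdiff_dist (insert {} G) 2) homotopy_equivalent_space Z N"
proof -
  note i1 = insert_empty_T[of T1, OF Un_upper1] and i2 = insert_empty_T[of T2, OF Un_upper2]
  have e0: "geometric_realization (cplx L0) homotopy_equivalent_space Z 0"
    using cplx_L0_equivalent eqv homotopy_eqv_trans by blast
  have s1: "finite_complex (cplx L0 \<union> insert {} ` T1) \<and>
      geometric_realization (cplx L0 \<union> insert {} ` T1) homotopy_equivalent_space Z (0 + card (insert {} ` T1))"
  proof (rule fillable_attach_family[OF _ cplx_L0_complex Z _ _ e0])
    show "finite (insert {} ` T1)" using finite_T by simp
    show "0 + card (insert {} ` T1) \<le> N" using i1(1) N by simp
    show "\<sigma> \<notin> cplx L0 \<and> card \<sigma> = 4 \<and> fillable (cplx L0) \<sigma>" if "\<sigma> \<in> insert {} ` T1" for \<sigma>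
    proof -
      obtain \<tau> where \<tau>: "\<tau> \<in> T1" "\<sigma> = insert {} \<tau>" using \<open>\<sigma> \<in> insert {} ` T1\<close> by (rule imageE)
      have "fillable (cplx L0) \<sigma>" unfolding \<tau>(2) by (rule fillable_T1[OF \<tau>(1)])
      then show ?thesis using i1(2,3)[OF \<open>\<sigma> \<in> insert {} ` T1\<close>] by simp
    qed
  qed
  have s2: "finite_complex ((cplx L0 \<union> insert {} ` T1) \<union> insert {} ` T2) \<and>
      geometric_realization ((cplx L0 \<union> insert {} ` T1) \<union> insert {} ` T2) homotopy_equivalent_space
        Z (card T1 + card (insert {} ` T2))"
  proof (rule fillable_attach_family[OF _ conjunct1[OF s1] Z])
    show "finite (insert {} ` T2)" using finite_T by simp
    show "card T1 + card (insert {} ` T2) \<le> N" using i2(1) N by simp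
    show "geometric_realization (cplx L0 \<union> insert {} ` T1) homotopy_equivalent_space Z (card T1)"
      using s1 i1(1) by simp
    fix \<sigma> assume \<sigma>: "\<sigma> \<in> insert {} ` T2"
    then obtain \<tau> where \<tau>: "\<tau> \<in> T2" "\<sigma> = insert {} \<tau>" by blast
    have "\<sigma> \<notin> insert {} ` T1"
    proof
      assume "\<sigma> \<in> insert {} ` T1"
      then obtain \<tau>' where \<tau>': "\<tau>' \<in> T1" "\<sigma> = insert {} \<tau>'" by blast
      have "{} \<notin> \<tau>" "{} \<notin> \<tau>'" using card_T(2) \<tau>(1) \<tau>'(1) by simp_all
      then have "\<tau> = \<tau>'" using \<tau>(2) \<tau>'(2) by (metis Diff_insert_absorb)
      then have "\<tau> \<in> T1 \<inter> T2" using \<tau>(1) \<tau>'(1) by simp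
      then show False using T_disjoint by simp
    qed
    moreover have "\<sigma> \<notin> cplx L0" "card \<sigma> = 4" by (rule i2(3)[OF \<sigma>], rule i2(2)[OF \<sigma>])
    moreover have "fillable (cplx L0 \<union> insert {} ` T1) \<sigma>"
      unfolding \<tau>(2) by (rule fillable_T2[OF \<tau>(1) conjunct1[OF s1]])
    ultimately show "\<sigma> \<notin> cplx L0 \<union> insert {} ` T1 \<and> card \<sigma> = 4 \<and> fillable (cplx L0 \<union> insert {} ` T1) \<sigma>"
      by simp
  qed
  have "(cplx L0 \<union> insert {} ` T1) \<union> insert {} ` T2 = cplx L"
    unfolding L_eq cplx_def by (simp only: image_Un Un_assoc)
  then show ?thesis using conjunct2[OF s2] unfolding i2(1) N cplx_L by (simp only:)
qed

end

section \<open>The order on sets\<close>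

lemma nth_sorted_less:
  assumes "finite A" "j < k" "k < card A"
  shows "sorted_list_of_set A ! j < sorted_list_of_set A ! k"
  using strict_sorted_list_of_set[of A] assms by (simp add: sorted_wrt_nth_less)

lemma nth_sorted_le:
  assumes "finite A" "j \<le> k" "k < card A"
  shows "sorted_list_of_set A ! j \<le> sorted_list_of_set A ! k"
  using nth_sorted_less[OF assms(1), of j k] assms by (cases "j = k") auto

lemma nth_sorted_mem:
  assumes "finite A" "k < card A"
  shows "sorted_list_of_set A ! k \<in> A"
  using assms by (metis length_sorted_list_of_set nth_mem set_sorted_list_of_set)

lemma nth_sorted_obtain:
  assumes "finite A" "x \<in> A"
  obtains k where "k < card A" "x = sorted_list_of_set A ! k"
  using assms by (metis in_set_conv_nth length_sorted_list_of_set set_sorted_list_of_set)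

text \<open>An element below the entry of \<open>A\<close> at position \<open>k\<close> sits at an
  earlier position, where the lists agree. This holds for elements of \<open>B\<close> too, because
  the entry of \<open>B\<close> at position \<open>k\<close> is larger; in particular the entry of
  \<open>A\<close> cannot lie in \<open>B\<close>.\<close>

lemma first_difference_witness:
  assumes fin: "finite A" "finite B" and card: "card A = card B" and k: "k < card A"
    and less: "sorted_list_of_set A ! k < sorted_list_of_set B ! k"
    and eq: "\<And>l. l < k \<Longrightarrow> sorted_list_of_set A ! l = sorted_list_of_set B ! l"
  shows "\<exists>e\<in>A. e \<notin> B \<and> (\<forall>d<e. d \<in> A \<longleftrightarrow> d \<in> B)"
proof -
  let ?a = "\<lambda>i. sorted_list_of_set A ! i" and ?b = "\<lambda>i. sorted_list_of_set B ! i"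
  have below_A: "\<exists>l<k. d = ?a l" if "d \<in> A" "d < ?a k" for d
  proof -
    obtain l where l: "l < card A" "d = ?a l" using nth_sorted_obtain[OF fin(1) \<open>d \<in> A\<close>] .
    then have "l < k" using nth_sorted_le[OF fin(1), of k l] \<open>d < ?a k\<close> by (metis not_le)
    then show ?thesis using l by blast
  qed
  have below_B: "\<exists>l<k. d = ?b l" if "d \<in> B" "d < ?b k" for d
  proof -
    obtain l where l: "l < card B" "d = ?b l" using nth_sorted_obtain[OF fin(2) \<open>d \<in> B\<close>] .
    then have "l < k" using nth_sorted_le[OF fin(2), of k l] \<open>d < ?b k\<close> by (metis not_le)
    then show ?thesis using l by blast
  qed
  have mem: "?a l \<in> A" "?b l \<in> B" if "l \<le> k" for l
    using nth_sorted_mem fin card k that by (metis le_less_trans)+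
  have "?a k \<notin> B"
  proof
    assume "?a k \<in> B"
    then obtain l where "l < k" "?a k = ?b l" using below_B less by blast
    then show False using eq[of l] nth_sorted_less[OF fin(1) \<open>l < k\<close> k] by simp
  qed
  moreover have "d \<in> A \<longleftrightarrow> d \<in> B" if d: "d < ?a k" for d
  proof
    assume "d \<in> A"
    then obtain l where "l < k" "d = ?a l" using below_A d by blast
    then show "d \<in> B" using eq[of l] mem(2)[of l] by simp
  next
    assume "d \<in> B"
    then obtain l where "l < k" "d = ?b l" using below_B[of d] d less by (meson less_trans)
    then show "d \<in> A" using eq[of l] mem(1)[of l] by simp
  qed
  ultimately show ?thesis using mem(1)[of k] by blast
qed

text \<open>On sets of equal size this is the lexicographic order, expressed by membership at the
  least difference. Comparing arbitrary distinct sets this way makes asymmetry, transitivity and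
  totality provable without sorted lists.\<close>

definition precedes :: "nat set \<Rightarrow> nat set \<Rightarrow> bool" where
  "precedes A B \<longleftrightarrow> (\<exists>e\<in>A. e \<notin> B \<and> (\<forall>d<e. d \<in> A \<longleftrightarrow> d \<in> B))"

lemma precedes_asym: "precedes A B \<Longrightarrow> \<not> precedes B A"
  unfolding precedes_def by (metis nat_neq_iff)

lemma precedes_trans: "precedes A B \<Longrightarrow> precedes B C \<Longrightarrow> precedes A C"
  unfolding precedes_def by (metis less_trans nat_neq_iff)

lemma precedes_total:
  assumes "A \<noteq> B"
  shows "precedes A B \<or> precedes B A"
proof -
  define e where "e = (LEAST e. (e \<in> A) \<noteq> (e \<in> B))"
  obtain e0 where "(e0 \<in> A) \<noteq> (e0 \<in> B)" using assms by blast
  then have "(e \<in> A) \<noteq> (e \<in> B)" unfolding e_def by (rule LeastI)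
  moreover have "d \<in> A \<longleftrightarrow> d \<in> B" if "d < e" for d
    using that not_less_Least unfolding e_def by blast
  ultimately show ?thesis unfolding precedes_def by blast
qed

lemma set_prec_iff:
  assumes fin: "finite A" "finite B"
  shows "set_prec A B \<longleftrightarrow> card A < card B \<or> (card A = card B \<and> precedes A B)"
proof -
  have lex: "(\<exists>k\<in>{1..card A}. nth_elem A k < nth_elem B k \<and> (\<forall>l\<in>{1..<k}. nth_elem A l = nth_elem B l))
      \<longleftrightarrow> (\<exists>k<card A. sorted_list_of_set A ! k < sorted_list_of_set B ! k \<and>
            (\<forall>l<k. sorted_list_of_set A ! l = sorted_list_of_set B ! l))" for A B
  proof
    assume "\<exists>k\<in>{1..card A}. nth_elem A k < nth_elem B k \<and> (\<forall>l\<in>{1..<k}. nth_elem A l = nth_elem B l)"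
    then obtain k where k: "k \<in> {1..card A}" "nth_elem A k < nth_elem B k"
      "\<And>l. l \<in> {1..<k} \<Longrightarrow> nth_elem A l = nth_elem B l" by blast
    have "sorted_list_of_set A ! l = sorted_list_of_set B ! l" if "l < k - 1" for l
      using k(3)[of "Suc l"] that by (simp add: nth_elem_def)
    moreover have "k - 1 < card A" using k(1) by auto
    ultimately show "\<exists>k<card A. sorted_list_of_set A ! k < sorted_list_of_set B ! k \<and>
        (\<forall>l<k. sorted_list_of_set A ! l = sorted_list_of_set B ! l)"
      using k(2) unfolding nth_elem_def by blast
  next
    assume "\<exists>k<card A. sorted_list_of_set A ! k < sorted_list_of_set B ! k \<and>
        (\<forall>l<k. sorted_list_of_set A ! l = sorted_list_of_set B ! l)"
    then obtain k where k: "k < card A" "sorted_list_of_set A ! k < sorted_list_of_set B ! k"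
      "\<And>l. l < k \<Longrightarrow> sorted_list_of_set A ! l = sorted_list_of_set B ! l" by blast
    have "nth_elem A l = nth_elem B l" if "l \<in> {1..<Suc k}" for l
      using k(3)[of "l - 1"] that by (auto simp: nth_elem_def)
    moreover have "Suc k \<in> {1..card A}" using k(1) by simp
    moreover have "nth_elem A (Suc k) < nth_elem B (Suc k)" using k(2) by (simp add: nth_elem_def)
    ultimately show "\<exists>k\<in>{1..card A}. nth_elem A k < nth_elem B k \<and> (\<forall>l\<in>{1..<k}. nth_elem A l = nth_elem B l)"
      by blast
  qed
  have fwd: "precedes A B" if "finite A" "finite B" "card A = card B" and ex: "\<exists>k<card A. sorted_list_of_set A ! k < sorted_list_of_set B ! k \<and>
            (\<forall>l<k. sorted_list_of_set A ! l = sorted_list_of_set B ! l)" for A B :: "nat set"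
  proof -
    obtain k where "k < card A" "sorted_list_of_set A ! k < sorted_list_of_set B ! k"
      "\<And>l. l < k \<Longrightarrow> sorted_list_of_set A ! l = sorted_list_of_set B ! l" using ex by blast
    then show ?thesis unfolding precedes_def by (rule first_difference_witness[OF that(1-3)])
  qed
  have "(\<exists>k<card A. sorted_list_of_set A ! k < sorted_list_of_set B ! k \<and>
            (\<forall>l<k. sorted_list_of_set A ! l = sorted_list_of_set B ! l)) \<longleftrightarrow> precedes A B" if c: "card A = card B"
  proof
    assume p: "precedes A B"
    let ?D = "\<lambda>k. k < card A \<and> sorted_list_of_set A ! k \<noteq> sorted_list_of_set B ! k"
    have "\<exists>k. ?D k"
    proof (rule ccontr)
      assume "\<not> ?thesis"
      then have "sorted_list_of_set A = sorted_list_of_set B"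
        using c by (intro nth_equalityI) auto
      then have "A = B" using fin set_sorted_list_of_set by metis
      then show False using p precedes_asym by blast
    qed
    define k where "k = (LEAST k. ?D k)"
    have k: "?D k" unfolding k_def using \<open>\<exists>k. ?D k\<close> by (rule LeastI_ex)
    have eq: "sorted_list_of_set A ! l = sorted_list_of_set B ! l" if "l < k" for l
    proof -
      have "\<not> ?D l" using that unfolding k_def by (rule not_less_Least)
      then show ?thesis using that k by simp
    qed
    \<comment> \<open>If the first difference went the other way, the direction already shown would
      give \<open>precedes B A\<close>.\<close>
    have "\<not> sorted_list_of_set B ! k < sorted_list_of_set A ! k"
    proof
      assume "sorted_list_of_set B ! k < sorted_list_of_set A ! k"
      then have "precedes B A"
        using k eq c by (intro fwd[OF fin(2) fin(1)]) auto
      then show False using p precedes_asym by blast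
    qed
    then show "\<exists>k<card A. sorted_list_of_set A ! k < sorted_list_of_set B ! k \<and>
        (\<forall>l<k. sorted_list_of_set A ! l = sorted_list_of_set B ! l)"
      using k eq by (meson nat_neq_iff)
  qed (rule fwd[OF fin c])
  then show ?thesis unfolding set_prec_def lex by blast
qed

lemma set_prec_asym: "finite A \<Longrightarrow> finite B \<Longrightarrow> set_prec A B \<Longrightarrow> \<not> set_prec B A"
  using precedes_asym by (auto simp: set_prec_iff)

lemma set_prec_trans:
  "finite A \<Longrightarrow> finite B \<Longrightarrow> finite C \<Longrightarrow> set_prec A B \<Longrightarrow> set_prec B C \<Longrightarrow> set_prec A C"
  using precedes_trans[of A B C] by (auto simp: set_prec_iff)

lemma set_prec_total: "finite A \<Longrightarrow> finite B \<Longrightarrow> A \<noteq> B \<Longrightarrow> set_prec A B \<or> set_prec B A"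
  using precedes_total[of A B] by (auto simp: set_prec_iff)

text \<open>Another three-element \<open>B\<close> before \<open>{1, 2, 3}\<close> would first
  differ from it in an element above 3 and hence contain 1, 2 and 3 as well, which is one element
  too many. The bound \<open>B \<subseteq> {1..m}\<close> excludes a first difference at 0.\<close>

lemma set_preceq_123:
  assumes "B \<subseteq> {1..m}"
  shows "set_preceq {1, 2, 3} B \<longleftrightarrow> 3 \<le> card B" and "set_prec B {1, 2, 3} \<longleftrightarrow> card B < 3"
proof -
  have fin: "finite B" using assms finite_subset by blast
  have p: "precedes {1, 2, 3} B" if c: "card B = 3" "B \<noteq> {1, 2, 3}"
  proof -
    have "\<not> precedes B {1, 2, 3}"
    proof
      assume "precedes B {1, 2, 3}"
      then obtain e where e: "e \<in> B" "e \<notin> {1, 2, 3}" "\<And>d. d < e \<Longrightarrow> d \<in> B \<longleftrightarrow> d \<in> {1, 2, 3}"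
        unfolding precedes_def by blast
      have "1 \<le> e" using e(1) assms by auto
      then have "3 < e" using e(2) by auto
      then have "insert e {1, 2, 3} \<subseteq> B" using e(1) e(3)[of 1] e(3)[of 2] e(3)[of 3] by auto
      then have "card (insert e {1, 2, 3}) \<le> card B" using fin card_mono by blast
      then show False using c e(2) by simp
    qed
    then show ?thesis using precedes_total[of B "{1, 2, 3}"] c by blast
  qed
  have c3: "card {1, 2, 3::nat} = 3" by simp
  have f3: "finite {1, 2, 3::nat}" by simp
  show "set_preceq {1, 2, 3} B \<longleftrightarrow> 3 \<le> card B"
  proof (cases "B = {1, 2, 3}")
    case True
    then show ?thesis unfolding set_preceq_def using c3 by (metis order_refl)
  next
    case False
    then show ?thesis
      unfolding set_preceq_def set_prec_iff[OF f3 fin] c3 using p[OF _ False] by (metis le_eq_less_or_eq)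
  qed
  show "set_prec B {1, 2, 3} \<longleftrightarrow> card B < 3"
  proof (cases "B = {1, 2, 3}")
    case True
    then show ?thesis unfolding set_prec_iff[OF fin f3] c3 using precedes_asym[of B B] c3 by (metis less_irrefl)
  next
    case False
    then show ?thesis
      unfolding set_prec_iff[OF fin f3] c3 using p[OF _ False] precedes_asym by metis
  qed
qed

subsection \<open>Counting the cells\<close>

lemma card_3_sorted:
  assumes "card S = 3"
  obtains u v w :: nat where "S = {u, v, w}" "u < v" "v < w"
proof -
  have fin: "finite S" using assms by (metis card.infinite zero_neq_numeral)
  let ?a = "\<lambda>i. sorted_list_of_set S ! i"
  have lt: "?a 0 < ?a 1" "?a 1 < ?a 2" using nth_sorted_less[OF fin, of 0 1] nth_sorted_less[OF fin, of 1 2] assms by simp_all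
  have "{?a 0, ?a 1, ?a 2} \<subseteq> S" using nth_sorted_mem[OF fin] assms by simp
  moreover have "card {?a 0, ?a 1, ?a 2} = card S" using lt assms by simp
  ultimately have "{?a 0, ?a 1, ?a 2} = S" using fin card_subset_eq by blast
  then show thesis using lt that by metis
qed

lemma triangle_eq_pairs:
  assumes "u \<noteq> v" "v \<noteq> w" "u \<noteq> w"
  shows "triangle u v w = {D. D \<subseteq> {u, v, w} \<and> card D = 2}"
proof
  show "triangle u v w \<subseteq> {D. D \<subseteq> {u, v, w} \<and> card D = 2}"
    using assms by (simp add: triangle_def)
  show "{D. D \<subseteq> {u, v, w} \<and> card D = 2} \<subseteq> triangle u v w"
  proof
    fix D assume "D \<in> {D. D \<subseteq> {u, v, w} \<and> card D = 2}"
    then obtain x y where "D = {x, y}" "x \<noteq> y" "x \<in> {u, v, w}" "y \<in> {u, v, w}"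
      by (auto simp: card_2_iff)
    then show "D \<in> triangle u v w" unfolding triangle_def by (elim insertE emptyE) (simp_all add: insert_commute)
  qed
qed

text \<open>The hockey-stick identity; together with Pascal's rule it absorbs the first sum of
  \<open>sphere_count\<close> into \<open>card A choose 3\<close>.\<close>

lemma sum_choose_2: "(\<Sum>k = 2..n. k choose 2) = Suc n choose 3"
proof (induction n)
  case (Suc n)
  show ?case
  proof (cases "2 \<le> Suc n")
    case True
    then have "(\<Sum>k = 2..Suc n. k choose 2) = (\<Sum>k = 2..n. k choose 2) + (Suc n choose 2)"
      by (simp add: sum.atLeast_Suc_atMost_Suc_shift atLeastAtMostSuc_conv)
    then show ?thesis using Suc binomial_Suc_Suc[of "Suc n" 2] by (simp add: numeral_3_eq_3 numeral_2_eq_2)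
  next
    case False
    then show ?thesis by (simp add: binomial_eq_0)
  qed
qed simp

text \<open>Positions count from 0: level \<open>k\<close> means lying in the gap between the
  entries at \<open>k - 1\<close> and \<open>k\<close>, and the gap for \<open>k = 0\<close> has no
  lower entry.\<close>

lemma level_eq_iff:
  fixes y :: nat
  assumes fin: "finite A" and k: "k < card A" and y: "y \<notin> A"
  shows "card {x \<in> A. x < y} = k \<longleftrightarrow> y < sorted_list_of_set A ! k \<and> (k = 0 \<or> sorted_list_of_set A ! (k - 1) < y)"
proof -
  let ?a = "\<lambda>i. sorted_list_of_set A ! i"
  have inj: "inj_on ?a {..<card A}"
    by (rule inj_onI) (metis fin lessThan_iff linorder_neqE_nat nth_sorted_less order_less_irrefl)
  have up: "j \<le> card {x \<in> A. x < y}" if "j \<le> card A" "j = 0 \<or> ?a (j - 1) < y" for j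
  proof -
    have "?a ` {..<j} \<subseteq> {x \<in> A. x < y}"
    proof (rule image_subsetI)
      fix i assume i: "i \<in> {..<j}"
      then have "?a i \<le> ?a (j - 1)" using nth_sorted_le[OF fin, of i "j - 1"] that by auto
      then show "?a i \<in> {x \<in> A. x < y}" using that i nth_sorted_mem[OF fin, of i] by auto
    qed
    then have "card (?a ` {..<j}) \<le> card {x \<in> A. x < y}" using fin by (intro card_mono) auto
    moreover have "card (?a ` {..<j}) = j"
      using inj_on_subset[OF inj, of "{..<j}"] that by (subst card_image) auto
    ultimately show ?thesis by simp
  qed
  have down: "card {x \<in> A. x < y} \<le> j" if "j < card A" "y < ?a j" for j
  proof -
    have "{x \<in> A. x < y} \<subseteq> ?a ` {..<j}"
    proof
      fix x assume x: "x \<in> {x \<in> A. x < y}"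
      then obtain i where i: "i < card A" "x = ?a i" using nth_sorted_obtain[OF fin, of x] by blast
      have "i < j"
      proof (rule ccontr)
        assume "\<not> i < j"
        then have "?a j \<le> ?a i" using nth_sorted_le[OF fin, of j i] i by simp
        then show False using x i that by simp
      qed
      then show "x \<in> ?a ` {..<j}" using i by blast
    qed
    then have "card {x \<in> A. x < y} \<le> card (?a ` {..<j})" by (intro card_mono) auto
    also have "\<dots> \<le> j" using card_image_le[of "{..<j}" ?a] by simp
    finally show ?thesis .
  qed
  have ne: "?a j \<noteq> y" if "j < card A" for j using nth_sorted_mem[OF fin that] y by blast
  show ?thesis
  proof
    assume c: "card {x \<in> A. x < y} = k"
    have "\<not> ?a k < y" using up[of "Suc k"] c k by auto
    then have "y < ?a k" using ne[OF k] by simp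
    moreover have "?a (k - 1) < y" if "k \<noteq> 0"
    proof (rule ccontr)
      assume n: "\<not> ?thesis"
      have "k - 1 < card A" using k by simp
      from ne[OF this] n have "y < ?a (k - 1)" by linarith
      from down[OF \<open>k - 1 < card A\<close> this] c \<open>k \<noteq> 0\<close> show False by linarith
    qed
    ultimately show "y < ?a k \<and> (k = 0 \<or> ?a (k - 1) < y)" by blast
  next
    assume "y < ?a k \<and> (k = 0 \<or> ?a (k - 1) < y)"
    then show "card {x \<in> A. x < y} = k" using up[of k] down[of k] k by simp
  qed
qed

text \<open>Group the \<open>y\<close> outside \<open>A\<close> by the number \<open>k\<close> of
  elements of \<open>A\<close> below them: for \<open>k < n\<close> they fill one gap, and
  \<open>n - k - 1\<close> elements of \<open>A\<close> lie between them and the maximum. The first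
  gap is one larger than the number of its \<open>y\<close>; the surplus
  \<open>(n - 1) choose 2\<close> joins the first sum to give \<open>n choose 3\<close>.\<close>

lemma sphere_count_eq:
  assumes A: "A \<subseteq> {1..m}" and n: "3 \<le> card A"
  shows "sphere_count A = (card A choose 3) + (\<Sum>y\<in>{1..m} - A. card {x \<in> A. y < x \<and> x < Max A} choose 2)"
proof -
  define n where "n = card A"
  define f where "f k = k choose 2" for k
  define lvl where "lvl y = card {x \<in> A. x < y}" for y
  let ?a = "\<lambda>i. sorted_list_of_set A ! i" and ?Y = "{1..m} - A"
  have fin: "finite A" using A finite_subset by blast
  have n3: "3 \<le> n" using n by (simp add: n_def)
  \<comment> \<open>Leaving out \<open>Max A\<close> costs one element; for a \<open>y\<close> above
    all of \<open>A\<close> both sides are 0 by truncated subtraction.\<close>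
  have above: "card {x \<in> A. y < x \<and> x < Max A} = n - lvl y - 1" if y: "y \<in> ?Y" for y
  proof -
    have "x < y \<or> y < x" if "x \<in> A" for x using that y by (metis DiffD2 nat_neq_iff)
    then have "A = {x \<in> A. x < y} \<union> {x \<in> A. y < x}" by blast
    moreover have "card ({x \<in> A. x < y} \<union> {x \<in> A. y < x}) = lvl y + card {x \<in> A. y < x}"
      unfolding lvl_def using fin by (intro card_Un_disjoint) auto
    ultimately have 1: "card {x \<in> A. y < x} = n - lvl y" unfolding n_def by (metis diff_add_inverse)
    show ?thesis
    proof (cases "{x \<in> A. y < x} = {}")
      case True
      then have "{x \<in> A. y < x \<and> x < Max A} = {}" by blast
      then show ?thesis using 1 True by (metis card.empty diff_0_eq_0)
    next
      case False
      then obtain x where "x \<in> A" "y < x" by blast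
      have "Max A \<in> A" using fin \<open>x \<in> A\<close> Max_in by blast
      moreover have "y < Max A" using Max_ge[OF fin \<open>x \<in> A\<close>] \<open>y < x\<close> by linarith
      ultimately have "Max A \<in> {x \<in> A. y < x}" by simp
      moreover have "{x \<in> A. y < x \<and> x < Max A} = {x \<in> A. y < x} - {Max A}"
        using Max_ge[OF fin] by (auto intro: le_neq_implies_less)
      ultimately show ?thesis using 1 fin by simp
    qed
  qed
  have lvl_le: "lvl y \<le> n" for y unfolding lvl_def n_def using fin by (intro card_mono) auto
  have "(\<Sum>y\<in>?Y. f (n - lvl y - 1)) = (\<Sum>k\<in>{..n}. \<Sum>y\<in>{y\<in>?Y. lvl y = k}. f (n - lvl y - 1))"
    using lvl_le by (intro sum.group[symmetric]) auto
  also have "\<dots> = (\<Sum>k\<in>{..n}. card {y\<in>?Y. lvl y = k} * f (n - k - 1))"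
    by (intro sum.cong) auto
  also have "\<dots> = (\<Sum>k<n - 2. card {y\<in>?Y. lvl y = k} * f (n - k - 1))"
  proof (intro sum.mono_neutral_right ballI)
    fix k assume "k \<in> {..n} - {..<n - 2}"
    then have "n - k - 1 < 2" by auto
    then show "card {y\<in>?Y. lvl y = k} * f (n - k - 1) = 0" by (simp add: f_def binomial_eq_0)
  qed auto
  finally have 1: "(\<Sum>y\<in>?Y. f (n - lvl y - 1)) = (\<Sum>k<n - 2. card {y\<in>?Y. lvl y = k} * f (n - k - 1))" .
  have a0: "1 \<le> ?a 0" using nth_sorted_mem[OF fin, of 0] A n by fastforce
  \<comment> \<open>The first gap is the least element of \<open>A\<close> itself and so counts from
    0, whereas \<open>y\<close> starts at 1; this is the extra 1 at \<open>k = 0\<close>.\<close>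
  have 2: "gap A (Suc k) = card {y\<in>?Y. lvl y = k} + (if k = 0 then 1 else 0)" if k: "k < n - 2" for k
  proof -
    have kn: "k < card A" using k by (simp add: n_def)
    let ?lo = "if k = 0 then 1 else Suc (?a (k - 1))"
    have "{y\<in>?Y. lvl y = k} = {?lo..<?a k}"
    proof (rule set_eqI)
      fix y
      have am: "?a k \<le> m" using nth_sorted_mem[OF fin kn] A by auto
      have notA: "y \<notin> A" if y: "y \<in> {?lo..<?a k}"
      proof
        assume "y \<in> A"
        then obtain j where j: "j < card A" "y = ?a j" using nth_sorted_obtain[OF fin] by blast
        then have "j < k" using y nth_sorted_le[OF fin, of k j] by (meson atLeastLessThan_iff leD not_le)
        then have "?a j \<le> ?a (k - 1)" "k \<noteq> 0" using nth_sorted_le[OF fin, of j "k - 1"] kn by auto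
        then show False using y j by auto
      qed
      show "y \<in> {y\<in>?Y. lvl y = k} \<longleftrightarrow> y \<in> {?lo..<?a k}"
      proof
        assume "y \<in> {y\<in>?Y. lvl y = k}"
        then show "y \<in> {?lo..<?a k}" using level_eq_iff[OF fin kn, of y] by (auto simp: lvl_def)
      next
        assume y: "y \<in> {?lo..<?a k}"
        then have "1 \<le> y" by (auto split: if_splits)
        moreover have "y \<le> m" using y am by auto
        moreover have "lvl y = k" using level_eq_iff[OF fin kn notA[OF y]] y by (auto simp: lvl_def split: if_splits)
        ultimately show "y \<in> {y\<in>?Y. lvl y = k}" using notA[OF y] by simp
      qed
    qed
    then have "card {y\<in>?Y. lvl y = k} = ?a k - ?lo" by simp
    then show ?thesis using a0 by (auto simp: gap_def nth_elem_def)
  qed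
  have "(\<Sum>l = 1..n - 2. gap A l * ((n - l) choose 2)) = (\<Sum>k<n - 2. gap A (Suc k) * f (n - Suc k))"
    by (simp add: sum.atLeast1_atMost_eq f_def)
  also have "\<dots> = (\<Sum>k<n - 2. card {y\<in>?Y. lvl y = k} * f (n - k - 1) + (if k = 0 then f (n - 1) else 0))"
    by (intro sum.cong) (auto simp: 2 distrib_right)
  also have "\<dots> = (\<Sum>k<n - 2. card {y\<in>?Y. lvl y = k} * f (n - k - 1)) + f (n - 1)"
    using n3 by (simp add: sum.distrib)
  finally have 3: "(\<Sum>l = 1..n - 2. gap A l * ((n - l) choose 2)) = (\<Sum>y\<in>?Y. f (n - lvl y - 1)) + f (n - 1)"
    using 1 by simp
  have "n = Suc (Suc (n - 2))" using n3 by simp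
  then have 4: "n choose 3 = f (n - 1) + (\<Sum>k = 2..n - 2. k choose 2)"
    unfolding sum_choose_2 f_def by (metis binomial_Suc_Suc diff_Suc_1 numeral_2_eq_2 numeral_3_eq_3)
  have 5: "(\<Sum>y\<in>?Y. card {x \<in> A. y < x \<and> x < Max A} choose 2) = (\<Sum>y\<in>?Y. f (n - lvl y - 1))"
    by (intro sum.cong) (simp_all add: above f_def)
  have "sphere_count A = (\<Sum>k = 2..n - 2. k choose 2) + (\<Sum>l = 1..n - 2. gap A l * ((n - l) choose 2))"
    by (simp add: sphere_count_def n_def Let_def)
  also have "\<dots> = (n choose 3) + (\<Sum>y\<in>?Y. card {x \<in> A. y < x \<and> x < Max A} choose 2)"
    unfolding 3 4 5 by simp
  finally show ?thesis by (simp add: n_def)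
qed

section \<open>Counting the removed triangles\<close>

context cube_link
begin

definition pairs :: "nat set \<Rightarrow> nat set set" where "pairs S = {D. D \<subseteq> S \<and> card D = 2}"

lemma pairs_triangle: "u < v \<Longrightarrow> v < w \<Longrightarrow> pairs {u, v, w} = triangle u v w"
  unfolding pairs_def using triangle_eq_pairs[of u v w] by simp

text \<open>The union recovers a triple from its triangle, which makes the parametrisations of
  \<open>T1\<close> and \<open>T2\<close> injective.\<close>

lemma Union_pairs: "card S = 3 \<Longrightarrow> \<Union>(pairs S) = S"
  by (erule card_3_sorted) (simp add: pairs_triangle Union_triangle)

lemma card_T1: "card T1 = card A choose 3"
proof -
  let ?S = "{S. S \<subseteq> A \<and> card S = 3}"
  have "T1 = pairs ` ?S"
  proof (rule set_eqI)
    fix \<tau>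
    show "\<tau> \<in> T1 \<longleftrightarrow> \<tau> \<in> pairs ` ?S"
    proof
      assume "\<tau> \<in> T1"
      then obtain u v w where "\<tau> = triangle u v w" "u \<in> A" "v \<in> A" "w \<in> A" "u < v" "v < w"
        unfolding T1_def by blast
      then have "\<tau> = pairs {u, v, w}" "{u, v, w} \<in> ?S" by (simp_all add: pairs_triangle)
      then show "\<tau> \<in> pairs ` ?S" by (rule image_eqI)
    next
      assume "\<tau> \<in> pairs ` ?S"
      then obtain S where S: "\<tau> = pairs S" "S \<subseteq> A" "card S = 3" by blast
      obtain u v w where uvw: "S = {u, v, w}" "u < v" "v < w" using card_3_sorted[OF S(3)] by blast
      then have "\<tau> = triangle u v w" "u \<in> A" "v \<in> A" "w \<in> A" using S by (simp_all add: pairs_triangle)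
      then show "\<tau> \<in> T1" using uvw unfolding T1_def by blast
    qed
  qed
  moreover have "inj_on pairs ?S"
    by (rule inj_onI) (metis (mono_tags, lifting) Union_pairs mem_Collect_eq)
  ultimately have "card T1 = card ?S" by (simp add: card_image)
  then show ?thesis using n_subsets[OF finite_A] by simp
qed

text \<open>The triple of such a triangle has exactly one element in \<open>Y\<close> and the others
  in \<open>A\<close>, so the triangle determines both \<open>y\<close> and the pair above
  it.\<close>

lemma card_T2: "card T2 = (\<Sum>y\<in>Y. card {x \<in> A. y < x \<and> x < z} choose 2)"
proof -
  let ?P = "\<lambda>y. {P. P \<subseteq> {x \<in> A. y < x \<and> x < z} \<and> card P = 2}"
  let ?f = "\<lambda>(y, P). pairs (insert y P)"
  have fin: "finite (?P y)" for y
    by (rule finite_subset[of _ "Pow A"]) (use finite_A in auto)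
  have c3: "card (insert y P) = 3" if "P \<in> ?P y" for y P
  proof -
    have "finite P" "y \<notin> P" using that finite_A by (auto intro: card_ge_0_finite)
    then show ?thesis using that by simp
  qed
  have "T2 = ?f ` (SIGMA y:Y. ?P y)"
  proof (rule set_eqI)
    fix \<tau>
    show "\<tau> \<in> T2 \<longleftrightarrow> \<tau> \<in> ?f ` (SIGMA y:Y. ?P y)"
    proof
      assume "\<tau> \<in> T2"
      then obtain u v w where *: "\<tau> = triangle u v w" "u \<in> Y" "v \<in> A" "w \<in> A" "u < v" "v < w" "w < z"
        unfolding T2_def by blast
      then have "\<tau> = ?f (u, {v, w})" by (simp add: pairs_triangle)
      moreover have "(u, {v, w}) \<in> (SIGMA y:Y. ?P y)" using * by simp
      ultimately show "\<tau> \<in> ?f ` (SIGMA y:Y. ?P y)" by (rule image_eqI)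
    next
      assume "\<tau> \<in> ?f ` (SIGMA y:Y. ?P y)"
      then obtain y P where *: "\<tau> = pairs (insert y P)" "y \<in> Y" "P \<in> ?P y" by auto
      then obtain a b where ab: "P = {a, b}" "a \<noteq> b" by (auto simp: card_2_iff)
      define v where "v = min a b"
      define w where "w = max a b"
      have P: "P = {v, w}" "v < w" using ab by (auto simp: v_def w_def min_def max_def)
      then have "y < v" "v \<in> A" "w \<in> A" "w < z" using * by auto
      then show "\<tau> \<in> T2" using * P unfolding T2_def by (auto simp: pairs_triangle)
    qed
  qed
  moreover have "inj_on ?f (SIGMA y:Y. ?P y)"
  proof (rule inj_onI)
    fix p q assume p: "p \<in> (SIGMA y:Y. ?P y)" and q: "q \<in> (SIGMA y:Y. ?P y)" and eq: "?f p = ?f q"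
    obtain y P y' P' where yP: "p = (y, P)" "q = (y', P')" by (cases p, cases q)
    have m: "y \<in> Y" "P \<in> ?P y" "y' \<in> Y" "P' \<in> ?P y'" using p q yP by simp_all
    have "\<Union>(pairs (insert y P)) = \<Union>(pairs (insert y' P'))" using eq yP by simp
    then have ins: "insert y P = insert y' P'" using Union_pairs[OF c3[OF m(2)]] Union_pairs[OF c3[OF m(4)]] by simp
    have sub: "P \<subseteq> A" "P' \<subseteq> A" using m by auto
    then have "y \<notin> P'" "y' \<notin> P" using m(1,3) disjoint by auto
    then have "y = y'" using ins by auto
    moreover have "y \<notin> P" "y' \<notin> P'" using m(1,3) sub disjoint by auto
    ultimately have "P = P'" using ins by (metis Diff_insert_absorb)
    then show "p = q" using yP \<open>y = y'\<close> by simp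
  qed
  ultimately have "card T2 = card (SIGMA y:Y. ?P y)" by (simp add: card_image)
  also have "\<dots> = (\<Sum>y\<in>Y. card (?P y))" using finite_Y fin by (intro card_SigmaI) auto
  also have "\<dots> = (\<Sum>y\<in>Y. card {x \<in> A. y < x \<and> x < z} choose 2)"
    using finite_A by (intro sum.cong refl n_subsets) simp
  finally show ?thesis .
qed

end

section \<open>The main theorem\<close>

lemma sym_diff_involution: "sym_diff A (sym_diff A D) = D"
  by blast

lemma card_sym_diff:
  assumes "finite A" "finite D"
  shows "card (sym_diff A D) + 2 * card (A \<inter> D) = card A + card D"
proof -
  have "card (sym_diff A D) = card (A - D) + card (D - A)"
    using assms by (intro card_Un_disjoint) auto
  moreover have "card A = card (A - D) + card (A \<inter> D)" using assms(1) by (metis card_Int_Diff add.commute)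
  moreover have "card D = card (D - A) + card (A \<inter> D)" using assms(2) by (metis card_Int_Diff add.commute inf_commute)
  ultimately show ?thesis by linarith
qed

text \<open>Symmetric difference with a fixed set is an involution and leaves
  \<open>sym_diff D E\<close> unchanged, so it is an isometry.\<close>

lemma vietoris_rips_translate:
  "(`) (sym_diff A) ` vietoris_rips symdiff_dist F 2 = vietoris_rips symdiff_dist (sym_diff A ` F) 2"
proof -
  let ?g = "sym_diff A"
  have gg: "?g (?g D) = D" for D by (rule sym_diff_involution)
  have gg': "?g ` ?g ` S = S" for S unfolding image_image gg by simp
  have n: "near (?g D) (?g E) \<longleftrightarrow> near D E" for D E
  proof -
    have "sym_diff (?g D) (?g E) = sym_diff D E" by blast
    then show ?thesis unfolding near_def by (rule arg_cong)
  qed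
  have fwd: "?g ` S \<in> vietoris_rips symdiff_dist (?g ` F) 2" if "S \<in> vietoris_rips symdiff_dist F 2" for S F
    using that unfolding mem_vietoris_rips_2 by (simp add: n image_mono)
  show ?thesis
  proof
    show "(`) ?g ` vietoris_rips symdiff_dist F 2 \<subseteq> vietoris_rips symdiff_dist (?g ` F) 2"
      using fwd by (rule image_subsetI)
    show "vietoris_rips symdiff_dist (?g ` F) 2 \<subseteq> (`) ?g ` vietoris_rips symdiff_dist F 2"
    proof
      fix S assume "S \<in> vietoris_rips symdiff_dist (?g ` F) 2"
      then have "?g ` S \<in> vietoris_rips symdiff_dist F 2" using fwd[of S "?g ` F"] unfolding gg' by simp
      then show "S \<in> (`) ?g ` vietoris_rips symdiff_dist F 2" by (rule rev_image_eqI) (simp only: gg')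
    qed
  qed
qed

lemma realization_translate:
  assumes "finite F"
  shows "geometric_realization (vietoris_rips symdiff_dist F 2) homotopy_equivalent_space
    geometric_realization (vietoris_rips symdiff_dist (sym_diff A ` F) 2)"
  using homeomorphic_realization_involution(2)[OF finite_complex_vietoris_rips[OF assms], of "sym_diff A"]
  unfolding vietoris_rips_translate
  by (intro homeomorphic_imp_homotopy_equivalent_space) (metis sym_diff_involution)

section \<open>The family below \<open>A\<close>, translated so that \<open>A\<close> becomes the
  empty set\<close>

context
  fixes m :: nat and A :: "nat set"
  assumes A: "A \<subseteq> {1..m}" and card_A: "3 \<le> card A"
begin

text \<open>The translate of the whole family below \<open>A\<close>: besides the neighbours of
  \<open>{}\<close> it holds the larger sets that serve as second apexes of the octahedra.\<close>

definition link_family :: "nat set set" where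
  "link_family = {D. D \<subseteq> {1..m} \<and> set_prec (sym_diff A D) A}"

lemma finite_A': "finite A"
  using A finite_subset by blast

text \<open>Since \<open>sym_diff A D\<close> has
  \<open>card A + card D - 2 * card (A \<inter> D)\<close> elements, it precedes \<open>A\<close> by
  size when more than half of \<open>D\<close> lies in \<open>A\<close>; at exactly half, the
  lexicographic order decides.\<close>

lemma link_family_iff:
  assumes D: "D \<subseteq> {1..m}"
  shows "D \<in> link_family \<longleftrightarrow> card D < 2 * card (A \<inter> D) \<or>
    (card D = 2 * card (A \<inter> D) \<and> precedes (sym_diff A D) A)"
proof -
  have fD: "finite D" using D finite_subset by blast
  have "finite (sym_diff A D)" using finite_A' fD by simp
  then show ?thesis
    unfolding link_family_def using D card_sym_diff[OF finite_A' fD] set_prec_iff[of "sym_diff A D" A] finite_A' by auto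
qed

text \<open>The exchange changes membership at \<open>w\<close> and \<open>x\<close> only, so the
  smaller of these two decides the order.\<close>

lemma precedes_exchange:
  assumes "x \<in> A" "w \<notin> A"
  shows "precedes (sym_diff A {w, x}) A \<longleftrightarrow> w < x"
proof
  assume "precedes (sym_diff A {w, x}) A"
  then obtain e where e: "e \<in> sym_diff A {w, x}" "e \<notin> A" "\<And>d. d < e \<Longrightarrow> d \<in> sym_diff A {w, x} \<longleftrightarrow> d \<in> A"
    unfolding precedes_def by blast
  have "e = w" using e(1,2) assms by auto
  moreover have "x \<notin> sym_diff A {w, x}" using assms by simp
  ultimately show "w < x" using e(3)[of x] assms by (metis nat_neq_iff)
next
  assume "w < x"
  then show "precedes (sym_diff A {w, x}) A"
    unfolding precedes_def using assms by (intro bexI[of _ w]) auto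
qed

lemma small_link_family:
  "D \<in> link_family \<and> card D \<le> 2 \<longleftrightarrow>
    (\<exists>x\<in>A. D = {x}) \<or> (\<exists>x\<in>A. \<exists>w. w \<noteq> x \<and> (w \<in> A \<or> w \<in> {1..m} - A \<and> w < x) \<and> D = {w, x})"
proof
  assume D: "D \<in> link_family \<and> card D \<le> 2"
  then have Dm: "D \<subseteq> {1..m}" by (simp add: link_family_def)
  then have fD: "finite D" using finite_subset by blast
  have c: "card D < 2 * card (A \<inter> D) \<or> (card D = 2 * card (A \<inter> D) \<and> precedes (sym_diff A D) A)"
    using D link_family_iff[OF Dm] by blast
  have "D \<noteq> {}"
  proof
    assume "D = {}"
    then have "precedes A A" using c by simp
    then show False using precedes_asym by blast
  qed
  then have "card D = 1 \<or> card D = 2" using D fD by (metis card_0_eq le_SucE le_zero_eq numeral_2_eq_2 One_nat_def)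
  then show "(\<exists>x\<in>A. D = {x}) \<or> (\<exists>x\<in>A. \<exists>w. w \<noteq> x \<and> (w \<in> A \<or> w \<in> {1..m} - A \<and> w < x) \<and> D = {w, x})"
  proof
    assume "card D = 1"
    then obtain x where x: "D = {x}" using card_1_singletonE by blast
    have "x \<in> A" using c x by (cases "x \<in> A") auto
    then show ?thesis using x by blast
  next
    assume "card D = 2"
    then obtain a b where ab: "D = {a, b}" "a \<noteq> b" by (auto simp: card_2_iff)
    consider "a \<in> A" "b \<in> A" | "a \<in> A" "b \<notin> A" | "a \<notin> A" "b \<in> A" | "a \<notin> A" "b \<notin> A" by blast
    then show ?thesis
    proof cases
      case 1
      then show ?thesis using ab by blast
    next
      case 2
      then have "A \<inter> D = {a}" using ab by auto
      then have "precedes (sym_diff A {b, a}) A" using c ab by (simp add: insert_commute)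
      then have "b < a" using precedes_exchange[OF 2] by simp
      moreover have "D = {b, a}" "b \<in> {1..m} - A" using ab Dm 2 by auto
      ultimately show ?thesis using 2 ab by blast
    next
      case 3
      then have "A \<inter> D = {b}" using ab by auto
      then have "precedes (sym_diff A {a, b}) A" using c ab by simp
      then have "a < b" using precedes_exchange[OF 3(2,1)] by simp
      moreover have "a \<in> {1..m} - A" using ab Dm 3 by auto
      ultimately show ?thesis using 3 ab by blast
    next
      case 4
      then have "A \<inter> D = {}" using ab by auto
      then show ?thesis using c ab by simp
    qed
  qed
next
  assume "(\<exists>x\<in>A. D = {x}) \<or> (\<exists>x\<in>A. \<exists>w. w \<noteq> x \<and> (w \<in> A \<or> w \<in> {1..m} - A \<and> w < x) \<and> D = {w, x})"
  then show "D \<in> link_family \<and> card D \<le> 2"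
  proof (elim disjE bexE exE conjE)
    fix x assume x: "x \<in> A" "D = {x}"
    then have "D \<subseteq> {1..m}" "A \<inter> D = {x}" using A by auto
    then show ?thesis using link_family_iff[of D] x by simp
  next
    fix x w assume x: "x \<in> A" "w \<noteq> x" "D = {w, x}" "w \<in> A"
    then have "D \<subseteq> {1..m}" "A \<inter> D = {w, x}" using A by auto
    then show ?thesis using link_family_iff[of D] x by simp
  next
    fix x w assume x: "x \<in> A" "w \<noteq> x" "D = {w, x}" "w \<in> {1..m} - A" "w < x"
    then have "D \<subseteq> {1..m}" "A \<inter> D = {x}" using A by auto
    then show ?thesis using link_family_iff[of D] x precedes_exchange[of x w] by simp
  qed
qed

interpretation cube_link A "{1..m} - A" link_family
proof
  show "finite A" by (rule finite_A')
  show "A \<noteq> {}" using card_A by auto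
  show "A \<inter> ({1..m} - A) = {}" "finite ({1..m} - A)" by auto
  show "finite link_family"
    by (rule finite_subset[of _ "Pow {1..m}"]) (auto simp: link_family_def)
  show "finite D" if "D \<in> link_family" for D
    using that finite_subset[of D "{1..m}"] by (simp add: link_family_def)
  show "{} \<notin> link_family"
    using link_family_iff[of "{}"] precedes_asym[of A A] by auto
  show "D \<in> link_family \<and> card D \<le> 2 \<longleftrightarrow>
    (\<exists>x\<in>A. D = {x}) \<or> (\<exists>x\<in>A. \<exists>w. w \<noteq> x \<and> (w \<in> A \<or> w \<in> {1..m} - A \<and> w < x) \<and> D = {w, x})" for D
    by (rule small_link_family)
  show "{u, v, w} \<in> link_family" if "u \<in> A" "v \<in> A" "w \<in> A" "u < v" "v < w" for u v w
  proof -
    have "{u, v, w} \<subseteq> {1..m}" "A \<inter> {u, v, w} = {u, v, w}" using that A by auto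
    then show ?thesis using link_family_iff[of "{u, v, w}"] that by simp
  qed
  show "{u, v, w, Max A} \<in> link_family"
    if "u \<in> {1..m} - A" "v \<in> A" "w \<in> A" "u < v" "v < w" "w < Max A" for u v w
  proof -
    have "Max A \<in> A" using finite_A' that(2) Max_in by blast
    then have "{u, v, w, Max A} \<subseteq> {1..m}" "A \<inter> {u, v, w, Max A} = {v, w, Max A}" using that A by auto
    \<comment> \<open>Three of the four elements lie in \<open>A\<close>, so the translated set
      comes before \<open>A\<close> by size alone.\<close>
    then show ?thesis using link_family_iff[of "{u, v, w, Max A}"] that by simp
  qed
qed

text \<open>The tower is left arbitrary, so that the same vertex step yields the sphere, the bouquet
  and the wedge. Translation by \<open>A\<close> identifies the families before and after the step
  with \<open>link_family\<close> and \<open>insert {} link_family\<close>.\<close>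

lemma VR_preceq_tower:
  assumes Z: "cell_tower Z (sphere_count A)" and eqv: "VR_prec m A homotopy_equivalent_space Z 0"
  shows "VR_preceq m A homotopy_equivalent_space Z (sphere_count A)"
proof -
  let ?g = "sym_diff A"
  have gg: "?g (?g D) = D" for D by (rule sym_diff_involution)
  have sub: "?g D \<subseteq> {1..m} \<longleftrightarrow> D \<subseteq> {1..m}" for D using A by blast
  have prec: "?g ` link_family = family_prec m A"
  proof
    show "?g ` link_family \<subseteq> family_prec m A"
      using sub by (auto simp: link_family_def family_prec_def)
    show "family_prec m A \<subseteq> ?g ` link_family"
    proof
      fix B assume B: "B \<in> family_prec m A"
      then have "B \<subseteq> {1..m}" "set_prec B A" by (simp_all add: family_prec_def)
      then have "?g B \<in> link_family" unfolding link_family_def mem_Collect_eq gg sub by blast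
      then show "B \<in> ?g ` link_family" by (rule rev_image_eqI) (simp only: gg)
    qed
  qed
  have "?g {} = A" by simp
  then have preceq: "?g ` insert {} link_family = family_preceq m A"
    unfolding image_insert prec family_preceq_def by simp
  have "geometric_realization (vietoris_rips symdiff_dist link_family 2) homotopy_equivalent_space Z 0"
    using realization_translate[OF finite_G, of A] eqv unfolding prec by (rule homotopy_eqv_trans)
  then have "geometric_realization (vietoris_rips symdiff_dist (insert {} link_family) 2)
      homotopy_equivalent_space Z (sphere_count A)"
    using attach_link[OF Z] sphere_count_eq[OF A card_A] card_T1 card_T2 by simp
  moreover have "geometric_realization (vietoris_rips symdiff_dist (insert {} link_family) 2)
      homotopy_equivalent_space VR_preceq m A"
    using realization_translate[of "insert {} link_family" A] finite_G unfolding preceq by simp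
  ultimately show ?thesis
    using homotopy_eqv_trans homotopy_equivalent_space_sym by blast
qed

end

section \<open>Induction along the order\<close>

lemma homotopy_equivalent_contractible_spaces:
  assumes X: "contractible_space X" "topspace X \<noteq> {}" and Y: "contractible_space Y" "topspace Y \<noteq> {}"
  shows "X homotopy_equivalent_space Y"
proof -
  obtain a b where a: "a \<in> topspace X" and b: "b \<in> topspace Y" using X Y by blast
  have "homotopic_with (\<lambda>_. True) X X ((\<lambda>_. a) \<circ> (\<lambda>_. b)) id"
    using X(1) a unfolding contractible_space_alt by (simp add: comp_def homotopic_with_sym)
  moreover have "homotopic_with (\<lambda>_. True) Y Y ((\<lambda>_. b) \<circ> (\<lambda>_. a)) id"
    using Y(1) b unfolding contractible_space_alt by (simp add: comp_def homotopic_with_sym)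
  moreover have "continuous_map X Y (\<lambda>_. b)" "continuous_map Y X (\<lambda>_. a)" using a b by simp_all
  ultimately show ?thesis unfolding homotopy_equivalent_space_def by blast
qed

text \<open>The homotopy from \<open>g \<circ> f\<close> to the identity joins each \<open>x\<close>
  to \<open>g (f x)\<close>, and \<open>g\<close> carries over the paths of \<open>Y\<close>; paths
  are handled as homotopies between constant maps.\<close>

lemma path_connected_space_homotopy_equivalent:
  assumes "X homotopy_equivalent_space Y" and Y: "path_connected_space Y"
  shows "path_connected_space X"
proof -
  obtain f g where f: "continuous_map X Y f" and g: "continuous_map Y X g"
    and gf: "homotopic_with (\<lambda>_. True) X X (g \<circ> f) id"
    using assms(1) unfolding homotopy_equivalent_space_def by blast
  have fY: "f x \<in> topspace Y" if "x \<in> topspace X" for x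
    using that continuous_map_image_subset_topspace[OF f] by blast
  have 1: "path_component_of X (g (f x)) x" if x: "x \<in> topspace X" for x
  proof -
    have "continuous_map X X (\<lambda>_. x)" using x by simp
    from homotopic_with_compose_continuous_map_right[OF gf this, of "\<lambda>_. True"]
    have "homotopic_with (\<lambda>_. True) X X (\<lambda>_. g (f x)) (\<lambda>_. x)" by (simp add: comp_def)
    then show ?thesis using x by (auto simp: homotopic_constant_maps)
  qed
  have 2: "path_component_of X (g (f x)) (g (f y))" if x: "x \<in> topspace X" and y: "y \<in> topspace X" for x y
  proof -
    have "path_component_of Y (f x) (f y)"
      using Y fY[OF x] fY[OF y] by (simp add: path_connected_space_iff_path_component)
    then have "homotopic_with (\<lambda>_. True) X Y (\<lambda>_. f x) (\<lambda>_. f y)" by (simp add: homotopic_constant_maps)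
    from homotopic_with_compose_continuous_map_left[OF this g, of "\<lambda>_. True"]
    have "homotopic_with (\<lambda>_. True) X X (\<lambda>_. g (f x)) (\<lambda>_. g (f y))" by (simp add: comp_def)
    then show ?thesis using x by (auto simp: homotopic_constant_maps)
  qed
  show ?thesis
    unfolding path_connected_space_iff_path_component
  proof (intro ballI)
    fix x y assume x: "x \<in> topspace X" and y: "y \<in> topspace X"
    have "path_component_of X x (g (f y))"
      using path_component_of_trans[OF _ 2[OF x y]] 1[OF x] path_component_of_sym by metis
    then show "path_component_of X x y" using 1[OF y] path_component_of_trans by metis
  qed
qed

lemma finite_family_prec: "finite (family_prec m A)"
  by (rule finite_subset[of _ "Pow {1..m}"]) (auto simp: family_prec_def)

text \<open>Below \<open>{1, 2, 3}\<close> lie exactly the sets with at most two elements. All of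
  them are near \<open>{}\<close>, so the complex is a cone.\<close>

lemma VR_prec_123: "VR_prec m {1, 2, 3} homotopy_equivalent_space sphere_bouquet 0 3"
  "contractible_space (VR_prec m {1, 2, 3})"
proof -
  let ?F = "family_prec m {1, 2, 3}"
  have F: "B \<in> ?F \<longleftrightarrow> B \<subseteq> {1..m} \<and> card B < 3" for B
    using set_preceq_123(2)[of B m] by (auto simp: family_prec_def)
  have fin: "finite B" if "B \<in> ?F" for B
    using that F finite_subset[of B "{1..m}"] by simp
  have e: "{} \<in> ?F" unfolding F by simp
  have n: "near {} B" if "B \<in> ?F" for B using near_empty[OF fin[OF that]] that unfolding F by simp
  have cone: "insert {} S \<in> vietoris_rips symdiff_dist ?F 2" if "S \<in> vietoris_rips symdiff_dist ?F 2" for S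
  proof -
    have S: "S \<subseteq> ?F" "finite S" "\<And>D E. D \<in> S \<Longrightarrow> E \<in> S \<Longrightarrow> near D E"
      using that unfolding mem_vietoris_rips_2 by simp_all
    have n': "near {} D" if "D \<in> insert {} S" for D using that n e S(1) by (metis insertE subsetD)
    have "near D E" if "D \<in> insert {} S" "E \<in> insert {} S" for D E
      using that n' S(3) near_commute by (metis insertE)
    then show ?thesis using S e unfolding mem_vietoris_rips_2 by simp
  qed
  have "{{}} \<in> vietoris_rips symdiff_dist ?F 2" using e by (simp add: mem_vietoris_rips_2)
  then show c: "contractible_space (VR_prec m {1, 2, 3})"
    using contractible_realization_cone[OF finite_complex_vietoris_rips[OF finite_family_prec] cone] by blast
  have t: "topspace (sphere_bouquet 0 3) = {None}" by (rule topspace_sphere_bouquet_0)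
  have ne: "topspace (VR_prec m {1, 2, 3}) \<noteq> {}"
  proof -
    let ?f = "\<lambda>B. if B = {} then 1 else 0 :: real"
    have "?f \<in> std_simplex {{}}" by (simp add: std_simplex_def)
    then show ?thesis
      using \<open>{{}} \<in> vietoris_rips symdiff_dist ?F 2\<close>
        mem_realization_points[OF finite_complex_vietoris_rips[OF finite_family_prec], of ?f]
      unfolding topspace_geometric_realization by blast
  qed
  have "contractible_space (sphere_bouquet 0 3)"
    by (rule contractible_space_subset_singleton[of _ None]) (simp add: t)
  then show "VR_prec m {1, 2, 3} homotopy_equivalent_space sphere_bouquet 0 3"
    using c ne t homotopy_equivalent_contractible_spaces by blast
qed

text \<open>Either \<open>A\<close> is \<open>{1, 2, 3}\<close>, or the family below
  \<open>A\<close> is the family up to the immediate predecessor \<open>C\<close>, which again has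
  at least three elements; the vertex step for \<open>C\<close> then adds
  \<open>sphere_count C\<close> spheres.\<close>

lemma VR_prec_bouquet:
  assumes "A \<subseteq> {1..m}" "3 \<le> card A"
  shows "VR_prec m A homotopy_equivalent_space
    sphere_bouquet (\<Sum>B | B \<subseteq> {1..m} \<and> 3 \<le> card B \<and> set_prec B A. sphere_count B) 3"
  using assms
proof (induction "card (family_prec m A)" arbitrary: A rule: less_induct)
  case less
  have fin: "finite B" if "B \<subseteq> {1..m}" for B using that finite_subset by blast
  let ?S = "\<lambda>A. {B. B \<subseteq> {1..m} \<and> 3 \<le> card B \<and> set_prec B A}"
  have finS: "finite (?S A)" for A
    by (rule finite_subset[of _ "Pow {1..m}"]) auto
  show ?case
  proof (cases "?S A = {}")
    case True
    have "A = {1, 2, 3}"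
    proof (rule ccontr)
      assume "A \<noteq> {1, 2, 3}"
      then have p: "set_prec {1, 2, 3} A"
        using set_preceq_123(1)[OF less.prems(1)] less.prems(2) by (simp add: set_preceq_def)
      have "3 \<le> m" using card_mono[OF _ less.prems(1)] less.prems(2) by simp
      then have "{1, 2, 3} \<in> ?S A" using p by simp
      then show False using True by blast
    qed
    then show ?thesis using VR_prec_123(1)[of m] unfolding True sum.empty by simp
  next
    case False
    let ?c = "\<lambda>B. card (family_prec m B)"
    \<comment> \<open>The immediate predecessor is found as a member whose initial segment has the
      greatest cardinality.\<close>
    have "Max (?c ` ?S A) \<in> ?c ` ?S A" using False finS by (intro Max_in) auto
    then obtain C where C: "Max (?c ` ?S A) = ?c C" "C \<in> ?S A" by (rule imageE)
    from C(2) have Cm: "C \<subseteq> {1..m}" "3 \<le> card C" "set_prec C A" by simp_all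
    have max: "B = C \<or> set_prec B C" if B: "B \<subseteq> {1..m}" "set_prec B A" for B
    proof (rule ccontr)
      assume n: "\<not> ?thesis"
      then have CB: "set_prec C B" using set_prec_total[OF fin[OF B(1)] fin[OF Cm(1)]] by blast
      have "card C \<le> card B" using CB unfolding set_prec_iff[OF fin[OF Cm(1)] fin[OF B(1)]] by linarith
      then have "B \<in> ?S A" using B Cm by simp
      then have "?c B \<le> Max (?c ` ?S A)" using finS by (intro Max_ge finite_imageI imageI)
      then have "?c B \<le> ?c C" unfolding C(1) .
      moreover have "family_prec m C \<subset> family_prec m B"
      proof
        show "family_prec m C \<subseteq> family_prec m B"
        proof
          fix D assume "D \<in> family_prec m C"
          then have D: "D \<subseteq> {1..m}" "set_prec D C" by (simp_all add: family_prec_def)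
          have "set_prec D B" by (rule set_prec_trans[OF fin[OF D(1)] fin[OF Cm(1)] fin[OF B(1)] D(2) CB])
          then show "D \<in> family_prec m B" using D(1) by (simp add: family_prec_def)
        qed
        have "C \<in> family_prec m B" using CB Cm(1) by (simp add: family_prec_def)
        moreover have "C \<notin> family_prec m C"
          using set_prec_asym[OF fin[OF Cm(1)] fin[OF Cm(1)]] unfolding family_prec_def by blast
        ultimately show "family_prec m C \<noteq> family_prec m B" by blast
      qed
      then have "?c C < ?c B" using finite_family_prec psubset_card_mono by blast
      ultimately show False by simp
    qed
    have down: "set_prec B A" if "B \<subseteq> {1..m}" "set_prec B C" for B
      by (rule set_prec_trans[OF fin[OF that(1)] fin[OF Cm(1)] fin[OF less.prems(1)] that(2) Cm(3)])
    have fam: "family_prec m A = family_preceq m C"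
    proof (rule set_eqI)
      fix B
      show "B \<in> family_prec m A \<longleftrightarrow> B \<in> family_preceq m C"
        using max[of B] down[of B] Cm unfolding family_prec_def family_preceq_def by blast
    qed
    have SA: "?S A = insert C (?S C)"
    proof (rule set_eqI)
      fix B
      show "B \<in> ?S A \<longleftrightarrow> B \<in> insert C (?S C)"
        using max[of B] down[of B] Cm by blast
    qed
    have irr: "\<not> set_prec C C" using set_prec_asym[OF fin[OF Cm(1)] fin[OF Cm(1)]] by blast
    then have CnC: "C \<notin> ?S C" by simp
    have "C \<notin> family_prec m C" using irr by (simp add: family_prec_def)
    then have "?c C < ?c A"
      unfolding fam family_preceq_def using finite_family_prec[of m C] by simp
    then have IH: "VR_prec m C homotopy_equivalent_space sphere_bouquet (\<Sum>B\<in>?S C. sphere_count B) 3"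
      using less.hyps Cm by blast
    have "VR_preceq m C homotopy_equivalent_space
        sphere_bouquet ((\<Sum>B\<in>?S C. sphere_count B) + sphere_count C) 3"
      using VR_preceq_tower[OF Cm(1,2) cell_tower_sphere_bouquet, of "\<Sum>B\<in>?S C. sphere_count B"] IH by simp
    then show ?thesis
      unfolding fam SA using finS[of C] CnC by (simp add: add.commute)
  qed
qed

theorem theorem15:
  fixes m n :: nat and A :: "nat set"
  assumes "n > 2" and "m \<ge> n" and "A \<subseteq> {1..m}" and "card A = n"
  shows "(\<exists>k. VR_preceq m A homotopy_equivalent_space sphere_bouquet k 3) \<and>
    (A = {1, 2, 3} \<longrightarrow> VR_preceq m A homotopy_equivalent_space nsphere 3) \<and>
    (\<forall>A. A \<subseteq> {1..m} \<and> set_prec {1, 2, 3} A \<longrightarrow>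
       (\<forall>x \<in> topspace (VR_prec m A).
          VR_preceq m A homotopy_equivalent_space
            wedge (sphere_bouquet (sphere_count A) 3) bouquet_basepoint (VR_prec m A) x)) \<and>
    (\<forall>A. A \<subseteq> {1..m} \<and> card A \<ge> 3 \<longrightarrow>
       VR_preceq m A homotopy_equivalent_space
         sphere_bouquet
           (\<Sum>B | B \<subseteq> {1..m} \<and> set_preceq {1, 2, 3} B \<and> set_preceq B A. sphere_count B) 3)"
proof -
  have count: "VR_preceq m A homotopy_equivalent_space
      sphere_bouquet (\<Sum>B | B \<subseteq> {1..m} \<and> set_preceq {1, 2, 3} B \<and> set_preceq B A. sphere_count B) 3"
    if A: "A \<subseteq> {1..m}" "3 \<le> card A" for A
  proof -
    let ?S = "{B. B \<subseteq> {1..m} \<and> 3 \<le> card B \<and> set_prec B A}"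
    have "finite ?S" by (rule finite_subset[of _ "Pow {1..m}"]) auto
    moreover have "finite A" using A(1) finite_subset by blast
    then have "A \<notin> ?S" using set_prec_asym[of A A] by auto
    moreover have "{B. B \<subseteq> {1..m} \<and> set_preceq {1, 2, 3} B \<and> set_preceq B A} = insert A ?S"
      using set_preceq_123(1)[of _ m] A by (auto simp: set_preceq_def[of _ A])
    ultimately have "(\<Sum>B | B \<subseteq> {1..m} \<and> set_preceq {1, 2, 3} B \<and> set_preceq B A. sphere_count B)
        = (\<Sum>B\<in>?S. sphere_count B) + sphere_count A" by simp
    then show ?thesis
      using VR_preceq_tower[OF A cell_tower_sphere_bouquet, of "\<Sum>B\<in>?S. sphere_count B"] VR_prec_bouquet[OF A]
      by simp
  qed
  have one: "VR_preceq m {1, 2, 3} homotopy_equivalent_space nsphere 3" if "{1, 2, 3} \<subseteq> {1..m}"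
  proof -
    \<comment> \<open>A tower of length one, from the base point to the whole sphere, matching
      \<open>sphere_count {1, 2, 3} = 1\<close>. It reaches \<open>nsphere 3\<close> itself and not
      only a bouquet with one summand.\<close>
    let ?Z = "\<lambda>j. if j = 0 then subtopology (nsphere 3) {sphere_basepoint} else nsphere 3"
    have "sorted_list_of_set {1, 2, 3::nat} = [1, 2, 3]" by simp
    then have c: "sphere_count {1, 2, 3} = 1" by (simp add: sphere_count_def gap_def nth_elem_def) (simp add: numeral_2_eq_2)
    have t: "topspace (?Z 0) = {sphere_basepoint}" using sphere_basepoint_in_nsphere by auto
    have "contractible_space (?Z 0)" by simp
    moreover have "topspace (VR_prec m {1, 2, 3}) \<noteq> {}"
    proof
      assume "topspace (VR_prec m {1, 2, 3}) = {}"
      then have "VR_prec m {1, 2, 3} = trivial_topology" by (simp add: null_topspace_iff_trivial)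
      then show False
        using VR_prec_123(1)[of m] None_in_sphere_bouquet[of 0 3]
        by (auto simp: homotopy_equivalent_space_def continuous_map_def)
    qed
    ultimately have "VR_prec m {1, 2, 3} homotopy_equivalent_space ?Z 0"
      using VR_prec_123(2)[of m] t homotopy_equivalent_contractible_spaces by blast
    moreover have "3 \<le> card {1, 2, 3::nat}" by simp
    ultimately show ?thesis
      using VR_preceq_tower[OF that, of ?Z] cell_tower_nsphere c by simp
  qed
  \<comment> \<open>Every \<open>x\<close> can be the base point of the wedge: the complex below
    \<open>A\<close> is already known to be equivalent to a bouquet and is therefore path
    connected.\<close>
  have step: "VR_preceq m A homotopy_equivalent_space
      wedge (sphere_bouquet (sphere_count A) 3) bouquet_basepoint (VR_prec m A) x"
    if A: "A \<subseteq> {1..m}" "set_prec {1, 2, 3} A" and x: "x \<in> topspace (VR_prec m A)" for A x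
  proof -
    have cA: "3 \<le> card A" using set_preceq_123(1)[OF A(1)] A(2) by (simp add: set_preceq_def)
    have pc: "path_connected_space (VR_prec m A)"
      by (rule path_connected_space_homotopy_equivalent[OF VR_prec_bouquet[OF A(1) cA] path_connected_sphere_bouquet])
    have "Hausdorff_space (VR_prec m A)"
      by (rule Hausdorff_geometric_realization[OF finite_complex_vietoris_rips[OF finite_family_prec]])
    then have "closedin (VR_prec m A) {x}" using x by (simp add: closedin_Hausdorff_singleton)
    from cell_tower_wedge[OF pc x this]
    have Z: "cell_tower (\<lambda>j. wedge (sphere_bouquet j 3) bouquet_basepoint (VR_prec m A) x) (sphere_count A)" .
    have "VR_prec m A homotopy_equivalent_space wedge (sphere_bouquet 0 3) bouquet_basepoint (VR_prec m A) x"
      by (rule homeomorphic_imp_homotopy_equivalent_space, rule wedge_trivial_homeomorphic)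
         (simp_all add: topspace_sphere_bouquet_0 bouquet_basepoint_def x)
    from VR_preceq_tower[OF A(1) cA Z this] show ?thesis .
  qed
  have cA: "3 \<le> card A" using assms by simp
  show ?thesis
  proof (intro conjI allI impI ballI)
    show "\<exists>k. VR_preceq m A homotopy_equivalent_space sphere_bouquet k 3"
      by (rule exI, rule count[OF assms(3) cA])
    assume "A = {1, 2, 3}"
    then show "VR_preceq m A homotopy_equivalent_space nsphere 3" using one assms(3) by metis
  next
    fix A x assume "A \<subseteq> {1..m} \<and> set_prec {1, 2, 3} A" "x \<in> topspace (VR_prec m A)"
    then show "VR_preceq m A homotopy_equivalent_space
        wedge (sphere_bouquet (sphere_count A) 3) bouquet_basepoint (VR_prec m A) x"
      by (elim conjE) (rule step)
  next
    fix A assume "A \<subseteq> {1..m} \<and> 3 \<le> card A"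
    then show "VR_preceq m A homotopy_equivalent_space
        sphere_bouquet (\<Sum>B | B \<subseteq> {1..m} \<and> set_preceq {1, 2, 3} B \<and> set_preceq B A. sphere_count B) 3"
      by (elim conjE) (rule count)
  qed
qed

end
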